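(* Let $Z$ be a compact metric space with $0<\operatorname{diam}Z<1$ equipped with a doubling measure $\nu$, let $X$ be a hyperbolic filling of $Z$ with parameters $\alpha,\tau>1$, and let $X_\varepsilon$ be the uniformization of $X$ with $\varepsilon=\log\alpha$. Let $1\le p<\infty$, $\beta>0$, $u\in\widetilde N^{1,p}(X_\varepsilon,\mu_\beta)$ and $0<\theta\le1-\beta/(\varepsilon p)$. For $\zeta\in Z$ and $n=0,1,\dots$ let $A_n(\zeta)=A_n\cap B_Z(\zeta,\alpha^{-n})$ and $$u_n(\zeta)=\frac1{\#A_n(\zeta)}\sum_{z\in A_n(\zeta)}u((z,n)).$$ Then $u$ has a trace $\tilde u\in B^\theta_{p,p}(Z)$ given by $\tilde u(\zeta)=\lim_{n\to\infty}u_n(\zeta)$ for $\nu$-a.e. $\zeta\in Z$ (the limit existing for $\nu$-a.e. $\zeta$), with the (semi)norm estimates $$\|\tilde u\|_{\theta,p}\lesssim\|g_u\|_{L^p(X_\varepsilon,\mu_\beta)}$$ and $$\|\tilde u\|_{L^p(Z)}\lesssim|u(v_0)|+\|g_u\|_{L^p(X_\varepsilon,\mu_\beta)}\lesssim\|u\|_{N^{1,p}(X_\varepsilon,\mu_\beta)},$$ with comparison constants independent of $u$. If $u\in\operatorname{Lip}(X_\varepsilon)$, then $\tilde u=\hat u|_Z$, where $\hat u$ is the unique Lipschitz extension of $u$ to $\overline X_\varepsilon$.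
   Context: Balls are open; $B_Z$ refers to $(Z,d_Z)$. A Borel regular measure $\nu$ is doubling if there is $C>0$ with $0<\nu(B(x,2r))\le C\nu(B(x,r))<\infty$ for all balls. $a\lesssim b$ means $a\le Cb$ for a constant $C>0$. Hyperbolic filling. Let $(Z,d_Z)$ be a metric space with $\operatorname{diam}Z<1$; fix $\alpha,\tau>1$ and $z_0\in Z$. Set $A_0=\{z_0\}$ and for each $n\ge1$ choose a maximal $\alpha^{-n}$-separated set $A_n\subset Z$ (i.e. $d_Z(z,z')\ge\alpha^{-n}$ for distinct $z,z'\in A_n$) so that $A_n\subset A_m$ whenever $m\ge n\ge0$. Let $V_n=\{(x,n):x\in A_n\}$ and $V=\bigcup_{n\ge0}V_n$. Two different vertices $(x,n),(y,m)\in V$ are neighbors, $(x,n)\sim(y,m)$, iff $|n-m|\le1$ and: $B_Z(x,\tau\alpha^{-n})\cap B_Z(y,\tau\alpha^{-m})\ne\emptyset$ if $m=n$; $B_Z(x,\alpha^{-n})\cap B_Z(y,\alpha^{-m})\ne\emptyset$ if $m=n\pm1$. The hyperbolic filling $X$ is the metric graph with vertex set $V$ and an edge $[v,w]$, a unit interval, for each pair of neighbors $v\sim w$, equipped with the path metric $d_X$. The root is $v_0=(z_0,0)$. Uniformization. $\rho_\varepsilon(x)=e^{-\varepsilon d_X(x,v_0)}$ and $d_\varepsilon(x,y)=\inf_\gamma\int_\gamma\rho_\varepsilon\,ds$, infimum over rectifiable curves in $X$ from $x$ to $y$. $X_\varepsilon=(X,d_\varepsilon)$, $\overline{X}_\varepsilon$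 is its completion, $\partial_\varepsilon X=\overline{X}_\varepsilon\setminus X_\varepsilon$. For $\varepsilon=\log\alpha$ and $Z$ compact, $\partial_\varepsilon X$ is identified with $Z$ via the biLipschitz homeomorphism $\Psi:Z\to\partial_\varepsilon X$, $\Psi(z)=\lim_{j\to\infty}(z_j,j)$ in $d_\varepsilon$, where $z_j\in A_j$, $d_Z(z_j,z)<\alpha^{-j}$. Measure. $\hat\mu(\{(z,n)\})=\nu(B_Z(z,\alpha^{-n}))$, $\rho_\beta((z,n))=e^{-\beta n}$, and for Borel $A\subset X$, $$\mu_\beta(A)=\sum_{v\in V}\sum_{w\sim v}\bigl(\rho_\beta(v)\hat\mu(\{v\})+\rho_\beta(w)\hat\mu(\{w\})\bigr)\mathcal L(A\cap[v,w]),$$ where $\mathcal L$ is Lebesgue measure on the unit interval $[v,w]$. Newtonian spaces. On a metric measure space $(Y,d,\mu)$, a Borel function $g:Y\to[0,\infty]$ is an upper gradient of $u:Y\to[-\infty,\infty]$ if $|u(x)-u(y)|\le\int_\gamma g\,ds$ for every nonconstant compact rectifiable curve $\gamma$ with endpoints $x,y$ (the right-hand side being required to be $\infty$ if $u(x)$ or $u(y)$ is not finite). A nonnegative measurable $g$ is a $p$-weak upper gradient if this holds for all such curves outside a family $\Gamma$ for which there is a Borel $0\le\rho\in L^p(Y)$ with $\int_\gamma\rho\,ds=\infty$ for every $\gamma\in\Gamma$. $\widetilde N^{1,p}(Y,\mu)$ is the set of functions $u$ with $\int_Y|u|^p\,d\mu<\infty$ having a $p$-weak upper gradient in $L^p(Y,\mu)$,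 with seminorm $\|u\|_{N^{1,p}(Y,\mu)}=(\int_Y|u|^p\,d\mu+\inf_g\int_Yg^p\,d\mu)^{1/p}$, infimum over upper gradients $g$ of $u$. $g_u\in L^p$ denotes the minimal $p$-weak upper gradient of $u$ ($g_u\le g$ a.e. for every $p$-weak upper gradient $g\in L^p$ of $u$). Besov space. $B^\theta_{p,p}(Z)$ consists of $u\in L^p(Z,\nu)$ with $$\|u\|_{\theta,p}^p=\int_Z\int_Z\frac{|u(\zeta)-u(\xi)|^p}{d_Z(\zeta,\xi)^{p\theta}}\frac{d\nu(\xi)\,d\nu(\zeta)}{\nu(B_Z(\zeta,d_Z(\zeta,\xi)))}<\infty$$ (inner integral over $\xi\ne\zeta$). *)

theory Defs
  imports "HOL-Analysis.Analysis"
begin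

section \<open>Curves and line integrals in a metric space\<close>

text \<open>Compact curves are parametrized by the unit interval (library notion \<^const>\<open>pathin\<close>).\<close>

definition curve_length :: "'a metric \<Rightarrow> (real \<Rightarrow> 'a) \<Rightarrow> real \<Rightarrow> real \<Rightarrow> ennreal" where
  "curve_length m \<gamma> a b =
     (SUP ts \<in> {ts. sorted ts \<and> set ts \<subseteq> {a..b}}.
        ennreal (\<Sum>i<length ts - 1. mdist m (\<gamma> (ts ! i)) (\<gamma> (ts ! Suc i))))"

definition rectifiable_curve :: "'a metric \<Rightarrow> (real \<Rightarrow> 'a) \<Rightarrow> bool" where
  "rectifiable_curve m \<gamma> \<longleftrightarrow> pathin (mtopology_of m) \<gamma> \<and> curve_length m \<gamma> 0 1 < \<infinity>"

definition nonconstant_curve :: "(real \<Rightarrow> 'a) \<Rightarrow> bool" where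
  "nonconstant_curve \<gamma> \<longleftrightarrow> (\<exists>t\<in>{0..1}. \<gamma> t \<noteq> \<gamma> 0)"

text \<open>The choice of \<open>t\<close> is immaterial: \<open>\<gamma>\<close> is constant between two parameters at which
  the length function has the same value.\<close>

definition arclength_param :: "'a metric \<Rightarrow> (real \<Rightarrow> 'a) \<Rightarrow> real \<Rightarrow> 'a" where
  "arclength_param m \<gamma> s = \<gamma> (SOME t. t \<in> {0..1} \<and> curve_length m \<gamma> 0 t = ennreal s)"

definition line_integral :: "'a metric \<Rightarrow> (real \<Rightarrow> 'a) \<Rightarrow> ('a \<Rightarrow> ennreal) \<Rightarrow> ennreal" where
  "line_integral m \<gamma> g =
     (\<integral>\<^sup>+ s \<in> {0..enn2real (curve_length m \<gamma> 0 1)}. g (arclength_param m \<gamma> s) \<partial>lebesgue)"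

definition measurable_along :: "'a metric \<Rightarrow> (real \<Rightarrow> 'a) \<Rightarrow> ('a \<Rightarrow> ennreal) \<Rightarrow> bool" where
  "measurable_along m \<gamma> g \<longleftrightarrow>
     (\<lambda>s. g (arclength_param m \<gamma> s))
       \<in> borel_measurable (lebesgue_on {0..enn2real (curve_length m \<gamma> 0 1)})"

definition metric_borel :: "'a metric \<Rightarrow> 'a measure" where
  "metric_borel m = sigma (mspace m) {U. openin (mtopology_of m) U}"


section \<open>Newtonian spaces\<close>

text \<open>Extended nonnegative powers, used for exponents \<open>p > 0\<close> only.\<close>

definition ennreal_powr :: "ennreal \<Rightarrow> real \<Rightarrow> ennreal" where
  "ennreal_powr x p = (if x = \<infinity> then \<infinity> else ennreal (enn2real x powr p))"

text \<open>Measures live on the Borel sets; \<open>\<mu>\<close>-measurable means measurable for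
  \<^term>\<open>completion \<mu>\<close>.\<close>

definition Lp_energy :: "'a measure \<Rightarrow> real \<Rightarrow> ('a \<Rightarrow> ennreal) \<Rightarrow> ennreal" where
  "Lp_energy \<mu> p f = (\<integral>\<^sup>+ x. ennreal_powr (f x) p \<partial>completion \<mu>)"

definition Lp_norm :: "'a measure \<Rightarrow> real \<Rightarrow> ('a \<Rightarrow> ennreal) \<Rightarrow> ennreal" where
  "Lp_norm \<mu> p f = ennreal_powr (Lp_energy \<mu> p f) (1 / p)"

definition upper_gradient_along ::
    "'a metric \<Rightarrow> ('a \<Rightarrow> ereal) \<Rightarrow> ('a \<Rightarrow> ennreal) \<Rightarrow> (real \<Rightarrow> 'a) \<Rightarrow> bool" where
  "upper_gradient_along m u g \<gamma> \<longleftrightarrow>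
     (if \<bar>u (\<gamma> 0)\<bar> = \<infinity> \<or> \<bar>u (\<gamma> 1)\<bar> = \<infinity> then line_integral m \<gamma> g = \<infinity>
      else e2ennreal \<bar>u (\<gamma> 0) - u (\<gamma> 1)\<bar> \<le> line_integral m \<gamma> g)"

definition upper_gradient :: "'a metric \<Rightarrow> ('a \<Rightarrow> ereal) \<Rightarrow> ('a \<Rightarrow> ennreal) \<Rightarrow> bool" where
  "upper_gradient m u g \<longleftrightarrow>
     g \<in> borel_measurable (metric_borel m) \<and>
     (\<forall>\<gamma>. rectifiable_curve m \<gamma> \<and> nonconstant_curve \<gamma> \<longrightarrow> upper_gradient_along m u g \<gamma>)"

definition exceptional_family ::
    "'a metric \<Rightarrow> 'a measure \<Rightarrow> real \<Rightarrow> (real \<Rightarrow> 'a) set \<Rightarrow> bool" where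
  "exceptional_family m \<mu> p \<Gamma> \<longleftrightarrow>
     (\<exists>\<rho>. \<rho> \<in> borel_measurable (metric_borel m) \<and> Lp_energy \<mu> p \<rho> < \<infinity> \<and>
          (\<forall>\<gamma>\<in>\<Gamma>. line_integral m \<gamma> \<rho> = \<infinity>))"

text \<open>A function that is merely \<open>\<mu>\<close>-measurable has a well-defined line integral only along
  curves outside some exceptional family; the curves along which it is not measurable are
  therefore required to be in \<open>\<Gamma>\<close>.\<close>

definition weak_upper_gradient ::
    "'a metric \<Rightarrow> 'a measure \<Rightarrow> real \<Rightarrow> ('a \<Rightarrow> ereal) \<Rightarrow> ('a \<Rightarrow> ennreal) \<Rightarrow> bool" where
  "weak_upper_gradient m \<mu> p u g \<longleftrightarrow>
     g \<in> borel_measurable (completion \<mu>) \<and>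
     (\<exists>\<Gamma> \<subseteq> {\<gamma>. rectifiable_curve m \<gamma> \<and> nonconstant_curve \<gamma>}.
        exceptional_family m \<mu> p \<Gamma> \<and>
        (\<forall>\<gamma>. rectifiable_curve m \<gamma> \<and> nonconstant_curve \<gamma> \<and> \<gamma> \<notin> \<Gamma> \<longrightarrow>
             measurable_along m \<gamma> g \<and> upper_gradient_along m u g \<gamma>))"

definition newtonian :: "'a metric \<Rightarrow> 'a measure \<Rightarrow> real \<Rightarrow> ('a \<Rightarrow> ereal) set" where
  "newtonian m \<mu> p =
     {u. u \<in> borel_measurable (completion \<mu>) \<and>
         Lp_energy \<mu> p (\<lambda>x. e2ennreal \<bar>u x\<bar>) < \<infinity> \<and>
         (\<exists>g. weak_upper_gradient m \<mu> p u g \<and> Lp_energy \<mu> p g < \<infinity>)}"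

definition newtonian_seminorm ::
    "'a metric \<Rightarrow> 'a measure \<Rightarrow> real \<Rightarrow> ('a \<Rightarrow> ereal) \<Rightarrow> ennreal" where
  "newtonian_seminorm m \<mu> p u =
     ennreal_powr (Lp_energy \<mu> p (\<lambda>x. e2ennreal \<bar>u x\<bar>)
                   + (INF g \<in> {g. upper_gradient m u g}. Lp_energy \<mu> p g)) (1 / p)"

definition minimal_weak_upper_gradient ::
    "'a metric \<Rightarrow> 'a measure \<Rightarrow> real \<Rightarrow> ('a \<Rightarrow> ereal) \<Rightarrow> ('a \<Rightarrow> ennreal) \<Rightarrow> bool" where
  "minimal_weak_upper_gradient m \<mu> p u g \<longleftrightarrow>
     weak_upper_gradient m \<mu> p u g \<and> Lp_energy \<mu> p g < \<infinity> \<and>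
     (\<forall>g'. weak_upper_gradient m \<mu> p u g' \<and> Lp_energy \<mu> p g' < \<infinity> \<longrightarrow>
           (AE x in completion \<mu>. g x \<le> g' x))"


section \<open>Doubling measures and Besov spaces\<close>

text \<open>A measure on the Borel \<open>\<sigma>\<close>-algebra; the outer measure it induces is Borel regular.\<close>

definition doubling_measure :: "'z::metric_space measure \<Rightarrow> bool" where
  "doubling_measure \<nu> \<longleftrightarrow>
     sets \<nu> = sets borel \<and>
     (\<exists>C>0. \<forall>x. \<forall>r>0.
        0 < emeasure \<nu> (ball x (2 * r)) \<and>
        emeasure \<nu> (ball x (2 * r)) \<le> ennreal C * emeasure \<nu> (ball x r) \<and>
        ennreal C * emeasure \<nu> (ball x r) < \<infinity>)"

definition besov_energy ::
    "'z::metric_space measure \<Rightarrow> real \<Rightarrow> real \<Rightarrow> ('z \<Rightarrow> real) \<Rightarrow> ennreal" where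
  "besov_energy \<nu> \<theta> p u =
     (\<integral>\<^sup>+ \<zeta>. (\<integral>\<^sup>+ \<xi> \<in> - {\<zeta>}.
          ennreal (\<bar>u \<zeta> - u \<xi>\<bar> powr p /
                   (dist \<zeta> \<xi> powr (p * \<theta>) * measure \<nu> (ball \<zeta> (dist \<zeta> \<xi>))))
        \<partial>completion \<nu>) \<partial>completion \<nu>)"

definition besov_seminorm ::
    "'z::metric_space measure \<Rightarrow> real \<Rightarrow> real \<Rightarrow> ('z \<Rightarrow> real) \<Rightarrow> ennreal" where
  "besov_seminorm \<nu> \<theta> p u = ennreal_powr (besov_energy \<nu> \<theta> p u) (1 / p)"

definition besov_space ::
    "'z::metric_space measure \<Rightarrow> real \<Rightarrow> real \<Rightarrow> ('z \<Rightarrow> real) set" where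
  "besov_space \<nu> \<theta> p =
     {u. u \<in> borel_measurable (completion \<nu>) \<and>
         Lp_energy \<nu> p (\<lambda>\<zeta>. ennreal \<bar>u \<zeta>\<bar>) < \<infinity> \<and>
         besov_energy \<nu> \<theta> p u < \<infinity>}"


section \<open>Hyperbolic fillings\<close>

definition separated :: "real \<Rightarrow> 'z::metric_space set \<Rightarrow> bool" where
  "separated r S \<longleftrightarrow> (\<forall>x\<in>S. \<forall>y\<in>S. x \<noteq> y \<longrightarrow> r \<le> dist x y)"

definition maximal_separated :: "real \<Rightarrow> 'z::metric_space set \<Rightarrow> bool" where
  "maximal_separated r S \<longleftrightarrow> separated r S \<and> (\<forall>T. separated r T \<and> S \<subseteq> T \<longrightarrow> T = S)"

definition filling_nets :: "real \<Rightarrow> 'z::metric_space \<Rightarrow> (nat \<Rightarrow> 'z set) \<Rightarrow> bool" where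
  "filling_nets \<alpha> z0 A \<longleftrightarrow>
     A 0 = {z0} \<and> (\<forall>n\<ge>1. maximal_separated (1 / \<alpha> ^ n) (A n)) \<and>
     (\<forall>n m. n \<le> m \<longrightarrow> A n \<subseteq> A m)"

definition fill_vertices :: "(nat \<Rightarrow> 'z set) \<Rightarrow> ('z \<times> nat) set" where
  "fill_vertices A = {(x, n). x \<in> A n}"

definition fill_adj ::
    "real \<Rightarrow> real \<Rightarrow> (nat \<Rightarrow> 'z::metric_space set) \<Rightarrow> 'z \<times> nat \<Rightarrow> 'z \<times> nat \<Rightarrow> bool" where
  "fill_adj \<alpha> \<tau> A = (\<lambda>(x, n) (y, m).
     (x, n) \<in> fill_vertices A \<and> (y, m) \<in> fill_vertices A \<and> (x, n) \<noteq> (y, m) \<and>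
     (m = n \<and> ball x (\<tau> / \<alpha> ^ n) \<inter> ball y (\<tau> / \<alpha> ^ m) \<noteq> {} \<or>
      (m = Suc n \<or> n = Suc m) \<and> ball x (1 / \<alpha> ^ n) \<inter> ball y (1 / \<alpha> ^ m) \<noteq> {}))"

text \<open>Points of the metric graph are given by barycentric coordinates, as in the geometric
  realization of a simplicial complex: \<open>edge_pt v w t\<close> is the point at distance \<open>t\<close> from \<open>v\<close> on
  the unit interval \<open>[v, w]\<close>, and \<open>edge_pt v w t = edge_pt w v (1 - t)\<close>.\<close>

definition vertex_pt :: "'v \<Rightarrow> 'v \<Rightarrow> real" where
  "vertex_pt v = indicator {v}"

definition edge_pt :: "'v \<Rightarrow> 'v \<Rightarrow> real \<Rightarrow> 'v \<Rightarrow> real" where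
  "edge_pt v w t = (\<lambda>x. (1 - t) * vertex_pt v x + t * vertex_pt w x)"

definition fill_points ::
    "real \<Rightarrow> real \<Rightarrow> (nat \<Rightarrow> 'z::metric_space set) \<Rightarrow> ('z \<times> nat \<Rightarrow> real) set" where
  "fill_points \<alpha> \<tau> A =
     vertex_pt ` fill_vertices A \<union>
     {edge_pt v w t | v w t. fill_adj \<alpha> \<tau> A v w \<and> t \<in> {0..1}}"

text \<open>\<open>fill_chain \<alpha> \<tau> A x y l\<close>: there is a piecewise linear path of length \<open>l\<close> from \<open>x\<close> to \<open>y\<close>,
  consisting of finitely many segments, each contained in one edge. The path metric is the
  infimum of these lengths.\<close>

inductive fill_chain ::
    "real \<Rightarrow> real \<Rightarrow> (nat \<Rightarrow> 'z::metric_space set) \<Rightarrow>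
     ('z \<times> nat \<Rightarrow> real) \<Rightarrow> ('z \<times> nat \<Rightarrow> real) \<Rightarrow> real \<Rightarrow> bool"
  for \<alpha> \<tau> A where
  fill_chain_refl: "x \<in> fill_points \<alpha> \<tau> A \<Longrightarrow> fill_chain \<alpha> \<tau> A x x 0"
| fill_chain_step: "fill_chain \<alpha> \<tau> A x (edge_pt v w s) l \<Longrightarrow> fill_adj \<alpha> \<tau> A v w \<Longrightarrow>
    s \<in> {0..1} \<Longrightarrow> t \<in> {0..1} \<Longrightarrow> fill_chain \<alpha> \<tau> A x (edge_pt v w t) (l + \<bar>s - t\<bar>)"

text \<open>The type \<^typ>\<open>'a metric\<close> requires distance functions that are nonnegative and symmetric
  also outside the carrier. Under the hypotheses \<open>\<alpha>, \<tau> > 1\<close>, \<open>diam Z < 1\<close> and \<open>filling_nets\<close> the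
  graph is connected, the infimum is over a nonempty set, and \<open>fill_dist\<close> is a metric; likewise
  for \<open>uniformized_dist\<close> below.\<close>

definition fill_dist ::
    "real \<Rightarrow> real \<Rightarrow> (nat \<Rightarrow> 'z::metric_space set) \<Rightarrow>
     ('z \<times> nat \<Rightarrow> real) \<Rightarrow> ('z \<times> nat \<Rightarrow> real) \<Rightarrow> real" where
  "fill_dist \<alpha> \<tau> A x y =
     (if x \<in> fill_points \<alpha> \<tau> A \<and> y \<in> fill_points \<alpha> \<tau> A
      then Inf {l. fill_chain \<alpha> \<tau> A x y l} else 0)"

definition filling ::
    "real \<Rightarrow> real \<Rightarrow> (nat \<Rightarrow> 'z::metric_space set) \<Rightarrow> ('z \<times> nat \<Rightarrow> real) metric" where
  "filling \<alpha> \<tau> A = metric (fill_points \<alpha> \<tau> A, fill_dist \<alpha> \<tau> A)"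


section \<open>Uniformization, its boundary, and the lifted measure\<close>

definition uniformized_dist ::
    "'a metric \<Rightarrow> 'a \<Rightarrow> real \<Rightarrow> 'a \<Rightarrow> 'a \<Rightarrow> real" where
  "uniformized_dist X x0 \<epsilon> x y =
     enn2real (INF \<gamma> \<in> {\<gamma>. rectifiable_curve X \<gamma> \<and> \<gamma> 0 = x \<and> \<gamma> 1 = y}.
       line_integral X \<gamma> (\<lambda>q. ennreal (exp (- \<epsilon> * mdist X q x0))))"

definition uniformized :: "'a metric \<Rightarrow> 'a \<Rightarrow> real \<Rightarrow> 'a metric" where
  "uniformized X x0 \<epsilon> = metric (mspace X, uniformized_dist X x0 \<epsilon>)"

definition is_completion :: "'a metric \<Rightarrow> 'c metric \<Rightarrow> ('a \<Rightarrow> 'c) \<Rightarrow> bool" where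
  "is_completion m m' \<iota> \<longleftrightarrow>
     mcomplete_of m' \<and> \<iota> \<in> mspace m \<rightarrow> mspace m' \<and>
     mtopology_of m' closure_of \<iota> ` mspace m = mspace m' \<and>
     (\<forall>x\<in>mspace m. \<forall>y\<in>mspace m. mdist m' (\<iota> x) (\<iota> y) = mdist m x y)"

definition boundary_map ::
    "real \<Rightarrow> (nat \<Rightarrow> 'z::metric_space set) \<Rightarrow> 'c metric \<Rightarrow> (('z \<times> nat \<Rightarrow> real) \<Rightarrow> 'c) \<Rightarrow> 'z \<Rightarrow> 'c"
  where
  "boundary_map \<alpha> A m' \<iota> \<zeta> =
     (THE q. \<forall>z. (\<forall>j. z j \<in> A j \<and> dist (z j) \<zeta> < 1 / \<alpha> ^ j) \<longrightarrow>
        limitin (mtopology_of m') (\<lambda>j. \<iota> (vertex_pt (z j, j))) q sequentially)"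

definition vertex_weight ::
    "'z::metric_space measure \<Rightarrow> real \<Rightarrow> real \<Rightarrow> 'z \<times> nat \<Rightarrow> ennreal" where
  "vertex_weight \<nu> \<alpha> \<beta> = (\<lambda>(z, n). ennreal (exp (- \<beta> * real n)) * emeasure \<nu> (ball z (1 / \<alpha> ^ n)))"

text \<open>Each edge occurs twice in the double sum, once for each orientation.\<close>

definition mu_beta ::
    "'z::metric_space measure \<Rightarrow> real \<Rightarrow> real \<Rightarrow> (nat \<Rightarrow> 'z set) \<Rightarrow> real \<Rightarrow> ('z \<times> nat \<Rightarrow> real) measure"
  where
  "mu_beta \<nu> \<alpha> \<tau> A \<beta> =
     measure_of (fill_points \<alpha> \<tau> A) (sets (metric_borel (filling \<alpha> \<tau> A)))
       (\<lambda>S. \<integral>\<^sup>+ v. (\<integral>\<^sup>+ w. (vertex_weight \<nu> \<alpha> \<beta> v + vertex_weight \<nu> \<alpha> \<beta> w) *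
                  emeasure lborel {t \<in> {0..1}. edge_pt v w t \<in> S}
                \<partial>count_space {w. fill_adj \<alpha> \<tau> A v w}) \<partial>count_space (fill_vertices A))"

definition trace_avg ::
    "real \<Rightarrow> (nat \<Rightarrow> 'z::metric_space set) \<Rightarrow> (('z \<times> nat \<Rightarrow> real) \<Rightarrow> ereal) \<Rightarrow> nat \<Rightarrow> 'z \<Rightarrow> ereal"
  where
  "trace_avg \<alpha> A u n \<zeta> =
     (\<Sum>z \<in> A n \<inter> ball \<zeta> (1 / \<alpha> ^ n). u (vertex_pt (z, n))) /
     ereal (real (card (A n \<inter> ball \<zeta> (1 / \<alpha> ^ n))))"

end

theory Submission
  imports Defs
begin

text \<open>An edge between vertices at level about \<open>n\<close> has \<open>d\<^sub>\<epsilon>\<close>-length at most a multiple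
  of \<open>\<alpha>\<^bsup>-n\<^esup>\<close>, and every edge carries a positive multiple of Lebesgue measure, so no edge is
  exceptional. Hence \<open>|u(v) - u(w)|\<^bsup>p\<^esup>\<close> is controlled by \<open>\<alpha>\<^bsup>-np\<^esup>\<close> times the integral of \<open>g\<^bsup>p\<^esup>\<close> over the edge, and
  what remains is a statement about the values of \<open>u\<close> at the vertices. The increments
  \<open>u\<^sub>n\<^sub>+\<^sub>1 - u\<^sub>n\<close> are bounded by vertical edges near \<open>\<zeta>\<close>; a weighted sum of their \<open>p\<close>-th powers is
  integrable, which yields the limit together with the decay of \<open>u - u\<^sub>n\<close>. In the Besov energy a pair with
  \<open>d(\<zeta>, \<xi>) < (\<tau> - 1) \<alpha>\<^bsup>-n\<^esup>\<close> is compared through \<open>u\<^sub>n(\<zeta>)\<close> and \<open>u\<^sub>n(\<xi>)\<close>, whose difference is bounded by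
  horizontal edges of level \<open>n\<close> because \<open>\<tau> > 1\<close>.\<close>

section \<open>Nets\<close>

text \<open>The bound \<theta> \<le> 1 - \<beta>/(\<epsilon> p) says \<alpha>^(n p \<theta>)
  \<alpha>^(-n p) \<le> exp(-\<beta> n): the Besov scale factor at distance \<alpha>^-n, times the
  p-th power of the length of an edge of level n, is absorbed by the weight of
  \<open>mu_beta\<close>. From there on only the discrete quantity \<open>energy\<close> matters.
  Positivity of \<theta> supplies the convergence. Half of the exponent p \<theta> is put as a
  growing weight into \<open>tail\<close>, which forces geometric decay of the increments at a fixed
  point; the other half remains as a geometric factor in the offset when the tails are summed over
  their starting levels. Each increment is bounded by the whole tail, so no Hoelder inequality
  appears and p = 1 is not special. Two obstacles lie in the definitions. A weak upper gradient is
  measurable only for the completed measure, so a Borel majorant of equal energy replaces it on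
  edges. The arc length parametrization is given by a choice, so line integrals are estimated by
  comparing measures on the parameter interval. The trace is the value of \<open>lim\<close> at
  every point, which yields the Lipschitz statement for all \<zeta>.\<close>

locale hyperbolic_filling =
  fixes \<alpha> \<tau> :: real and A :: "nat \<Rightarrow> 'z::metric_space set" and z0 :: 'z
  assumes compact_UNIV: "compact (UNIV :: 'z set)"
    and diameter_less_1: "diameter (UNIV :: 'z set) < 1"
    and alpha: "\<alpha> > 1" and tau: "\<tau> > 1"
    and nets: "filling_nets \<alpha> z0 A"
begin

abbreviation rad :: "nat \<Rightarrow> real" where "rad n \<equiv> 1 / \<alpha> ^ n"
abbreviation adj :: "'z \<times> nat \<Rightarrow> 'z \<times> nat \<Rightarrow> bool" where "adj \<equiv> fill_adj \<alpha> \<tau> A"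

lemma dist_less_1: "dist (x::'z) y < 1"
  using diameter_bounded_bound[OF compact_imp_bounded[OF compact_UNIV], of x y] diameter_less_1 by simp

lemma rad_pos: "rad n > 0"
  using alpha by simp

lemma rad_antimono: "n \<le> k \<Longrightarrow> rad k \<le> rad n"
  using alpha by (intro divide_left_mono power_increasing) auto

lemma net_0: "A 0 = {z0}" and net_mono: "n \<le> k \<Longrightarrow> A n \<subseteq> A k"
  using nets by (auto simp: filling_nets_def)

lemma net_separated: "x \<in> A n \<Longrightarrow> y \<in> A n \<Longrightarrow> x \<noteq> y \<Longrightarrow> rad n \<le> dist x y"
  using nets net_0 by (cases "n = 0") (auto simp: filling_nets_def maximal_separated_def separated_def)

text \<open>A point at distance at least \<open>rad n\<close> from all of \<open>A n\<close> could
  be added to it, against maximality. At level 0, where the net is prescribed, the bound diam Z < 1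
  makes \<open>z0\<close> alone sufficient.\<close>

lemma net_cover: "\<exists>z\<in>A n. dist z \<zeta> < rad n"
proof (cases "n = 0")
  case True
  then show ?thesis using net_0 dist_less_1 by auto
next
  case False
  then have max: "maximal_separated (rad n) (A n)" using nets by (auto simp: filling_nets_def)
  show ?thesis
  proof (rule ccontr)
    assume c: "\<not> ?thesis"
    then have "separated (rad n) (insert \<zeta> (A n))"
      using max by (auto simp: separated_def maximal_separated_def not_less dist_commute)
    then have "insert \<zeta> (A n) = A n" using max by (auto simp: maximal_separated_def)
    then have "\<zeta> \<in> A n" by blast
    then show False using c rad_pos[of n] by (metis dist_self)
  qed
qed

text \<open>Total boundedness covers Z by finitely many balls of radius \<open>rad n / 2\<close>.
  Each contains at most one net point, so sending a net point to the centre of a ball around it is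
  injective.\<close>

lemma finite_net: "finite (A n)"
proof -
  have "rad n / 2 > 0" using rad_pos[of n] by simp
  then obtain k where k: "finite k" "(UNIV :: 'z set) \<subseteq> (\<Union>x\<in>k. ball x (rad n / 2))"
    using compact_UNIV unfolding compact_eq_totally_bounded by blast
  then have "\<forall>z. \<exists>c\<in>k. z \<in> ball c (rad n / 2)" by blast
  then obtain c where c: "\<And>z. c z \<in> k" "\<And>z. z \<in> ball (c z) (rad n / 2)" by metis
  have "inj_on c (A n)"
  proof (rule inj_onI, rule ccontr)
    fix x y assume xy: "x \<in> A n" "y \<in> A n" "c x = c y" "x \<noteq> y"
    have "dist x y < rad n / 2 + rad n / 2"
      using c(2)[of x] c(2)[of y] xy(3) dist_triangle_less_add[of x "c x" "rad n / 2" y "rad n / 2"]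
      by (simp add: dist_commute)
    then show False using net_separated[OF xy(1,2,4)] by simp
  qed
  then show ?thesis using k(1) c(1) by (meson finite_imageD finite_subset image_subsetI)
qed

lemma adj_sym: "adj v w \<Longrightarrow> adj w v"
  by (cases v; cases w) (auto simp: fill_adj_def)

lemma adj_neq: "adj v w \<Longrightarrow> v \<noteq> w"
  by (cases v; cases w) (auto simp: fill_adj_def)

lemma adj_vertices: "adj v w \<Longrightarrow> v \<in> fill_vertices A \<and> w \<in> fill_vertices A"
  by (cases v; cases w) (auto simp: fill_adj_def)

lemma adj_level: "adj (x, n) (y, k) \<Longrightarrow> n \<le> Suc k \<and> k \<le> Suc n"
  by (auto simp: fill_adj_def)

text \<open>The point \<zeta> witnesses that the two balls meet. The radii are those used for the
  averages u_n(\<zeta>), so the vertices entering consecutive averages at \<zeta> are joined by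
  vertical edges.\<close>

lemma adj_up:
  assumes "z \<in> A n" "z' \<in> A (Suc n)" "dist z \<zeta> < rad n" "dist z' \<zeta> < rad (Suc n)"
  shows "adj (z, n) (z', Suc n)"
proof -
  have "\<zeta> \<in> ball z (1 / \<alpha> ^ n) \<inter> ball z' (1 / \<alpha> ^ Suc n)" using assms by simp
  then show ?thesis using assms by (auto simp: fill_adj_def fill_vertices_def)
qed

text \<open>Horizontal adjacency allows the larger radius \<open>\<tau> * rad n\<close>; this slack
  later makes vertices near two different points of Z neighbours.\<close>

lemma adj_same_level:
  assumes "z \<in> A n" "z' \<in> A n" "z \<noteq> z'" "dist z \<zeta> < \<tau> * rad n" "dist z' \<zeta> < \<tau> * rad n"
  shows "adj (z, n) (z', n)"
proof -
  have "\<zeta> \<in> ball z (\<tau> / \<alpha> ^ n) \<inter> ball z' (\<tau> / \<alpha> ^ n)" using assms by simp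
  then show ?thesis using assms by (auto simp: fill_adj_def fill_vertices_def)
qed

lemma adj_root: "adj (z0, 0) (z0, 1)"
  using adj_up[of z0 0 z0 z0] net_0 net_mono[of 0 1] alpha by auto

lemma finite_neighbours: "finite {w. adj v w}"
proof (rule finite_subset)
  show "{w. adj v w} \<subseteq> (\<Union>k\<le>Suc (snd v). A k \<times> {k})"
    by (cases v) (auto simp: fill_adj_def fill_vertices_def)
  show "finite (\<Union>k\<le>Suc (snd v). A k \<times> {k})" using finite_net by auto
qed

end


section \<open>Doubling measures\<close>

locale doubling_filling = hyperbolic_filling \<alpha> \<tau> A z0
  for \<alpha> \<tau> :: real and A :: "nat \<Rightarrow> 'z::metric_space set" and z0 :: 'z +
  fixes \<nu> :: "'z measure"
  assumes doubling: "doubling_measure \<nu>"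
begin

lemma sets_nu [measurable_cong]: "sets \<nu> = sets borel"
  using doubling by (simp add: doubling_measure_def)

lemma space_nu [simp]: "space \<nu> = UNIV"
  using sets_eq_imp_space_eq[OF sets_nu] by simp

lemma emeasure_ball:
  assumes "r > 0"
  shows "0 < emeasure \<nu> (ball x r)" "emeasure \<nu> (ball x r) < \<infinity>"
proof -
  obtain C where C: "\<And>x r. r > 0 \<Longrightarrow> 0 < emeasure \<nu> (ball x (2 * r)) \<and>
      emeasure \<nu> (ball x (2 * r)) \<le> ennreal C * emeasure \<nu> (ball x r) \<and> ennreal C * emeasure \<nu> (ball x r) < \<infinity>"
    using doubling by (auto simp: doubling_measure_def)
  show "0 < emeasure \<nu> (ball x r)" "emeasure \<nu> (ball x r) < \<infinity>"
    using C[of "r / 2" x] assms by (auto intro: le_less_trans)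
qed

lemma finite_measure_nu: "finite_measure \<nu>"
proof
  have "ball z0 1 = (UNIV :: 'z set)" using dist_less_1 by auto
  then show "emeasure \<nu> (space \<nu>) \<noteq> \<infinity>" using emeasure_ball(2)[of 1 z0] by simp
qed

sublocale nu: finite_measure \<nu> by (rule finite_measure_nu)

lemma measure_ball_pos: "r > 0 \<Longrightarrow> measure \<nu> (ball x r) > 0"
  using emeasure_ball(1)[of r x] by (simp add: nu.emeasure_eq_measure)

text \<open>Weighted by \<nu> alone: the factor exp(-\<beta> n) of the lifted measure and the length
  of the edges are accounted for later by the weight \<alpha>^(n p \<theta>).\<close>

definition level_energy :: "real \<Rightarrow> ('z \<times> nat \<Rightarrow> real) \<Rightarrow> nat \<Rightarrow> real" where
  "level_energy p U n =
     (\<Sum>z\<in>A n. measure \<nu> (ball z (rad n)) * (\<Sum>w | adj (z, n) w. \<bar>U (z, n) - U w\<bar> powr p))"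

lemma level_energy_nonneg: "level_energy p U n \<ge> 0"
  unfolding level_energy_def by (intro sum_nonneg mult_nonneg_nonneg) auto

end

section \<open>Length of curves\<close>

text \<open>The recursive form of the sum in \<open>curve_length\<close>, so that partitions can be
  split, refined and reversed by list induction.\<close>

fun chord_sum :: "'a metric \<Rightarrow> (real \<Rightarrow> 'a) \<Rightarrow> real list \<Rightarrow> real" where
  "chord_sum m \<gamma> [] = 0"
| "chord_sum m \<gamma> [x] = 0"
| "chord_sum m \<gamma> (x # y # ts) = mdist m (\<gamma> x) (\<gamma> y) + chord_sum m \<gamma> (y # ts)"

lemma mdist_props:
  "mdist m x y \<ge> 0" "mdist m x y = mdist m y x"
  "x \<in> mspace m \<Longrightarrow> mdist m x x = 0"
  "x \<in> mspace m \<Longrightarrow> y \<in> mspace m \<Longrightarrow> z \<in> mspace m \<Longrightarrow> mdist m x z \<le> mdist m x y + mdist m y z"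
  "x \<in> mspace m \<Longrightarrow> y \<in> mspace m \<Longrightarrow> mdist m x y = 0 \<Longrightarrow> x = y"
  by (simp_all add: mdist_commute mdist_triangle)

lemma chord_sum_nonneg: "chord_sum m \<gamma> ts \<ge> 0"
  by (induction m \<gamma> ts rule: chord_sum.induct) auto

lemma sum_chords_eq: "(\<Sum>i<length ts - 1. mdist m (\<gamma> (ts ! i)) (\<gamma> (ts ! Suc i))) = chord_sum m \<gamma> ts"
proof (induction m \<gamma> ts rule: chord_sum.induct)
  case (3 m \<gamma> x y ts)
  then show ?case by (simp add: sum.lessThan_Suc_shift del: sum.lessThan_Suc)
qed auto

lemma curve_length_eq:
  "curve_length m \<gamma> a b = (SUP ts \<in> {ts. sorted ts \<and> set ts \<subseteq> {a..b}}. ennreal (chord_sum m \<gamma> ts))"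
  unfolding curve_length_def sum_chords_eq ..

lemma chord_sum_le_curve_length:
  "sorted ts \<Longrightarrow> set ts \<subseteq> {a..b} \<Longrightarrow> ennreal (chord_sum m \<gamma> ts) \<le> curve_length m \<gamma> a b"
  unfolding curve_length_eq by (rule SUP_upper) auto

lemma curve_length_le:
  assumes "\<And>ts. sorted ts \<Longrightarrow> set ts \<subseteq> {a..b} \<Longrightarrow> ennreal (chord_sum m \<gamma> ts) \<le> l"
  shows "curve_length m \<gamma> a b \<le> l"
  unfolding curve_length_eq by (rule SUP_least) (use assms in auto)

lemma mdist_le_curve_length:
  assumes "a \<le> b" shows "ennreal (mdist m (\<gamma> a) (\<gamma> b)) \<le> curve_length m \<gamma> a b"
  using chord_sum_le_curve_length[of "[a,b]" a b m \<gamma>] assms by simp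

lemma curve_length_mono:
  assumes "{a..b} \<subseteq> {c..d}" shows "curve_length m \<gamma> a b \<le> curve_length m \<gamma> c d"
  by (intro curve_length_le chord_sum_le_curve_length) (use assms in auto)

text \<open>An inequality, because the chord from the last point of \<open>xs\<close> to the first
  point of \<open>ys\<close> is dropped on the left.\<close>

lemma chord_sum_append:
  "chord_sum m \<gamma> xs + chord_sum m \<gamma> ys \<le> chord_sum m \<gamma> (xs @ ys)"
proof (induction m \<gamma> xs rule: chord_sum.induct)
  case (2 m \<gamma> x)
  then show ?case by (cases ys) auto
qed auto

lemma chord_sum_split:
  "chord_sum m \<gamma> (xs @ b # ys) = chord_sum m \<gamma> (xs @ [b]) + chord_sum m \<gamma> (b # ys)"
  by (induction m \<gamma> xs rule: chord_sum.induct) auto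

lemma chord_sum_insert:
  assumes "\<gamma> ` set (b # xs @ ys) \<subseteq> mspace m"
  shows "chord_sum m \<gamma> (xs @ ys) \<le> chord_sum m \<gamma> (xs @ b # ys)"
  using assms
proof (induction m \<gamma> xs rule: chord_sum.induct)
  case (1 m \<gamma>)
  then show ?case by (cases ys) auto
next
  case (2 m \<gamma> x)
  then show ?case by (cases ys) (auto intro: mdist_props)
qed auto

lemma chord_sum_rev: "chord_sum m \<gamma> (rev ts) = chord_sum m \<gamma> ts"
proof (induction m \<gamma> ts rule: chord_sum.induct)
  case (3 m \<gamma> x y ts)
  then show ?case
    using chord_sum_split[of m \<gamma> "rev ts" y "[x]"] by (simp add: mdist_props(2))
qed auto

lemma chord_sum_map: "chord_sum m \<gamma> (map f ts) = chord_sum m (\<gamma> \<circ> f) ts"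
  by (induction m "\<gamma> \<circ> f" ts rule: chord_sum.induct) auto

lemma chord_sum_cong: "(\<And>t. t \<in> set ts \<Longrightarrow> \<gamma> t = \<gamma>' t) \<Longrightarrow> chord_sum m \<gamma> ts = chord_sum m \<gamma>' ts"
  by (induction m \<gamma> ts rule: chord_sum.induct) auto

lemma curve_length_cong:
  assumes "\<And>t. t \<in> {a..b} \<Longrightarrow> \<gamma> t = \<gamma>' t"
  shows "curve_length m \<gamma> a b = curve_length m \<gamma>' a b"
  unfolding curve_length_eq by (intro SUP_cong refl arg_cong[where f=ennreal] chord_sum_cong) (use assms in auto)

lemma sorted_split_at:
  fixes b :: real
  assumes "sorted ts"
  obtains xs ys where "ts = xs @ ys" "\<And>x. x \<in> set xs \<Longrightarrow> x \<le> b" "\<And>y. y \<in> set ys \<Longrightarrow> b \<le> y"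
proof
  show "ts = takeWhile (\<lambda>x. x \<le> b) ts @ dropWhile (\<lambda>x. x \<le> b) ts" by simp
  show "x \<le> b" if "x \<in> set (takeWhile (\<lambda>x. x \<le> b) ts)" for x
    using that by (auto dest: set_takeWhileD)
  show "b \<le> y" if y: "y \<in> set (dropWhile (\<lambda>x. x \<le> b) ts)" for y
  proof -
    have "sorted (dropWhile (\<lambda>x. x \<le> b) ts)" using assms by (rule sorted_dropWhile)
    moreover have "b < hd (dropWhile (\<lambda>x. x \<le> b) ts)"
      using y hd_dropWhile[of "\<lambda>x. x \<le> b" ts] by (cases "dropWhile (\<lambda>x. x \<le> b) ts") auto
    ultimately show ?thesis using y by (cases "dropWhile (\<lambda>x. x \<le> b) ts") auto
  qed
qed

text \<open>In one direction b is inserted into a partition of [a, c], which by the triangle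
  inequality does not decrease the sum, and the partition is cut there. In the other direction
  partitions are concatenated and the two suprema are taken one after the other.\<close>

lemma curve_length_add:
  assumes "a \<le> b" "b \<le> c" "\<gamma> \<in> {a..c} \<rightarrow> mspace m"
  shows "curve_length m \<gamma> a c = curve_length m \<gamma> a b + curve_length m \<gamma> b c"
proof (rule antisym)
  show "curve_length m \<gamma> a c \<le> curve_length m \<gamma> a b + curve_length m \<gamma> b c"
  proof (rule curve_length_le)
    fix ts assume ts: "sorted ts" "set ts \<subseteq> {a..c}"
    obtain xs ys where xy: "ts = xs @ ys" "\<And>x. x \<in> set xs \<Longrightarrow> x \<le> b" "\<And>y. y \<in> set ys \<Longrightarrow> b \<le> y"
      using sorted_split_at[OF ts(1), of b] by blast
    have "chord_sum m \<gamma> ts \<le> chord_sum m \<gamma> (xs @ b # ys)"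
      unfolding xy(1) by (rule chord_sum_insert) (use ts assms xy in auto)
    also have "\<dots> = chord_sum m \<gamma> (xs @ [b]) + chord_sum m \<gamma> (b # ys)" by (rule chord_sum_split)
    finally have "ennreal (chord_sum m \<gamma> ts) \<le> ennreal (chord_sum m \<gamma> (xs @ [b])) + ennreal (chord_sum m \<gamma> (b # ys))"
      by (simp add: chord_sum_nonneg flip: ennreal_plus)
    also have "\<dots> \<le> curve_length m \<gamma> a b + curve_length m \<gamma> b c"
      by (intro add_mono chord_sum_le_curve_length) (use ts assms xy in \<open>auto simp: sorted_append\<close>)
    finally show "ennreal (chord_sum m \<gamma> ts) \<le> curve_length m \<gamma> a b + curve_length m \<gamma> b c" .
  qed
next
  have ne: "{ts. sorted ts \<and> set ts \<subseteq> {u..v}} \<noteq> {}" for u v :: real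
    by (auto intro: exI[of _ "[]"])
  have *: "ennreal (chord_sum m \<gamma> xs) + ennreal (chord_sum m \<gamma> ys) \<le> curve_length m \<gamma> a c"
    if "sorted xs" "set xs \<subseteq> {a..b}" "sorted ys" "set ys \<subseteq> {b..c}" for xs ys
  proof -
    have "ennreal (chord_sum m \<gamma> xs) + ennreal (chord_sum m \<gamma> ys) \<le> ennreal (chord_sum m \<gamma> (xs @ ys))"
      using chord_sum_append[of m \<gamma> xs ys] by (simp add: chord_sum_nonneg flip: ennreal_plus)
    also have "\<dots> \<le> curve_length m \<gamma> a c"
      by (rule chord_sum_le_curve_length) (use that assms in \<open>fastforce simp: sorted_append\<close>)+
    finally show ?thesis .
  qed
  have **: "curve_length m \<gamma> a b + ennreal (chord_sum m \<gamma> ys) \<le> curve_length m \<gamma> a c"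
    if "sorted ys" "set ys \<subseteq> {b..c}" for ys
    unfolding curve_length_eq[of m \<gamma> a b]
    using that by (subst ennreal_SUP_add_left[OF ne, symmetric]) (auto intro!: SUP_least *)
  show "curve_length m \<gamma> a b + curve_length m \<gamma> b c \<le> curve_length m \<gamma> a c"
    unfolding curve_length_eq[of m \<gamma> b c]
    by (subst ennreal_SUP_add_right[OF ne]) (auto intro!: SUP_least **)
qed

lemma chord_sum_le_Lipschitz:
  assumes "\<And>s t. s \<in> set ts \<Longrightarrow> t \<in> set ts \<Longrightarrow> mdist m (\<gamma> s) (\<gamma> t) \<le> K * \<bar>s - t\<bar>"
    and "sorted ts" "ts \<noteq> []"
  shows "chord_sum m \<gamma> ts \<le> K * (last ts - hd ts)"
  using assms
proof (induction ts rule: induct_list012)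
  case (3 x y ts)
  have "mdist m (\<gamma> x) (\<gamma> y) \<le> K * \<bar>x - y\<bar>" using "3.prems"(1)[of x y] by simp
  moreover have "chord_sum m \<gamma> (y # ts) \<le> K * (last (y # ts) - y)" using 3 by auto
  moreover have "\<bar>x - y\<bar> = y - x" using 3 by auto
  ultimately show ?case by (simp add: algebra_simps)
qed auto

lemma curve_length_le_Lipschitz:
  assumes "\<And>s t. s \<in> {a..b} \<Longrightarrow> t \<in> {a..b} \<Longrightarrow> mdist m (\<gamma> s) (\<gamma> t) \<le> K * \<bar>s - t\<bar>" "a \<le> b" "K \<ge> 0"
  shows "curve_length m \<gamma> a b \<le> ennreal (K * (b - a))"
proof (rule curve_length_le)
  fix ts assume ts: "sorted ts" "set ts \<subseteq> {a..b}"
  have "chord_sum m \<gamma> ts \<le> K * (b - a)"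
  proof (cases "ts = []")
    case False
    have "chord_sum m \<gamma> ts \<le> K * (last ts - hd ts)"
      by (rule chord_sum_le_Lipschitz) (use assms(1) ts False in blast)+
    also have "\<dots> \<le> K * (b - a)"
      using ts(2) False assms(3) hd_in_set[of ts] last_in_set[of ts]
      by (intro mult_left_mono) (auto simp: subset_iff intro!: diff_mono)
    finally show ?thesis .
  qed (use assms in auto)
  then show "ennreal (chord_sum m \<gamma> ts) \<le> ennreal (K * (b - a))" by (rule ennreal_leI)
qed

lemma curve_length_refl: "\<gamma> a \<in> mspace m \<Longrightarrow> curve_length m \<gamma> a a = 0"
  using curve_length_le_Lipschitz[of a a m \<gamma> 0] by (simp add: mdist_props)


section \<open>The arc length function of a rectifiable curve\<close>

definition arc_len :: "'a metric \<Rightarrow> (real \<Rightarrow> 'a) \<Rightarrow> real \<Rightarrow> real" where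
  "arc_len m \<gamma> t = enn2real (curve_length m \<gamma> 0 t)"

lemma rectifiable_curve_in_mspace:
  "rectifiable_curve m \<gamma> \<Longrightarrow> t \<in> {0..1} \<Longrightarrow> \<gamma> t \<in> mspace m"
  using path_image_subset_topspace[of "mtopology_of m" \<gamma>] by (auto simp: rectifiable_curve_def)

lemma curve_length_finite:
  "rectifiable_curve m \<gamma> \<Longrightarrow> 0 \<le> a \<Longrightarrow> b \<le> 1 \<Longrightarrow> curve_length m \<gamma> a b < \<infinity>"
  using curve_length_mono[of a b 0 1 m \<gamma>] by (auto simp: rectifiable_curve_def intro: le_less_trans)

lemma curve_length_eq_arc_len:
  assumes "rectifiable_curve m \<gamma>" "0 \<le> s" "s \<le> t" "t \<le> 1"
  shows "curve_length m \<gamma> s t = ennreal (arc_len m \<gamma> t - arc_len m \<gamma> s)"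
proof -
  have fin: "curve_length m \<gamma> 0 s < \<infinity>" "curve_length m \<gamma> s t < \<infinity>"
    using curve_length_finite[OF assms(1)] assms by auto
  have "curve_length m \<gamma> 0 t = curve_length m \<gamma> 0 s + curve_length m \<gamma> s t"
    by (rule curve_length_add) (use assms rectifiable_curve_in_mspace[OF assms(1)] in auto)
  then have "arc_len m \<gamma> t = arc_len m \<gamma> s + enn2real (curve_length m \<gamma> s t)"
    using fin by (simp add: arc_len_def enn2real_plus)
  then show ?thesis using fin by (simp add: ennreal_enn2real)
qed

lemma arc_len_nonneg: "arc_len m \<gamma> t \<ge> 0"
  by (simp add: arc_len_def)

lemma arc_len_0:
  "rectifiable_curve m \<gamma> \<Longrightarrow> arc_len m \<gamma> 0 = 0"
  using curve_length_refl[of \<gamma> 0 m] rectifiable_curve_in_mspace[of m \<gamma> 0] by (simp add: arc_len_def)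

lemma curve_length_0_eq:
  assumes "rectifiable_curve m \<gamma>" "t \<in> {0..1}"
  shows "curve_length m \<gamma> 0 t = ennreal (arc_len m \<gamma> t)"
  using curve_length_eq_arc_len[of m \<gamma> 0 t] assms by (simp add: arc_len_0)

lemma arc_len_mono:
  assumes "rectifiable_curve m \<gamma>" "0 \<le> s" "s \<le> t" "t \<le> 1"
  shows "arc_len m \<gamma> s \<le> arc_len m \<gamma> t"
proof -
  have "curve_length m \<gamma> 0 s \<le> curve_length m \<gamma> 0 t"
    using assms by (intro curve_length_mono) auto
  then show ?thesis
    using assms by (simp add: curve_length_0_eq arc_len_nonneg)
qed

lemma mdist_le_arc_len:
  assumes "rectifiable_curve m \<gamma>" "s \<in> {0..1}" "t \<in> {0..1}"
  shows "mdist m (\<gamma> s) (\<gamma> t) \<le> \<bar>arc_len m \<gamma> s - arc_len m \<gamma> t\<bar>"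
proof -
  have *: "mdist m (\<gamma> s) (\<gamma> t) \<le> arc_len m \<gamma> t - arc_len m \<gamma> s" if "0 \<le> s" "s \<le> t" "t \<le> 1" for s t
    using mdist_le_curve_length[OF that(2), of m \<gamma>] arc_len_mono[OF assms(1) that]
    by (simp add: curve_length_eq_arc_len[OF assms(1) that])
  show ?thesis
    using *[of s t] *[of t s] assms by (cases s t rule: le_cases) (auto simp: mdist_props(2))
qed

lemma continuous_on_mdist_curve:
  assumes "pathin (mtopology_of m) \<gamma>" "continuous_on {0..1} f" "continuous_on {0..1} h"
    "f \<in> {0..1} \<rightarrow> {0..1}" "h \<in> {0..1} \<rightarrow> {0..1}"
  shows "continuous_on {0..1} (\<lambda>s. mdist m (\<gamma> (f s)) (\<gamma> (h s)))"
proof -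
  have *: "continuous_map (top_of_set {0..1}) (mtopology_of m) (\<gamma> \<circ> f)"
    if "continuous_on {0..1} f" "f \<in> {0..1} \<rightarrow> {0..1}" for f
    using assms(1) that unfolding pathin_def
    by (intro continuous_map_compose[of _ "top_of_set {0..1}"]) (auto simp: continuous_map_in_subtopology)
  have "continuous_map (top_of_set {0..1}) euclidean (\<lambda>s. mdist m ((\<gamma> \<circ> f) s) ((\<gamma> \<circ> h) s))"
    by (intro continuous_map_mdist * assms)
  then show ?thesis by simp
qed

lemma continuous_on_chord_sum:
  assumes "pathin (mtopology_of m) \<gamma>"
    and "\<And>f. f \<in> set fs \<Longrightarrow> continuous_on {0..1} f \<and> f \<in> {0..1} \<rightarrow> {0..1}"
  shows "continuous_on {0..1} (\<lambda>s. chord_sum m \<gamma> (map (\<lambda>f. f s) fs))"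
  using assms(2)
proof (induction fs rule: induct_list012)
  case (3 f h fs)
  then show ?case
    by (auto intro!: continuous_on_add continuous_on_mdist_curve assms(1))
qed (auto simp: continuous_on_const)

lemma eventually_at_withinI: "(\<And>s. s \<in> S \<Longrightarrow> P s) \<Longrightarrow> eventually P (at t within S)"
  by (simp add: eventually_at_filter)

text \<open>Lower semicontinuity. A partition of [0, t] with chord sum above c is clamped by
  \<open>min s\<close> into [0, s]; its chord sum depends continuously on s and has the old value at
  s = t. For the length from s to 1 the clamp is \<open>max s\<close>.\<close>

lemma eventually_less_curve_length:
  assumes "rectifiable_curve m \<gamma>" "t \<in> {0..1}"
  shows "ennreal c < curve_length m \<gamma> 0 t \<Longrightarrow>
           \<forall>\<^sub>F s in at t within {0..1}. ennreal c < curve_length m \<gamma> 0 s"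
    and "ennreal c < curve_length m \<gamma> t 1 \<Longrightarrow>
           \<forall>\<^sub>F s in at t within {0..1}. ennreal c < curve_length m \<gamma> s 1"
proof -
  have path: "pathin (mtopology_of m) \<gamma>" using assms by (simp add: rectifiable_curve_def)
  have *: "\<forall>\<^sub>F s in at t within {0..1}. ennreal c < ennreal (chord_sum m \<gamma> (map (\<lambda>f. f s) fs))"
    if "\<And>f. f \<in> set fs \<Longrightarrow> continuous_on {0..1} f \<and> f \<in> {0..1} \<rightarrow> {0..1}"
      "ennreal c < ennreal (chord_sum m \<gamma> (map (\<lambda>f. f t) fs))" for fs
  proof -
    have "((\<lambda>s. ennreal (chord_sum m \<gamma> (map (\<lambda>f. f s) fs))) \<longlongrightarrow>
           ennreal (chord_sum m \<gamma> (map (\<lambda>f. f t) fs))) (at t within {0..1})"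
      using continuous_on_chord_sum[OF path that(1)] assms(2)
      by (intro tendsto_ennrealI) (auto simp: continuous_on_def)
    then show ?thesis using that(2) by (rule order_tendstoD)
  qed
  { assume "ennreal c < curve_length m \<gamma> 0 t"
    then obtain ts where ts: "sorted ts" "set ts \<subseteq> {0..t}" "ennreal c < ennreal (chord_sum m \<gamma> ts)"
      unfolding curve_length_eq less_SUP_iff by auto
    let ?fs = "map (\<lambda>x s. min s x) ts"
    have eq: "map (\<lambda>f. f s) ?fs = map (min s) ts" for s by simp
    have "map (min t) ts = ts" using ts(2) by (intro map_idI) auto
    then have "\<forall>\<^sub>F s in at t within {0..1}. ennreal c < ennreal (chord_sum m \<gamma> (map (\<lambda>f. f s) ?fs))"
      using ts assms(2)
      by (intro *) (auto intro!: continuous_intros simp: o_def subset_iff min_le_iff_disj le_max_iff_disj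
          intro: order_trans)
    then show "\<forall>\<^sub>F s in at t within {0..1}. ennreal c < curve_length m \<gamma> 0 s"
    proof (rule eventually_mp[rotated], intro eventually_at_withinI)
      fix s :: real assume "s \<in> {0..1}"
      then have "ennreal (chord_sum m \<gamma> (map (min s) ts)) \<le> curve_length m \<gamma> 0 s"
        using ts by (intro chord_sum_le_curve_length) (auto intro!: sorted_map_mono monotone_onI)
      then show "ennreal c < ennreal (chord_sum m \<gamma> (map (\<lambda>f. f s) ?fs)) \<longrightarrow> ennreal c < curve_length m \<gamma> 0 s"
        unfolding eq by auto
    qed }
  { assume "ennreal c < curve_length m \<gamma> t 1"
    then obtain ts where ts: "sorted ts" "set ts \<subseteq> {t..1}" "ennreal c < ennreal (chord_sum m \<gamma> ts)"
      unfolding curve_length_eq less_SUP_iff by auto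
    let ?fs = "map (\<lambda>x s. max s x) ts"
    have eq: "map (\<lambda>f. f s) ?fs = map (max s) ts" for s by simp
    have "map (max t) ts = ts" using ts(2) by (intro map_idI) auto
    then have "\<forall>\<^sub>F s in at t within {0..1}. ennreal c < ennreal (chord_sum m \<gamma> (map (\<lambda>f. f s) ?fs))"
      using ts assms(2)
      by (intro *) (auto intro!: continuous_intros simp: o_def subset_iff min_le_iff_disj le_max_iff_disj
          intro: order_trans)
    then show "\<forall>\<^sub>F s in at t within {0..1}. ennreal c < curve_length m \<gamma> s 1"
    proof (rule eventually_mp[rotated], intro eventually_at_withinI)
      fix s :: real assume "s \<in> {0..1}"
      then have "ennreal (chord_sum m \<gamma> (map (max s) ts)) \<le> curve_length m \<gamma> s 1"
        using ts by (intro chord_sum_le_curve_length) (auto intro!: sorted_map_mono monotone_onI)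
      then show "ennreal c < ennreal (chord_sum m \<gamma> (map (\<lambda>f. f s) ?fs)) \<longrightarrow> ennreal c < curve_length m \<gamma> s 1"
        unfolding eq by auto
    qed }
qed

text \<open>Both \<open>curve_length m \<gamma> 0 t\<close> and \<open>curve_length m \<gamma> t 1\<close> are lower semicontinuous in \<open>t\<close>, being
  suprema of continuous functions, and their sum is constant.\<close>

lemma continuous_on_arc_len:
  assumes "rectifiable_curve m \<gamma>"
  shows "continuous_on {0..1} (arc_len m \<gamma>)"
  unfolding continuous_on_def
proof
  fix t :: real assume t: "t \<in> {0..1}"
  let ?L = "arc_len m \<gamma>"
  show "(?L \<longlongrightarrow> ?L t) (at t within {0..1})"
  proof (rule order_tendstoI)
    fix c assume c: "c < ?L t"
    show "\<forall>\<^sub>F s in at t within {0..1}. c < ?L s"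
    proof (cases "c < 0")
      case True
      then show ?thesis using arc_len_nonneg[of m \<gamma>] by (auto intro!: always_eventually intro: less_le_trans)
    next
      case False
      have "\<forall>\<^sub>F s in at t within {0..1}. ennreal c < curve_length m \<gamma> 0 s"
        using c False by (intro eventually_less_curve_length assms t) (use t in \<open>simp add: curve_length_0_eq assms ennreal_less_iff\<close>)
      then show ?thesis
        by (rule eventually_mp[rotated], intro eventually_at_withinI)
           (use False in \<open>auto simp: curve_length_0_eq assms ennreal_less_iff\<close>)
    qed
  next
    fix c assume c: "?L t < c"
    show "\<forall>\<^sub>F s in at t within {0..1}. ?L s < c"
    proof (cases "?L 1 < c")
      case True
      then show ?thesis
        by (intro eventually_at_withinI) (auto intro: le_less_trans[OF arc_len_mono[OF assms, of _ 1]])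
    next
      case False
      have *: "curve_length m \<gamma> s 1 = ennreal (?L 1 - ?L s)" if "s \<in> {0..1}" for s
        using curve_length_eq_arc_len[OF assms, of s 1] that by simp
      have "\<forall>\<^sub>F s in at t within {0..1}. ennreal (?L 1 - c) < curve_length m \<gamma> s 1"
        using c False by (intro eventually_less_curve_length assms t) (use t in \<open>simp add: * ennreal_less_iff\<close>)
      then show ?thesis
        by (rule eventually_mp[rotated], intro eventually_at_withinI)
           (use False in \<open>auto simp: * assms ennreal_less_iff\<close>)
    qed
  qed
qed

section \<open>The arc length parametrization\<close>

definition arc_time :: "'a metric \<Rightarrow> (real \<Rightarrow> 'a) \<Rightarrow> real \<Rightarrow> real" where
  "arc_time m \<gamma> s = (SOME t. t \<in> {0..1} \<and> curve_length m \<gamma> 0 t = ennreal s)"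

lemma arclength_param_eq: "arclength_param m \<gamma> s = \<gamma> (arc_time m \<gamma> s)"
  by (simp add: arclength_param_def arc_time_def)

text \<open>That the choice has a witness is the intermediate value theorem; this is what continuity
  of \<open>arc_len\<close> is for.\<close>

lemma arc_time:
  assumes "rectifiable_curve m \<gamma>" "s \<in> {0..arc_len m \<gamma> 1}"
  shows "arc_time m \<gamma> s \<in> {0..1}" "arc_len m \<gamma> (arc_time m \<gamma> s) = s"
proof -
  obtain t where t: "0 \<le> t" "t \<le> 1" "arc_len m \<gamma> t = s"
    using IVT'[of "arc_len m \<gamma>" 0 s 1] assms continuous_on_arc_len[of m \<gamma>] by (auto simp: arc_len_0)
  then have "t \<in> {0..1} \<and> curve_length m \<gamma> 0 t = ennreal s"
    using curve_length_0_eq[OF assms(1), of t] by auto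
  then have *: "arc_time m \<gamma> s \<in> {0..1} \<and> curve_length m \<gamma> 0 (arc_time m \<gamma> s) = ennreal s"
    unfolding arc_time_def by (rule someI)
  then show "arc_time m \<gamma> s \<in> {0..1}" by blast
  show "arc_len m \<gamma> (arc_time m \<gamma> s) = s"
    using * assms(2) by (simp add: arc_len_def)
qed

text \<open>The chosen parameter may differ from t, but the arc length agrees at both, and the
  distance of two points of the curve is at most the difference of their arc lengths.\<close>

lemma arclength_param_arc_len:
  assumes "rectifiable_curve m \<gamma>" "t \<in> {0..1}"
  shows "arclength_param m \<gamma> (arc_len m \<gamma> t) = \<gamma> t"
proof -
  have "arc_len m \<gamma> t \<in> {0..arc_len m \<gamma> 1}"
    using arc_len_mono[OF assms(1), of t 1] assms(2) by (auto simp: arc_len_nonneg)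
  from arc_time[OF assms(1) this] show ?thesis
    using mdist_le_arc_len[OF assms(1), of "arc_time m \<gamma> (arc_len m \<gamma> t)" t] assms(2)
    by (auto simp: arclength_param_eq mdist_props(1) intro!: mdist_props(5)[of _ m]
        rectifiable_curve_in_mspace[OF assms(1)] intro: antisym)
qed

lemma arclength_param_Lipschitz:
  assumes "rectifiable_curve m \<gamma>" "s \<in> {0..arc_len m \<gamma> 1}" "s' \<in> {0..arc_len m \<gamma> 1}"
  shows "mdist m (arclength_param m \<gamma> s) (arclength_param m \<gamma> s') \<le> \<bar>s - s'\<bar>"
  using mdist_le_arc_len[OF assms(1) arc_time(1)[OF assms(1,2)] arc_time(1)[OF assms(1,3)]]
    arc_time(2)[OF assms(1,2)] arc_time(2)[OF assms(1,3)]
  by (simp add: arclength_param_eq)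

lemma arclength_param_in_mspace:
  "rectifiable_curve m \<gamma> \<Longrightarrow> s \<in> {0..arc_len m \<gamma> 1} \<Longrightarrow> arclength_param m \<gamma> s \<in> mspace m"
  unfolding arclength_param_eq by (intro rectifiable_curve_in_mspace arc_time(1))


lemma arc_len_le_Lipschitz:
  assumes "\<gamma> \<in> {0..1} \<rightarrow> mspace m" "K \<ge> 0"
    and "\<And>s t. s \<in> {0..1} \<Longrightarrow> t \<in> {0..1} \<Longrightarrow> mdist m (\<gamma> s) (\<gamma> t) \<le> K * \<bar>s - t\<bar>"
  shows "rectifiable_curve m \<gamma>"
    and "0 \<le> s \<Longrightarrow> s \<le> t \<Longrightarrow> t \<le> 1 \<Longrightarrow> arc_len m \<gamma> t - arc_len m \<gamma> s \<le> K * (t - s)"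
proof -
  have "Lipschitz_continuous_map (submetric euclidean_metric {0..1}) m \<gamma>"
    unfolding Lipschitz_continuous_map_def using assms by (auto intro!: exI[of _ K] simp: dist_real_def)
  then have path: "pathin (mtopology_of m) \<gamma>"
    using Lipschitz_continuous_imp_continuous_map[of "submetric euclidean_metric {0..1}" m \<gamma>]
    by (simp add: pathin_def mtopology_of_submetric)
  have *: "curve_length m \<gamma> s t \<le> ennreal (K * (t - s))" if "0 \<le> s" "s \<le> t" "t \<le> 1" for s t
    by (rule curve_length_le_Lipschitz) (use that assms in auto)
  then show rect: "rectifiable_curve m \<gamma>"
    unfolding rectifiable_curve_def using path *[of 0 1] by (auto intro: le_less_trans)
  show "0 \<le> s \<Longrightarrow> s \<le> t \<Longrightarrow> t \<le> 1 \<Longrightarrow> arc_len m \<gamma> t - arc_len m \<gamma> s \<le> K * (t - s)"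
    using *[of s t] assms(2) arc_len_mono[OF rect, of s t]
    by (simp add: curve_length_eq_arc_len[OF rect])
qed

section \<open>Line integrals\<close>

lemma measurable_metric_borel:
  assumes "continuous_map (top_of_set S) (mtopology_of m) f"
  shows "f \<in> measurable (restrict_space borel S) (metric_borel m)"
  unfolding metric_borel_def
proof (rule measurable_measure_of)
  show "{U. openin (mtopology_of m) U} \<subseteq> Pow (mspace m)"
    using openin_subset[of "mtopology_of m"] by auto
  show "f \<in> space (restrict_space borel S) \<rightarrow> mspace m"
    using continuous_map_image_subset_topspace[OF assms] by (auto simp: space_restrict_space)
  fix U assume "U \<in> {U. openin (mtopology_of m) U}"
  then have "openin (top_of_set S) {x \<in> S. f x \<in> U}"
    using openin_continuous_map_preimage[OF assms, of U] by simp
  then obtain T where "open T" "{x \<in> S. f x \<in> U} = S \<inter> T"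
    by (auto simp: openin_open)
  then show "f -` U \<inter> space (restrict_space borel S) \<in> sets (restrict_space borel S)"
    by (auto simp: sets_restrict_space space_restrict_space vimage_def image_iff conj_commute
        intro!: bexI[of _ T])
qed

lemma measurable_metric_borel_Lipschitz:
  assumes "f \<in> S \<rightarrow> mspace m"
    "\<And>s t. s \<in> S \<Longrightarrow> t \<in> S \<Longrightarrow> mdist m (f s) (f t) \<le> K * dist s t"
  shows "f \<in> measurable (restrict_space borel S) (metric_borel m)"
proof (rule measurable_metric_borel)
  have "Lipschitz_continuous_map (submetric euclidean_metric S) m f"
    unfolding Lipschitz_continuous_map_def using assms by (auto intro!: exI[of _ K])
  then show "continuous_map (top_of_set S) (mtopology_of m) f"
    using Lipschitz_continuous_imp_continuous_map[of "submetric euclidean_metric S" m f]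
    by (simp add: mtopology_of_submetric)
qed

lemma measurable_arclength_param:
  assumes "rectifiable_curve m \<gamma>"
  shows "arclength_param m \<gamma> \<in> measurable (restrict_space borel {0..arc_len m \<gamma> 1}) (metric_borel m)"
  using arclength_param_in_mspace[OF assms] arclength_param_Lipschitz[OF assms]
  by (intro measurable_metric_borel_Lipschitz[where K=1] funcsetI) (simp_all add: dist_real_def)

text \<open>Valid for every g: the nonnegative integral against a completion agrees with that
  against the underlying measure also for nonmeasurable integrands, and weak upper gradients are in
  general not Borel.\<close>

lemma line_integral_eq:
  "line_integral m \<gamma> g = (\<integral>\<^sup>+ s. g (arclength_param m \<gamma> s) * indicator {0..arc_len m \<gamma> 1} s \<partial>lborel)"
  by (simp add: line_integral_def arc_len_def nn_integral_completion)

lemma borel_measurable_along: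
  assumes "rectifiable_curve m \<gamma>" "g \<in> borel_measurable (metric_borel m)"
  shows "(\<lambda>s. g (arclength_param m \<gamma> s) * indicator {0..arc_len m \<gamma> 1} s :: ennreal) \<in> borel_measurable borel"
proof -
  have "(\<lambda>s. g (arclength_param m \<gamma> s)) \<in> borel_measurable (restrict_space borel {0..arc_len m \<gamma> 1})"
    using measurable_compose[OF measurable_arclength_param[OF assms(1)] assms(2)] .
  then show ?thesis
    by (subst (asm) borel_measurable_restrict_space_iff_ennreal) (auto simp: mult.commute)
qed

lemma measurable_along_borel:
  assumes "rectifiable_curve m \<gamma>" "g \<in> borel_measurable (metric_borel m)"
  shows "measurable_along m \<gamma> g"
  unfolding measurable_along_def arc_len_def[symmetric]
proof (subst borel_measurable_restrict_space_iff_ennreal)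
  show "{0..arc_len m \<gamma> 1} \<inter> space lebesgue \<in> sets lebesgue" by simp
  show "(\<lambda>s. g (arclength_param m \<gamma> s) * indicator {0..arc_len m \<gamma> 1} s) \<in> borel_measurable lebesgue"
    using borel_measurable_along[OF assms] by (intro measurable_completion) (simp add: mult.commute)
qed

lemma curve_length_compose_mono:
  assumes "mono \<phi>"
  shows "curve_length m (\<gamma> \<circ> \<phi>) a b \<le> curve_length m \<gamma> (\<phi> a) (\<phi> b)"
proof (rule curve_length_le)
  fix ts assume "sorted ts" "set ts \<subseteq> {a..b}"
  then show "ennreal (chord_sum m (\<gamma> \<circ> \<phi>) ts) \<le> curve_length m \<gamma> (\<phi> a) (\<phi> b)"
    unfolding chord_sum_map[symmetric] using assms
    by (intro chord_sum_le_curve_length) (auto intro!: sorted_map_mono monotone_onI dest: monoD simp: subset_iff)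
qed

lemma curve_length_compose_antimono:
  assumes "antimono \<phi>"
  shows "curve_length m (\<gamma> \<circ> \<phi>) a b \<le> curve_length m \<gamma> (\<phi> b) (\<phi> a)"
proof (rule curve_length_le)
  fix ts assume ts: "sorted ts" "set ts \<subseteq> {a..b}"
  have "sorted (rev (map \<phi> ts))"
    using ts(1) assms by (auto simp: sorted_wrt_rev sorted_wrt_map dest: antimonoD elim!: sorted_wrt_mono_rel[rotated])
  then have "ennreal (chord_sum m \<gamma> (rev (map \<phi> ts))) \<le> curve_length m \<gamma> (\<phi> b) (\<phi> a)"
    using ts assms by (intro chord_sum_le_curve_length) (auto dest: antimonoD simp: subset_iff)
  then show "ennreal (chord_sum m (\<gamma> \<circ> \<phi>) ts) \<le> curve_length m \<gamma> (\<phi> b) (\<phi> a)"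
    by (simp add: chord_sum_rev chord_sum_map)
qed

lemma curve_length_affine:
  assumes "c > 0"
  shows "curve_length m (\<lambda>t. \<gamma> (c * t + d)) a b = curve_length m \<gamma> (c * a + d) (c * b + d)"
proof (rule antisym)
  show "curve_length m (\<lambda>t. \<gamma> (c * t + d)) a b \<le> curve_length m \<gamma> (c * a + d) (c * b + d)"
    using curve_length_compose_mono[of "\<lambda>t. c * t + d" m \<gamma> a b] assms
    by (auto simp: o_def mono_def mult_left_mono)
  show "curve_length m \<gamma> (c * a + d) (c * b + d) \<le> curve_length m (\<lambda>t. \<gamma> (c * t + d)) a b"
    using curve_length_compose_mono[of "\<lambda>t. (t - d) / c" m "\<lambda>t. \<gamma> (c * t + d)" "c * a + d" "c * b + d"] assms
    by (auto simp: o_def mono_def divide_right_mono)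
qed

lemma curve_length_reverse:
  "curve_length m (\<lambda>t. \<gamma> (1 - t)) a b = curve_length m \<gamma> (1 - b) (1 - a)"
proof (rule antisym)
  show "curve_length m (\<lambda>t. \<gamma> (1 - t)) a b \<le> curve_length m \<gamma> (1 - b) (1 - a)"
    using curve_length_compose_antimono[of "\<lambda>t. 1 - t" m \<gamma> a b] by (auto simp: o_def antimono_def)
  show "curve_length m \<gamma> (1 - b) (1 - a) \<le> curve_length m (\<lambda>t. \<gamma> (1 - t)) a b"
    using curve_length_compose_antimono[of "\<lambda>t. 1 - t" m "\<lambda>t. \<gamma> (1 - t)" "1 - b" "1 - a"]
    by (auto simp: o_def antimono_def)
qed


section \<open>Concatenation and reversal of curves\<close>

definition join_curves :: "(real \<Rightarrow> 'a) \<Rightarrow> (real \<Rightarrow> 'a) \<Rightarrow> real \<Rightarrow> 'a" where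
  "join_curves \<gamma> \<gamma>' = (\<lambda>t. if t \<le> 1/2 then \<gamma> (2 * t) else \<gamma>' (2 * t - 1))"

lemma pathin_join_curves:
  assumes "pathin X \<gamma>" "pathin X \<gamma>'" "\<gamma> 1 = \<gamma>' 0"
  shows "pathin X (join_curves \<gamma> \<gamma>')"
  unfolding pathin_def join_curves_def
proof (rule continuous_map_cases_le)
  let ?I = "top_of_set {0..1::real}"
  have 1: "continuous_map (subtopology ?I {x \<in> topspace ?I. x \<le> 1/2}) ?I (\<lambda>t. 2 * t)"
    by (auto simp: continuous_map_in_subtopology subtopology_subtopology intro!: continuous_intros)
  show "continuous_map (subtopology ?I {x \<in> topspace ?I. x \<le> 1/2}) X (\<lambda>t. \<gamma> (2 * t))"
    using continuous_map_compose[OF 1 assms(1)[unfolded pathin_def]] by (simp add: o_def)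
  have 2: "continuous_map (subtopology ?I {x \<in> topspace ?I. 1/2 \<le> x}) ?I (\<lambda>t. 2 * t - 1)"
    by (auto simp: continuous_map_in_subtopology subtopology_subtopology intro!: continuous_intros)
  show "continuous_map (subtopology ?I {x \<in> topspace ?I. 1/2 \<le> x}) X (\<lambda>t. \<gamma>' (2 * t - 1))"
    using continuous_map_compose[OF 2 assms(2)[unfolded pathin_def]] by (simp add: o_def)
  show "\<gamma> (2 * t) = \<gamma>' (2 * t - 1)" if "t = 1/2" for t
    unfolding that using assms(3) by simp
qed auto

lemma curve_length_join_curves:
  assumes "\<gamma> 1 = \<gamma>' 0"
  shows "t \<le> 1 \<Longrightarrow> curve_length m (join_curves \<gamma> \<gamma>') 0 (t/2) = curve_length m \<gamma> 0 t"
    and "curve_length m (join_curves \<gamma> \<gamma>') (1/2) ((1 + t)/2) = curve_length m \<gamma>' 0 t"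
proof -
  assume "t \<le> 1"
  then have "curve_length m (join_curves \<gamma> \<gamma>') 0 (t/2) = curve_length m (\<lambda>t. \<gamma> (2 * t + 0)) 0 (t/2)"
    by (intro curve_length_cong) (auto simp: join_curves_def)
  also have "\<dots> = curve_length m \<gamma> 0 t" by (subst curve_length_affine) auto
  finally show "curve_length m (join_curves \<gamma> \<gamma>') 0 (t/2) = curve_length m \<gamma> 0 t" .
next
  have "curve_length m (join_curves \<gamma> \<gamma>') (1/2) ((1 + t)/2) = curve_length m (\<lambda>t. \<gamma>' (2 * t + (-1))) (1/2) ((1 + t)/2)"
  proof (rule curve_length_cong)
    fix s assume "s \<in> {1/2..(1 + t)/2}"
    then consider "s = 1/2" | "\<not> s \<le> 1/2" by fastforce
    then show "join_curves \<gamma> \<gamma>' s = \<gamma>' (2 * s + (-1))"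
    proof cases
      case 1
      show ?thesis unfolding 1 using assms by (simp add: join_curves_def)
    qed (simp add: join_curves_def)
  qed
  also have "\<dots> = curve_length m \<gamma>' 0 t"
    by (subst curve_length_affine) (auto simp: add_divide_distrib)
  finally show "curve_length m (join_curves \<gamma> \<gamma>') (1/2) ((1 + t)/2) = curve_length m \<gamma>' 0 t" .
qed

lemma rectifiable_join_curves:
  assumes \<gamma>: "rectifiable_curve m \<gamma>" "rectifiable_curve m \<gamma>'" "\<gamma> 1 = \<gamma>' 0"
  shows "rectifiable_curve m (join_curves \<gamma> \<gamma>')"
    and "t \<in> {0..1} \<Longrightarrow> arc_len m (join_curves \<gamma> \<gamma>') (t/2) = arc_len m \<gamma> t"
    and "t \<in> {0..1} \<Longrightarrow> arc_len m (join_curves \<gamma> \<gamma>') ((1 + t)/2) = arc_len m \<gamma> 1 + arc_len m \<gamma>' t"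
proof -
  let ?J = "join_curves \<gamma> \<gamma>'"
  have path: "pathin (mtopology_of m) ?J"
    using assms by (intro pathin_join_curves) (auto simp: rectifiable_curve_def)
  have in_m: "?J \<in> {0..1} \<rightarrow> mspace m"
    using path_image_subset_topspace[OF path] by simp
  have *: "curve_length m ?J 0 ((1 + t)/2) = curve_length m \<gamma> 0 1 + curve_length m \<gamma>' 0 t" if "t \<in> {0..1}" for t
  proof -
    have "curve_length m ?J 0 ((1 + t)/2) = curve_length m ?J 0 (1/2) + curve_length m ?J (1/2) ((1 + t)/2)"
      by (rule curve_length_add) (use that in_m in auto)
    then show ?thesis using curve_length_join_curves[where \<gamma>=\<gamma> and \<gamma>'=\<gamma>', OF assms(3)] by simp
  qed
  show rect: "rectifiable_curve m ?J"
    using path *[of 1] \<gamma> by (auto simp: rectifiable_curve_def)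
  show "t \<in> {0..1} \<Longrightarrow> arc_len m ?J (t/2) = arc_len m \<gamma> t"
    unfolding arc_len_def using curve_length_join_curves(1)[where \<gamma>=\<gamma> and \<gamma>'=\<gamma>', OF assms(3)] by simp
  show "t \<in> {0..1} \<Longrightarrow> arc_len m ?J ((1 + t)/2) = arc_len m \<gamma> 1 + arc_len m \<gamma>' t"
    using * curve_length_finite[OF \<gamma>(1)] curve_length_finite[OF \<gamma>(2)]
    unfolding arc_len_def by (simp add: enn2real_plus)
qed

text \<open>The integrand of the joined curve is bounded by those of the pieces, the second
  translated by the length \<open>?L\<close> of the first. At the joint both pieces contribute, so
  the pointwise relation is an inequality, which suffices for the triangle inequality of the
  uniformized metric.\<close>

lemma line_integral_join_curves:
  assumes \<gamma>: "rectifiable_curve m \<gamma>" "rectifiable_curve m \<gamma>'" "\<gamma> 1 = \<gamma>' 0"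
    and g: "g \<in> borel_measurable (metric_borel m)"
  shows "line_integral m (join_curves \<gamma> \<gamma>') g \<le> line_integral m \<gamma> g + line_integral m \<gamma>' g"
proof -
  let ?J = "join_curves \<gamma> \<gamma>'" and ?L = "arc_len m \<gamma> 1" and ?L' = "arc_len m \<gamma>' 1"
  note J = rectifiable_join_curves[OF \<gamma>]
  have p1: "arclength_param m ?J s = arclength_param m \<gamma> s" if "s \<in> {0..?L}" for s
  proof -
    let ?t = "arc_time m \<gamma> s"
    have t: "?t \<in> {0..1}" "arc_len m \<gamma> ?t = s" using arc_time[OF \<gamma>(1) that] by auto
    then have "arclength_param m ?J s = ?J (?t/2)"
      using arclength_param_arc_len[OF J(1), of "?t/2"] J(2)[of ?t] by auto
    then show ?thesis using t by (simp add: join_curves_def arclength_param_eq)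
  qed
  have p2: "arclength_param m ?J (?L + s) = arclength_param m \<gamma>' s" if "s \<in> {0..?L'}" for s
  proof -
    let ?t = "arc_time m \<gamma>' s"
    have t: "?t \<in> {0..1}" "arc_len m \<gamma>' ?t = s" using arc_time[OF \<gamma>(2) that] by auto
    then have "arclength_param m ?J (?L + s) = ?J ((1 + ?t)/2)"
      using arclength_param_arc_len[OF J(1), of "(1 + ?t)/2"] J(3)[of ?t] by auto
    also have "?J ((1 + ?t)/2) = \<gamma>' ?t"
      using t \<gamma>(3) by (auto simp: join_curves_def field_simps)
    finally show ?thesis by (simp add: arclength_param_eq)
  qed
  let ?F = "\<lambda>s. g (arclength_param m \<gamma> s) * indicator {0..?L} s"
  let ?F' = "\<lambda>s. g (arclength_param m \<gamma>' s) * indicator {0..?L'} s"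
  note [measurable] = borel_measurable_along[OF \<gamma>(1) g] borel_measurable_along[OF \<gamma>(2) g]
  have len: "arc_len m ?J 1 = ?L + ?L'" using J(3)[of 1] by simp
  have "line_integral m ?J g \<le> (\<integral>\<^sup>+ s. ?F s + ?F' (- ?L + 1 * s) \<partial>lborel)"
    unfolding line_integral_eq len
  proof (rule nn_integral_mono)
    fix s
    consider "s \<in> {0..?L}" | "s \<in> {?L<..?L + ?L'}" | "s \<notin> {0..?L + ?L'}"
      using arc_len_nonneg[of m \<gamma>' 1] by fastforce
    then show "g (arclength_param m ?J s) * indicator {0..?L + ?L'} s \<le> ?F s + ?F' (- ?L + 1 * s)"
    proof cases
      case 1
      then show ?thesis using p1[OF 1] arc_len_nonneg[of m \<gamma>' 1] by simp
    next
      case 2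
      then have "s - ?L \<in> {0..?L'}" by auto
      from p2[OF this] show ?thesis using 2 by (auto simp: indicator_def)
    qed simp
  qed
  also have "\<dots> = (\<integral>\<^sup>+ s. ?F s \<partial>lborel) + (\<integral>\<^sup>+ s. ?F' (- ?L + 1 * s) \<partial>lborel)"
    by (rule nn_integral_add) measurable
  also have "(\<integral>\<^sup>+ s. ?F' (- ?L + 1 * s) \<partial>lborel) = (\<integral>\<^sup>+ s. ?F' s \<partial>lborel)"
    using nn_integral_real_affine[of ?F' 1 "- ?L"] by simp
  finally show ?thesis unfolding line_integral_eq .
qed

lemma line_integral_reverse:
  assumes \<gamma>: "rectifiable_curve m \<gamma>" and g: "g \<in> borel_measurable (metric_borel m)"
  shows "rectifiable_curve m (\<lambda>t. \<gamma> (1 - t))"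
    and "line_integral m (\<lambda>t. \<gamma> (1 - t)) g \<le> line_integral m \<gamma> g"
proof -
  let ?R = "\<lambda>t. \<gamma> (1 - t)" and ?L = "arc_len m \<gamma> 1"
  have "continuous_map (top_of_set {0..1}) (top_of_set {0..1::real}) (\<lambda>t. 1 - t)"
    by (auto simp: continuous_map_in_subtopology intro!: continuous_intros)
  then have "pathin (mtopology_of m) ?R"
    using continuous_map_compose[of "top_of_set {0..1}" "top_of_set {0..1}" "\<lambda>t. 1 - t" "mtopology_of m" \<gamma>] \<gamma>
    by (simp add: pathin_def rectifiable_curve_def o_def)
  then show R: "rectifiable_curve m ?R"
    using \<gamma> by (simp add: rectifiable_curve_def curve_length_reverse)
  have len: "arc_len m ?R (1 - t) = ?L - arc_len m \<gamma> t" if "t \<in> {0..1}" for t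
    using curve_length_eq_arc_len[OF \<gamma>, of t 1] that arc_len_mono[OF \<gamma>, of t 1]
    by (simp add: arc_len_def[of m ?R] curve_length_reverse)
  then have len1: "arc_len m ?R 1 = ?L"
    using len[of 0] arc_len_0[OF \<gamma>] by simp
  have p: "arclength_param m ?R s = arclength_param m \<gamma> (?L - s)" if "s \<in> {0..?L}" for s
  proof -
    let ?t = "arc_time m \<gamma> (?L - s)"
    have t: "?t \<in> {0..1}" "arc_len m \<gamma> ?t = ?L - s" using arc_time[OF \<gamma>, of "?L - s"] that by auto
    then have "arclength_param m ?R s = ?R (1 - ?t)"
      using arclength_param_arc_len[OF R, of "1 - ?t"] len[of ?t] by auto
    then show ?thesis by (simp add: arclength_param_eq)
  qed
  let ?F = "\<lambda>s. g (arclength_param m \<gamma> s) * indicator {0..?L} s"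
  note [measurable] = borel_measurable_along[OF \<gamma> g]
  have "line_integral m ?R g = (\<integral>\<^sup>+ s. ?F (?L + (-1) * s) \<partial>lborel)"
    unfolding line_integral_eq len1
    by (intro nn_integral_cong) (use p in \<open>auto simp: indicator_def\<close>)
  also have "\<dots> = (\<integral>\<^sup>+ s. ?F s \<partial>lborel)"
    using nn_integral_real_affine[of ?F "-1" "?L"] by simp
  finally show "line_integral m ?R g \<le> line_integral m \<gamma> g" unfolding line_integral_eq by simp
qed

section \<open>Line integrals of Lipschitz curves\<close>

lemma emeasure_UN_le_nn_integral:
  assumes "countable I" "\<And>i. i \<in> I \<Longrightarrow> X i \<in> sets M"
  shows "emeasure M (\<Union>i\<in>I. X i) \<le> (\<integral>\<^sup>+ i. emeasure M (X i) \<partial>count_space I)"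
proof -
  have "emeasure M (\<Union>i\<in>I. X i) = (\<integral>\<^sup>+ x. indicator (\<Union>i\<in>I. X i) x \<partial>M)"
    using assms by (intro nn_integral_indicator[symmetric] sets.countable_UN') auto
  also have "\<dots> \<le> (\<integral>\<^sup>+ x. (\<integral>\<^sup>+ i. indicator (X i) x \<partial>count_space I) \<partial>M)"
  proof (rule nn_integral_mono)
    fix x
    show "indicator (\<Union>i\<in>I. X i) x \<le> (\<integral>\<^sup>+ i. indicator (X i) x \<partial>count_space I)"
    proof (cases "x \<in> (\<Union>i\<in>I. X i)")
      case True
      then obtain i where "i \<in> I" "x \<in> X i" by auto
      then show ?thesis using nn_integral_ge_point[of i I "\<lambda>i. indicator (X i) x"] by (simp add: indicator_def)
    qed simp
  qed
  also have "\<dots> = (\<integral>\<^sup>+ i. (\<integral>\<^sup>+ x. indicator (X i) x \<partial>M) \<partial>count_space I)"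
    using assms by (intro nn_integral_count_space_nn_integral) auto
  also have "\<dots> = (\<integral>\<^sup>+ i. emeasure M (X i) \<partial>count_space I)"
    using assms by (intro nn_integral_cong) auto
  finally show ?thesis .
qed


text \<open>It suffices to cover \<open>E\<close> efficiently by intervals with disjoint interiors.\<close>

lemma emeasure_arc_time_vimage_le:
  assumes K: "K \<ge> 0" and \<gamma>: "rectifiable_curve m \<gamma>"
    and lip: "\<And>s t. 0 \<le> s \<Longrightarrow> s \<le> t \<Longrightarrow> t \<le> 1 \<Longrightarrow> arc_len m \<gamma> t - arc_len m \<gamma> s \<le> K * (t - s)"
    and E: "E \<in> sets borel" "E \<subseteq> {0..1}"
  shows "emeasure lborel {s \<in> {0..arc_len m \<gamma> 1}. arc_time m \<gamma> s \<in> E} \<le> ennreal K * emeasure lborel E"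
proof (rule ennreal_le_epsilon)
  fix e :: real assume e: "e > 0"
  let ?L = "arc_len m \<gamma>"
  \<comment> \<open>Dividing by \<open>K + 1\<close> instead of K makes d positive with
    \<open>K * d \<le> e\<close> also when K = 0.\<close>
  define d where "d = e / (K + 1)"
  have d: "d > 0" "K * d \<le> e" using e K by (auto simp: d_def field_simps)
  have "emeasure lborel E \<le> emeasure lborel {0..1::real}" using E by (intro emeasure_mono) auto
  then have Efin: "E \<in> lmeasurable" using E by (auto simp: fmeasurable_def less_top intro: le_less_trans)
  have sub: "E \<subseteq> cbox 0 1" using E by (simp add: cbox_interval)
  obtain D where D: "countable D" "\<And>I. I \<in> D \<Longrightarrow> I \<subseteq> cbox 0 1 \<and> I \<noteq> {} \<and> (\<exists>c d. I = cbox c d)"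
      "pairwise (\<lambda>A B. interior A \<inter> interior B = {}) D" "E \<subseteq> \<Union>D" "\<Union>D \<in> lmeasurable"
      "measure lebesgue (\<Union>D) \<le> measure lebesgue E + d"
    by (rule measurable_outer_intervals_bounded[OF Efin sub d(1)]) (rule that; assumption)
  have I_eq: "\<exists>a b. I = {a..b} \<and> 0 \<le> a \<and> a \<le> b \<and> b \<le> 1" if I: "I \<in> D" for I
  proof -
    obtain a b where "I = {a..b}" "{a..b} \<subseteq> {0..1}" "{a..b} \<noteq> {}"
      using D(2)[OF I] by (auto simp: cbox_interval)
    then show ?thesis by auto
  qed
  \<comment> \<open>The interval spanned by the arc lengths over I. It contains every s whose chosen
    parameter lies in I, and its length is at most K times that of I.\<close>
  define X where "X I = {?L (Inf I)..?L (Sup I)}" for I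
  have X: "emeasure lborel (X I) \<le> ennreal K * emeasure lborel (interior I)" if I: "I \<in> D" for I
  proof -
    obtain a b where ab: "I = {a..b}" "0 \<le> a" "a \<le> b" "b \<le> 1" using I_eq[OF I] by blast
    then have "emeasure lborel (X I) = ennreal (?L b - ?L a)"
      using arc_len_mono[OF \<gamma>, of a b] by (simp add: X_def)
    also have "\<dots> \<le> ennreal (K * (b - a))" using lip ab by (intro ennreal_leI) auto
    finally show ?thesis using ab K by (simp add: ennreal_mult interior_atLeastAtMost_real)
  qed
  have "{s \<in> {0..?L 1}. arc_time m \<gamma> s \<in> E} \<subseteq> (\<Union>I\<in>D. X I)"
  proof safe
    fix s assume s: "s \<in> {0..?L 1}" "arc_time m \<gamma> s \<in> E"
    then obtain I where I: "I \<in> D" "arc_time m \<gamma> s \<in> I" using D(4) by auto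
    obtain a b where ab: "I = {a..b}" "0 \<le> a" "a \<le> b" "b \<le> 1" using I_eq[OF I(1)] by blast
    have "?L a \<le> s" "s \<le> ?L b"
      using arc_len_mono[OF \<gamma>, of a "arc_time m \<gamma> s"] arc_len_mono[OF \<gamma>, of "arc_time m \<gamma> s" b]
        arc_time[OF \<gamma> s(1)] ab I(2) by auto
    then show "s \<in> (\<Union>I\<in>D. X I)" using I(1) ab by (auto intro!: bexI[of _ I] simp: X_def)
  qed
  then have "emeasure lborel {s \<in> {0..?L 1}. arc_time m \<gamma> s \<in> E} \<le> emeasure lborel (\<Union>I\<in>D. X I)"
    by (rule emeasure_mono) (use D(1) in \<open>auto simp: X_def\<close>)
  also have "\<dots> \<le> (\<integral>\<^sup>+ I. emeasure lborel (X I) \<partial>count_space D)"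
    using D(1) by (intro emeasure_UN_le_nn_integral) (auto simp: X_def)
  also have "\<dots> \<le> (\<integral>\<^sup>+ I. ennreal K * emeasure lborel (interior I) \<partial>count_space D)"
    by (intro nn_integral_mono) (use X in auto)
  \<comment> \<open>The intervals overlap at most in endpoints, so their interiors are disjoint and
    the sum of the lengths is the measure of a union.\<close>
  also have "\<dots> = ennreal K * emeasure lborel (\<Union>I\<in>D. interior I)"
    using D(1,3) by (subst emeasure_UN_countable) (auto simp: nn_integral_cmult disjoint_family_on_def pairwise_def)
  finally have 1: "emeasure lborel {s \<in> {0..?L 1}. arc_time m \<gamma> s \<in> E} \<le> ennreal K * emeasure lborel (\<Union>I\<in>D. interior I)" .
  have "emeasure lborel (\<Union>I\<in>D. interior I) = emeasure lebesgue (\<Union>I\<in>D. interior I)"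
  proof -
    have "open (\<Union>I\<in>D. interior I)" by (intro open_UN) auto
    then show ?thesis by (subst emeasure_completion) (auto intro!: sets_completionI_sets borel_open)
  qed
  also have "\<dots> \<le> emeasure lebesgue (\<Union>D)"
    using D(5) interior_subset by (intro emeasure_mono) blast+
  also have "\<dots> = ennreal (measure lebesgue (\<Union>D))"
    using D(5) by (intro emeasure_eq_measure2) auto
  also have "\<dots> \<le> ennreal (measure lebesgue E + d)" by (rule ennreal_leI) (fact D(6))
  also have "\<dots> = emeasure lborel E + ennreal d"
    using emeasure_eq_measure2[OF Efin] E d by (simp add: ennreal_plus)
  finally have "ennreal K * emeasure lborel (\<Union>I\<in>D. interior I) \<le> ennreal K * (emeasure lborel E + ennreal d)"
    by (rule mult_left_mono) simp
  also have "\<dots> = ennreal K * emeasure lborel E + ennreal (K * d)"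
    using d K by (simp add: distrib_left ennreal_mult)
  also have "\<dots> \<le> ennreal K * emeasure lborel E + ennreal e"
    using d by (intro add_left_mono ennreal_leI)
  finally show "emeasure lborel {s \<in> {0..?L 1}. arc_time m \<gamma> s \<in> E} \<le> ennreal K * emeasure lborel E + ennreal e"
    using 1 by (rule order_trans[rotated])
qed

lemma arc_time_mono:
  assumes "rectifiable_curve m \<gamma>"
  shows "mono_on {0..arc_len m \<gamma> 1} (arc_time m \<gamma>)"
proof (rule monotone_onI)
  fix s s' assume s: "s \<in> {0..arc_len m \<gamma> 1}" "s' \<in> {0..arc_len m \<gamma> 1}" "s \<le> s'"
  show "arc_time m \<gamma> s \<le> arc_time m \<gamma> s'"
    using arc_time[OF assms s(1)] arc_time[OF assms s(2)] s(3)
      arc_len_mono[OF assms, of "arc_time m \<gamma> s'" "arc_time m \<gamma> s"]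
    by (cases "arc_time m \<gamma> s \<le> arc_time m \<gamma> s'") auto
qed

text \<open>The push-forward of Lebesgue measure on [0, L] under \<open>arc_time\<close> is at most
  K times Lebesgue measure on [0, 1], by the preimage estimate above. Integrating against these two
  measures gives the bound without differentiating the arc length.\<close>

lemma line_integral_le_Lipschitz:
  assumes \<gamma>: "\<gamma> \<in> {0..1} \<rightarrow> mspace m" and K: "K \<ge> 0"
    and lip: "\<And>s t. s \<in> {0..1} \<Longrightarrow> t \<in> {0..1} \<Longrightarrow> mdist m (\<gamma> s) (\<gamma> t) \<le> K * \<bar>s - t\<bar>"
    and g: "(\<lambda>t. g (\<gamma> t)) \<in> borel_measurable (restrict_space borel {0..1})"
  shows "line_integral m \<gamma> g \<le> ennreal K * (\<integral>\<^sup>+ t. g (\<gamma> t) * indicator {0..1} t \<partial>lborel)"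
proof -
  have rect: "rectifiable_curve m \<gamma>"
    by (rule arc_len_le_Lipschitz(1)[OF \<gamma> K]) (rule lip)
  have arc_lip: "arc_len m \<gamma> t - arc_len m \<gamma> s \<le> K * (t - s)" if "0 \<le> s" "s \<le> t" "t \<le> 1" for s t
    by (rule arc_len_le_Lipschitz(2)[OF \<gamma> K _ that]) (rule lip)
  let ?L = "arc_len m \<gamma> 1"
  let ?A = "restrict_space lborel {0..?L}" and ?B = "restrict_space lborel {0..1::real}"
  let ?T = "arc_time m \<gamma>"
  have [measurable]: "?T \<in> measurable ?A ?B"
  proof (rule measurable_restrict_space2)
    show "?T \<in> space ?A \<rightarrow> {0..1}" using arc_time(1)[OF rect] by (simp add: space_restrict_space Pi_iff)
    show "?T \<in> measurable ?A lborel"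
      using borel_measurable_mono_on_fnc[OF arc_time_mono[OF rect]]
      unfolding measurable_cong_sets[OF sets_restrict_space_cong[OF sets_lborel] sets_lborel] .
  qed
  have le: "distr ?A ?B ?T \<le> scale_measure (ennreal K) ?B"
  proof (rule le_measure[THEN iffD2])
    show "sets (distr ?A ?B ?T) = sets (scale_measure (ennreal K) ?B)"
      by (simp only: sets_distr sets_scale_measure)
    show "\<forall>E\<in>sets (distr ?A ?B ?T). emeasure (distr ?A ?B ?T) E \<le> emeasure (scale_measure (ennreal K) ?B) E"
    proof
      fix E assume "E \<in> sets (distr ?A ?B ?T)"
      then have E': "E \<in> sets ?B" by simp
      then have E: "E \<in> sets borel" "E \<subseteq> {0..1}"
        using sets_restrict_space_iff[of "{0..1::real}" lborel E] by auto
      have "emeasure (distr ?A ?B ?T) E = emeasure ?A (?T -` E \<inter> space ?A)"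
        using E' by (simp add: emeasure_distr)
      also have "\<dots> = emeasure lborel {s \<in> {0..?L}. ?T s \<in> E}"
        by (subst emeasure_restrict_space) (auto simp: space_restrict_space intro!: arg_cong[where f="emeasure lborel"])
      also have "\<dots> \<le> ennreal K * emeasure lborel E"
        by (rule emeasure_arc_time_vimage_le[OF K rect _ E]) (rule arc_lip)
      also have "\<dots> = emeasure (scale_measure (ennreal K) ?B) E"
        using E by (simp add: emeasure_restrict_space)
      finally show "emeasure (distr ?A ?B ?T) E \<le> emeasure (scale_measure (ennreal K) ?B) E" .
    qed
  qed
  have [measurable]: "(\<lambda>t. g (\<gamma> t)) \<in> borel_measurable ?B"
    using g unfolding measurable_cong_sets[OF sets_restrict_space_cong[OF sets_lborel] refl] .
  have "line_integral m \<gamma> g = (\<integral>\<^sup>+ s. g (\<gamma> (?T s)) \<partial>?A)"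
    unfolding line_integral_eq arclength_param_eq by (simp add: nn_integral_restrict_space)
  also have "\<dots> = (\<integral>\<^sup>+ t. g (\<gamma> t) \<partial>distr ?A ?B ?T)"
    by (rule nn_integral_distr[symmetric]) measurable
  also have "\<dots> \<le> (\<integral>\<^sup>+ t. g (\<gamma> t) \<partial>scale_measure (ennreal K) ?B)"
    by (rule nn_integral_mono_measure[OF _ le]) simp
  also have "\<dots> = ennreal K * (\<integral>\<^sup>+ t. g (\<gamma> t) \<partial>?B)"
    by (rule nn_integral_scale_measure) measurable
  also have "(\<integral>\<^sup>+ t. g (\<gamma> t) \<partial>?B) = (\<integral>\<^sup>+ t. g (\<gamma> t) * indicator {0..1} t \<partial>lborel)"
    by (simp add: nn_integral_restrict_space)
  finally show ?thesis .
qed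

section \<open>The metric graph\<close>

lemma edge_pt_0: "edge_pt v w 0 = vertex_pt v" and edge_pt_1: "edge_pt v w 1 = vertex_pt w"
  by (auto simp: edge_pt_def)

lemma edge_pt_Lipschitz: "\<bar>edge_pt v w s x - edge_pt v w t x\<bar> \<le> \<bar>s - t\<bar>"
  by (auto simp: edge_pt_def vertex_pt_def indicator_def)

text \<open>The level of a vertex, extended affinely along edges. It is 1-Lipschitz for the graph
  metric and vanishes at the root, so it bounds the distance to the root from below and hence the
  conformal weight from above.\<close>

definition height :: "('z \<times> nat \<Rightarrow> real) \<Rightarrow> real" where
  "height x = (\<Sum>v | x v \<noteq> 0. x v * real (snd v))"

lemma height_edge_pt:
  assumes "v \<noteq> w"
  shows "height (edge_pt v w t) = (1 - t) * real (snd v) + t * real (snd w)"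
proof -
  have "height (edge_pt v w t) = (\<Sum>x\<in>{v, w}. edge_pt v w t x * real (snd x))"
    unfolding height_def
    by (rule sum.mono_neutral_left) (auto simp: edge_pt_def vertex_pt_def indicator_def split: if_splits)
  then show ?thesis using assms by (simp add: edge_pt_def vertex_pt_def)
qed

lemma height_vertex_pt: "height (vertex_pt v) = real (snd v)"
proof -
  have "{x. vertex_pt v x \<noteq> 0} = {v}" by (auto simp: vertex_pt_def indicator_def)
  then show ?thesis by (simp add: height_def vertex_pt_def)
qed

context hyperbolic_filling
begin

abbreviation pts :: "('z \<times> nat \<Rightarrow> real) set" where "pts \<equiv> fill_points \<alpha> \<tau> A"
abbreviation chain where "chain \<equiv> fill_chain \<alpha> \<tau> A"
abbreviation root :: "'z \<times> nat \<Rightarrow> real" where "root \<equiv> vertex_pt (z0, 0)"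

lemma edge_in_pts: "adj v w \<Longrightarrow> t \<in> {0..1} \<Longrightarrow> edge_pt v w t \<in> pts"
  unfolding fill_points_def by blast

lemma vertex_in_pts: "v \<in> fill_vertices A \<Longrightarrow> vertex_pt v \<in> pts"
  by (auto simp: fill_points_def)

lemma root_in_pts: "root \<in> pts"
  by (rule vertex_in_pts) (simp add: fill_vertices_def net_0)

text \<open>Two kinds of functions vary along a chain by at most its length: the coordinates, which
  will separate distinct points, and \<open>height\<close>, because levels of neighbours differ by
  at most one.\<close>

lemma chain_facts:
  assumes "chain x y l"
  shows "x \<in> pts \<and> y \<in> pts \<and> 0 \<le> l \<and> (\<forall>v. \<bar>x v - y v\<bar> \<le> l) \<and> \<bar>height x - height y\<bar> \<le> l"
  using assms
proof induction
  case (fill_chain_step x v w s l t)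
  have "\<bar>x u - edge_pt v w t u\<bar> \<le> l + \<bar>s - t\<bar>" for u
    using fill_chain_step.IH edge_pt_Lipschitz[of v w s u t] by (smt (verit))
  moreover have "\<bar>height (edge_pt v w s) - height (edge_pt v w t)\<bar> \<le> \<bar>s - t\<bar>"
  proof -
    have "height (edge_pt v w s) - height (edge_pt v w t) = (s - t) * (real (snd w) - real (snd v))"
      by (simp add: height_edge_pt[OF adj_neq[OF fill_chain_step.hyps(2)]] algebra_simps)
    moreover have "\<bar>real (snd w) - real (snd v)\<bar> \<le> 1"
      using adj_level[of "fst v" "snd v" "fst w" "snd w"] fill_chain_step.hyps(2) by auto
    ultimately show ?thesis by (simp add: abs_mult mult_left_le)
  qed
  ultimately show ?case
    using fill_chain_step.IH edge_in_pts[OF fill_chain_step.hyps(2,4)] by (auto intro: order_trans)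
qed auto

lemma chain_trans: "chain y z l' \<Longrightarrow> chain x y l \<Longrightarrow> chain x z (l + l')"
proof (induction arbitrary: l rule: fill_chain.induct)
  case (fill_chain_step y v w s l' t)
  then have "chain x (edge_pt v w t) ((l + l') + \<bar>s - t\<bar>)"
    by (intro fill_chain.fill_chain_step) auto
  then show ?case by (simp add: add.assoc)
qed simp

lemma chain_edge:
  assumes "adj v w" "s \<in> {0..1}" "t \<in> {0..1}"
  shows "chain (edge_pt v w s) (edge_pt v w t) \<bar>s - t\<bar>"
  using fill_chain_step[OF fill_chain_refl[OF edge_in_pts[OF assms(1,2)]] assms(1) assms(2) assms(3)] by simp

lemma chain_sym: "chain x y l \<Longrightarrow> chain y x l"
proof (induction rule: fill_chain.induct)
  case (fill_chain_step x v w s l t)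
  then have "chain (edge_pt v w t) (edge_pt v w s) \<bar>t - s\<bar>" by (intro chain_edge) auto
  from chain_trans[OF fill_chain_step.IH this] show ?case by (simp add: abs_minus_commute add.commute)
qed (rule fill_chain_refl)

text \<open>Induction on the level: by \<open>net_cover\<close> every vertex of positive level has a
  neighbour one level closer to the root.\<close>

lemma chain_root: "x \<in> pts \<Longrightarrow> \<exists>l. chain x root l"
proof -
  have vert: "\<exists>l. chain (vertex_pt (z, n)) root l" if "z \<in> A n" for z n
    using that
  proof (induction n arbitrary: z)
    case 0
    then show ?case using fill_chain_refl[OF root_in_pts] net_0 by auto
  next
    case (Suc n)
    obtain z' where z': "z' \<in> A n" "dist z' z < rad n" using net_cover by blast
    then have "adj (z', n) (z, Suc n)" using Suc.prems rad_pos[of "Suc n"] by (intro adj_up[of _ _ _ z]) auto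
    then have "chain (vertex_pt (z, Suc n)) (vertex_pt (z', n)) 1"
      using chain_edge[OF adj_sym, of "(z', n)" "(z, Suc n)" 0 1] by (simp add: edge_pt_0 edge_pt_1)
    then show ?case using Suc.IH[OF z'(1)] by (metis chain_trans)
  qed
  assume "x \<in> pts"
  then consider v where "v \<in> fill_vertices A" "x = vertex_pt v"
    | v w t where "adj v w" "t \<in> {0..1}" "x = edge_pt v w t"
    by (auto simp: fill_points_def)
  then show ?thesis
  proof cases
    case 1
    then show ?thesis using vert by (cases v) (auto simp: fill_vertices_def)
  next
    case 2
    have "chain x (vertex_pt v) \<bar>t - 0\<bar>"
      using chain_edge[OF 2(1,2), of 0] 2(3) by (simp add: edge_pt_0)
    moreover have "\<exists>l. chain (vertex_pt v) root l"
      using vert adj_vertices[OF 2(1)] by (cases v) (auto simp: fill_vertices_def)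
    ultimately show ?thesis by (metis chain_trans)
  qed
qed

lemma chain_exists: "x \<in> pts \<Longrightarrow> y \<in> pts \<Longrightarrow> \<exists>l. chain x y l"
  using chain_root[of x] chain_root[of y] by (metis chain_sym chain_trans)

abbreviation "X \<equiv> filling \<alpha> \<tau> A"

lemma fill_dist_le: "chain x y l \<Longrightarrow> fill_dist \<alpha> \<tau> A x y \<le> l"
  unfolding fill_dist_def using chain_facts[of x y]
  by (auto intro!: cInf_lower bdd_belowI[of _ 0])

lemma fill_dist_greatest:
  assumes "x \<in> pts" "y \<in> pts" "\<And>l. chain x y l \<Longrightarrow> c \<le> l"
  shows "c \<le> fill_dist \<alpha> \<tau> A x y"
  unfolding fill_dist_def using assms chain_exists by (auto intro!: cInf_greatest)

text \<open>Definiteness comes from the coordinate bound in \<open>chain_facts\<close>: points at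
  distance zero have the same barycentric coordinates. For the triangle inequality the two infima
  are taken one after the other.\<close>

lemma Metric_space_filling: "Metric_space pts (fill_dist \<alpha> \<tau> A)"
proof
  show nonneg: "0 \<le> fill_dist \<alpha> \<tau> A x y" for x y
  proof (cases "x \<in> pts \<and> y \<in> pts")
    case True
    then show ?thesis using chain_facts[of x y] by (intro fill_dist_greatest) auto
  qed (auto simp: fill_dist_def)
  show "fill_dist \<alpha> \<tau> A x y = fill_dist \<alpha> \<tau> A y x" for x y
  proof -
    have "{l. chain x y l} = {l. chain y x l}" using chain_sym by auto
    then show ?thesis by (auto simp: fill_dist_def)
  qed
  fix x y z assume x: "x \<in> pts" and y: "y \<in> pts"
  show "fill_dist \<alpha> \<tau> A x y = 0 \<longleftrightarrow> x = y"
  proof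
    assume "fill_dist \<alpha> \<tau> A x y = 0"
    moreover have "\<bar>x v - y v\<bar> \<le> fill_dist \<alpha> \<tau> A x y" for v
      by (rule fill_dist_greatest[OF x y]) (use chain_facts[of x y] in blast)
    ultimately show "x = y" by (intro ext) (metis abs_le_zero_iff eq_iff_diff_eq_0)
  next
    assume "x = y"
    then show "fill_dist \<alpha> \<tau> A x y = 0"
      using fill_dist_le[OF fill_chain_refl[OF x]] nonneg[of x y] by simp
  qed
  assume z: "z \<in> pts"
  show "fill_dist \<alpha> \<tau> A x z \<le> fill_dist \<alpha> \<tau> A x y + fill_dist \<alpha> \<tau> A y z"
  proof -
    have "fill_dist \<alpha> \<tau> A x z - l \<le> fill_dist \<alpha> \<tau> A y z" if "chain x y l" for l
    proof (rule fill_dist_greatest[OF y z])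
      fix l' assume "chain y z l'"
      from fill_dist_le[OF chain_trans[OF this that]] show "fill_dist \<alpha> \<tau> A x z - l \<le> l'" by simp
    qed
    then have "fill_dist \<alpha> \<tau> A x z - fill_dist \<alpha> \<tau> A y z \<le> fill_dist \<alpha> \<tau> A x y"
      by (intro fill_dist_greatest[OF x y]) (simp add: algebra_simps)
    then show ?thesis by simp
  qed
qed

lemma mspace_X [simp]: "mspace X = pts" and mdist_X [simp]: "mdist X = fill_dist \<alpha> \<tau> A"
  unfolding filling_def
  by (simp_all add: Metric_space.mspace_metric[OF Metric_space_filling]
      Metric_space.mdist_metric[OF Metric_space_filling])

lemma mdist_X_edge:
  "adj v w \<Longrightarrow> s \<in> {0..1} \<Longrightarrow> t \<in> {0..1} \<Longrightarrow> mdist X (edge_pt v w s) (edge_pt v w t) \<le> \<bar>s - t\<bar>"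
  using fill_dist_le[OF chain_edge] by simp

lemma height_le_mdist_root: "q \<in> pts \<Longrightarrow> height q \<le> mdist X q root"
  using chain_facts[of q root]
  by (simp, intro fill_dist_greatest) (auto simp: root_in_pts height_vertex_pt intro: order_trans[OF abs_ge_self])

lemma mdist_root_edge:
  assumes "adj (x, n) (y, k)" "t \<in> {0..1}"
  shows "real (min n k) \<le> mdist X (edge_pt (x, n) (y, k) t) root"
proof -
  have "real (min n k) = (1 - t) * real (min n k) + t * real (min n k)" by (simp add: algebra_simps)
  also have "\<dots> \<le> (1 - t) * real n + t * real k"
    using assms(2) by (intro add_mono mult_left_mono) auto
  also have "\<dots> \<le> mdist X (edge_pt (x, n) (y, k) t) root"
    using height_le_mdist_root[OF edge_in_pts[OF assms]] height_edge_pt[OF adj_neq[OF assms(1)], of t] by simp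
  finally show ?thesis .
qed


section \<open>The uniformized metric\<close>

definition conf_factor :: "('z \<times> nat \<Rightarrow> real) \<Rightarrow> ennreal" where
  "conf_factor q = ennreal (exp (- ln \<alpha> * mdist X q root))"

definition curves :: "('z \<times> nat \<Rightarrow> real) \<Rightarrow> ('z \<times> nat \<Rightarrow> real) \<Rightarrow> (real \<Rightarrow> 'z \<times> nat \<Rightarrow> real) set" where
  "curves x y = {\<gamma>. rectifiable_curve X \<gamma> \<and> \<gamma> 0 = x \<and> \<gamma> 1 = y}"

text \<open>The uniformized distance before \<open>enn2real\<close> is applied. Since
  \<open>enn2real\<close> sends infinity to 0, the triangle inequality is proved for the extended
  value first and finiteness is added afterwards.\<close>

definition ennreal_dist :: "('z \<times> nat \<Rightarrow> real) \<Rightarrow> ('z \<times> nat \<Rightarrow> real) \<Rightarrow> ennreal" where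
  "ennreal_dist x y = (INF \<gamma>\<in>curves x y. line_integral X \<gamma> conf_factor)"

text \<open>The reason for \<epsilon> = ln \<alpha>: the conformal weight at distance n from the
  root is the scale of the net of level n.\<close>

lemma exp_ln_alpha: "exp (- ln \<alpha> * real n) = rad n"
  using alpha by (simp add: exp_minus exp_of_nat2_mult[symmetric] mult.commute inverse_eq_divide powr_realpow[symmetric] powr_def)

lemma continuous_map_borel_measurable:
  fixes f :: "'a \<Rightarrow> 'b::topological_space"
  assumes "continuous_map (mtopology_of m) euclidean f"
  shows "f \<in> borel_measurable (metric_borel m)"
proof (rule borel_measurableI)
  fix S :: "'b set" assume "open S"
  then have "openin (mtopology_of m) {x \<in> mspace m. f x \<in> S}"
    using openin_continuous_map_preimage[OF assms, of S] by simp
  moreover have sp: "space (metric_borel m) = mspace m" 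
    by (simp add: metric_borel_def space_measure_of_conv)
  moreover have "f -` S \<inter> mspace m = {x \<in> mspace m. f x \<in> S}" by auto
  moreover have "{U. openin (mtopology_of m) U} \<subseteq> Pow (mspace m)"
    using openin_subset[of "mtopology_of m"] by auto
  ultimately show "f -` S \<inter> space (metric_borel m) \<in> sets (metric_borel m)"
    by (simp add: metric_borel_def sets_measure_of)
qed

lemma borel_measurable_conf_factor: "conf_factor \<in> borel_measurable (metric_borel X)"
proof -
  have "continuous_map (mtopology_of X) euclidean (\<lambda>q. mdist X q root)"
    by (rule continuous_map_mdist) (auto simp: root_in_pts)
  from continuous_map_borel_measurable[OF this] show ?thesis
    unfolding conf_factor_def by measurable
qed

lemma ennreal_dist_less:
  assumes "ennreal_dist x y < c"
  obtains \<gamma> where "rectifiable_curve X \<gamma>" "\<gamma> 0 = x" "\<gamma> 1 = y" "line_integral X \<gamma> conf_factor < c"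
  using assms unfolding ennreal_dist_def INF_less_iff curves_def by auto

lemma ennreal_dist_le:
  "rectifiable_curve X \<gamma> \<Longrightarrow> \<gamma> 0 = x \<Longrightarrow> \<gamma> 1 = y \<Longrightarrow> ennreal_dist x y \<le> line_integral X \<gamma> conf_factor"
  unfolding ennreal_dist_def curves_def by (rule INF_lower) auto

lemma ennreal_less_add: "c < top \<Longrightarrow> e > 0 \<Longrightarrow> c < c + ennreal e"
  by (cases c) (auto simp: ennreal_plus[symmetric] ennreal_less_iff simp del: ennreal_plus)

text \<open>Curves within e/2 of the two infima are joined.\<close>

lemma ennreal_dist_triangle: "ennreal_dist x z \<le> ennreal_dist x y + ennreal_dist y z"
proof (rule ennreal_le_epsilon)
  fix e :: real assume fin: "ennreal_dist x y + ennreal_dist y z < top" and e: "e > 0"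
  then have "ennreal_dist x y < ennreal_dist x y + ennreal (e/2)" "ennreal_dist y z < ennreal_dist y z + ennreal (e/2)"
    by (auto intro!: ennreal_less_add)
  then obtain \<gamma> \<gamma>' where \<gamma>: "rectifiable_curve X \<gamma>" "\<gamma> 0 = x" "\<gamma> 1 = y" "line_integral X \<gamma> conf_factor < ennreal_dist x y + ennreal (e/2)"
    and \<gamma>': "rectifiable_curve X \<gamma>'" "\<gamma>' 0 = y" "\<gamma>' 1 = z" "line_integral X \<gamma>' conf_factor < ennreal_dist y z + ennreal (e/2)"
    by (metis ennreal_dist_less)
  have "\<gamma> 1 = \<gamma>' 0" using \<gamma> \<gamma>' by simp
  note J = rectifiable_join_curves(1)[OF \<gamma>(1) \<gamma>'(1) this] line_integral_join_curves[OF \<gamma>(1) \<gamma>'(1) this borel_measurable_conf_factor]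
  have "ennreal_dist x z \<le> line_integral X (join_curves \<gamma> \<gamma>') conf_factor"
    by (rule ennreal_dist_le[OF J(1)]) (auto simp: join_curves_def \<gamma> \<gamma>')
  also have "\<dots> \<le> (ennreal_dist x y + ennreal (e/2)) + (ennreal_dist y z + ennreal (e/2))"
    using J(2) \<gamma>(4) \<gamma>'(4) by (meson add_mono less_imp_le order_trans)
  also have "\<dots> = ennreal_dist x y + ennreal_dist y z + ennreal e"
    using e by (simp add: ac_simps ennreal_plus[symmetric] del: ennreal_plus)
  finally show "ennreal_dist x z \<le> ennreal_dist x y + ennreal_dist y z + ennreal e" .
qed

lemma ennreal_dist_sym: "ennreal_dist x y = ennreal_dist y x"
proof (rule antisym)
  have "ennreal_dist x y \<le> ennreal_dist y x" for x y
    unfolding ennreal_dist_def[of y x]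
  proof (rule INF_greatest)
    fix \<gamma> assume "\<gamma> \<in> curves y x"
    then have \<gamma>: "rectifiable_curve X \<gamma>" "\<gamma> 0 = y" "\<gamma> 1 = x" by (auto simp: curves_def)
    have "ennreal_dist x y \<le> line_integral X (\<lambda>t. \<gamma> (1 - t)) conf_factor"
      by (rule ennreal_dist_le[OF line_integral_reverse(1)[OF \<gamma>(1) borel_measurable_conf_factor]]) (simp_all add: \<gamma>)
    also have "\<dots> \<le> line_integral X \<gamma> conf_factor"
      by (rule line_integral_reverse(2)[OF \<gamma>(1) borel_measurable_conf_factor])
    finally show "ennreal_dist x y \<le> line_integral X \<gamma> conf_factor" .
  qed
  then show "ennreal_dist x y \<le> ennreal_dist y x" "ennreal_dist y x \<le> ennreal_dist x y" by auto
qed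

lemma segment_Lipschitz:
  assumes "\<And>s t. s \<in> {0..1} \<Longrightarrow> t \<in> {0..1} \<Longrightarrow> mdist m (edge_pt v w s) (edge_pt v w t) \<le> K * \<bar>s - t\<bar>"
    and "K \<ge> 0" "a \<in> {0..1}" "b \<in> {0..1}" "s \<in> {0..1}" "t \<in> {0..1}"
  shows "mdist m (edge_pt v w (a + (b - a) * s)) (edge_pt v w (a + (b - a) * t)) \<le> (K * \<bar>b - a\<bar>) * \<bar>s - t\<bar>"
proof -
  have *: "a + (b - a) * s \<in> {0..1}" if "s \<in> {0..1}" for s
    using convexD[OF convex_real_interval(5)[of 0 1], of a b "1 - s" s] assms(3,4) that by (simp add: algebra_simps)
  have "mdist m (edge_pt v w (a + (b - a) * s)) (edge_pt v w (a + (b - a) * t)) \<le> K * \<bar>(a + (b - a) * s) - (a + (b - a) * t)\<bar>"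
    using assms(1) * assms(5,6) by blast
  also have "\<bar>(a + (b - a) * s) - (a + (b - a) * t)\<bar> = \<bar>b - a\<bar> * \<bar>s - t\<bar>"
    by (simp add: abs_mult[symmetric] algebra_simps)
  finally show ?thesis by (simp add: mult.assoc)
qed

text \<open>The segment run at constant speed is a competitor. Its length in X is at most the
  parameter difference, and on the edge the height is at least \<open>min n k\<close>, so the weight
  is at most \<open>rad (min n k)\<close>.\<close>

lemma ennreal_dist_edge:
  assumes vw: "adj (x, n) (y, k)" and a: "a \<in> {0..1}" and b: "b \<in> {0..1}"
  shows "ennreal_dist (edge_pt (x, n) (y, k) a) (edge_pt (x, n) (y, k) b) \<le> ennreal (rad (min n k) * \<bar>a - b\<bar>)"
proof -
  let ?e = "edge_pt (x, n) (y, k)"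
  let ?\<gamma> = "\<lambda>r. ?e (a + (b - a) * r)"
  have I: "a + (b - a) * s \<in> {0..1}" if "s \<in> {0..1}" for s
    using convexD[OF convex_real_interval(5)[of 0 1], of a b "1 - s" s] a b that by (simp add: algebra_simps)
  have in_pts: "?\<gamma> \<in> {0..1} \<rightarrow> mspace X" using edge_in_pts[OF vw I] by auto
  have lip: "mdist X (?\<gamma> s) (?\<gamma> t) \<le> \<bar>b - a\<bar> * \<bar>s - t\<bar>" if "s \<in> {0..1}" "t \<in> {0..1}" for s t
    using segment_Lipschitz[of X "(x,n)" "(y,k)" 1 a b s t] mdist_X_edge[OF vw] a b that by simp
  have rect: "rectifiable_curve X ?\<gamma>"
    by (rule arc_len_le_Lipschitz(1)[OF in_pts _ lip]) auto
  have len: "arc_len X ?\<gamma> 1 \<le> \<bar>b - a\<bar>"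
    using arc_len_le_Lipschitz(2)[OF in_pts _ lip, of 0 1] arc_len_0[OF rect] by simp
  have "ennreal_dist (?e a) (?e b) \<le> line_integral X ?\<gamma> conf_factor"
    by (rule ennreal_dist_le[OF rect]) auto
  also have "\<dots> \<le> (\<integral>\<^sup>+ s. ennreal (rad (min n k)) * indicator {0..arc_len X ?\<gamma> 1} s \<partial>lborel)"
    unfolding line_integral_eq
  proof (rule nn_integral_mono)
    fix s
    show "conf_factor (arclength_param X ?\<gamma> s) * indicator {0..arc_len X ?\<gamma> 1} s \<le> ennreal (rad (min n k)) * indicator {0..arc_len X ?\<gamma> 1} s"
    proof (cases "s \<in> {0..arc_len X ?\<gamma> 1}")
      case True
      then have "real (min n k) \<le> mdist X (arclength_param X ?\<gamma> s) root"
        unfolding arclength_param_eq using arc_time(1)[OF rect True] mdist_root_edge[OF vw I] by blast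
      then have "exp (- ln \<alpha> * mdist X (arclength_param X ?\<gamma> s) root) \<le> exp (- ln \<alpha> * real (min n k))"
        using alpha by simp
      then show ?thesis
        unfolding conf_factor_def exp_ln_alpha by (intro mult_right_mono ennreal_leI) auto
    qed simp
  qed
  also have "\<dots> = ennreal (rad (min n k)) * ennreal (arc_len X ?\<gamma> 1)"
    by (simp add: nn_integral_cmult arc_len_nonneg)
  also have "\<dots> \<le> ennreal (rad (min n k)) * ennreal \<bar>a - b\<bar>"
    using len by (intro mult_left_mono ennreal_leI) (auto simp: abs_minus_commute)
  finally show ?thesis using rad_pos[of "min n k"] by (subst ennreal_mult) auto
qed

lemma ennreal_dist_chain: "chain x y l \<Longrightarrow> ennreal_dist x y \<le> ennreal l"
proof (induction rule: fill_chain.induct)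
  \<comment> \<open>The competitor is the constant curve, whose line integral is over the single
    point 0.\<close>
  case (fill_chain_refl x)
  have rect: "rectifiable_curve X (\<lambda>_. x)"
    using fill_chain_refl by (intro arc_len_le_Lipschitz(1)[of _ _ 0]) (use mdist_props(3)[of x X] in auto)
  have "arc_len X (\<lambda>_. x) 1 = 0"
    using arc_len_le_Lipschitz(2)[of "\<lambda>_. x" X 0 0 1] fill_chain_refl arc_len_0[OF rect]
      arc_len_nonneg[of X "\<lambda>_. x" 1] mdist_props(3)[of x X] by auto
  note len0 = this
  have "line_integral X (\<lambda>_. x) conf_factor = (\<integral>\<^sup>+ s. conf_factor (arclength_param X (\<lambda>_. x) 0) * indicator {0::real} s \<partial>lborel)"
    unfolding line_integral_eq len0 by (intro nn_integral_cong) (auto simp: indicator_def)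
  also have "\<dots> = 0" by (subst nn_integral_cmult_indicator) auto
  finally show ?case using ennreal_dist_le[OF rect] by simp
next
  case (fill_chain_step x v w s l t)
  obtain a n b k where vw: "v = (a, n)" "w = (b, k)" by (cases v; cases w)
  have "ennreal_dist (edge_pt v w s) (edge_pt v w t) \<le> ennreal (rad (min n k) * \<bar>s - t\<bar>)"
    unfolding vw by (rule ennreal_dist_edge) (use fill_chain_step vw in auto)
  also have "\<dots> \<le> ennreal \<bar>s - t\<bar>"
    using rad_antimono[of 0 "min n k"] rad_pos[of "min n k"] by (intro ennreal_leI mult_left_le_one_le) auto
  finally have "ennreal_dist x (edge_pt v w t) \<le> ennreal l + ennreal \<bar>s - t\<bar>"
    using ennreal_dist_triangle[of x "edge_pt v w t" "edge_pt v w s"] fill_chain_step.IH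
    by (meson add_mono order_trans)
  then show ?case using chain_facts[OF fill_chain_step.hyps(1)] by (simp add: ennreal_plus)
qed

text \<open>Every curve from x to y has length at least d = d_X(x, y), and its initial piece of
  length d stays within distance d of x, where the weight has a positive lower bound.\<close>

lemma ennreal_dist_pos:
  assumes x: "x \<in> pts" and y: "y \<in> pts" and "x \<noteq> y"
  shows "ennreal_dist x y > 0"
proof -
  let ?d = "mdist X x y" and ?D = "mdist X x root"
  let ?c = "ennreal (exp (- ln \<alpha> * (?D + ?d)))"
  have d: "?d > 0"
    using assms mdist_props(5)[of x X y] mdist_props(1)[of X x y] by (force simp: less_le)
  have "?c * ennreal ?d \<le> ennreal_dist x y"
    unfolding ennreal_dist_def
  proof (rule INF_greatest)
    fix \<gamma> assume "\<gamma> \<in> curves x y"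
    then have \<gamma>: "rectifiable_curve X \<gamma>" "\<gamma> 0 = x" "\<gamma> 1 = y" by (auto simp: curves_def)
    let ?L = "arc_len X \<gamma> 1"
    have L: "?d \<le> ?L" using mdist_le_arc_len[OF \<gamma>(1), of 0 1] arc_len_0[OF \<gamma>(1)] arc_len_nonneg[of X \<gamma> 1] \<gamma> by simp
    have p0: "arclength_param X \<gamma> 0 = x"
      using arclength_param_arc_len[OF \<gamma>(1), of 0] arc_len_0[OF \<gamma>(1)] \<gamma> by simp
    have "?c * ennreal ?d = (\<integral>\<^sup>+ s. ?c * indicator {0..?d} s \<partial>lborel)"
      using d by (simp add: nn_integral_cmult)
    also have "\<dots> \<le> line_integral X \<gamma> conf_factor"
      unfolding line_integral_eq
    proof (rule nn_integral_mono)
      fix s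
      show "?c * indicator {0..?d} s \<le> conf_factor (arclength_param X \<gamma> s) * indicator {0..?L} s"
      proof (cases "s \<in> {0..?d}")
        case True
        then have s: "s \<in> {0..?L}" using L by auto
        have "mdist X (arclength_param X \<gamma> s) x \<le> s"
          using arclength_param_Lipschitz[OF \<gamma>(1) s, of 0] p0 arc_len_nonneg[of X \<gamma> 1] s by simp
        moreover have "mdist X (arclength_param X \<gamma> s) root \<le> mdist X (arclength_param X \<gamma> s) x + ?D"
          using arclength_param_in_mspace[OF \<gamma>(1) s] x root_in_pts by (intro mdist_props(4)) auto
        ultimately have "mdist X (arclength_param X \<gamma> s) root \<le> ?D + ?d" using True by simp
        then show ?thesis using s True alpha by (simp add: conf_factor_def ennreal_leI)
      qed simp
    qed
    finally show "?c * ennreal ?d \<le> line_integral X \<gamma> conf_factor" .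
  qed
  moreover have "?c * ennreal ?d > 0" using d by (simp add: ennreal_zero_less_mult_iff)
  ultimately show ?thesis by (rule less_le_trans[rotated])
qed

abbreviation "Xe \<equiv> uniformized X root (ln \<alpha>)"

lemma uniformized_dist_eq: "uniformized_dist X root (ln \<alpha>) x y = enn2real (ennreal_dist x y)"
  unfolding uniformized_dist_def ennreal_dist_def conf_factor_def curves_def ..

lemma ennreal_dist_finite: "x \<in> pts \<Longrightarrow> y \<in> pts \<Longrightarrow> ennreal_dist x y < top"
  using chain_exists[of x y] ennreal_dist_chain[of x y] by (metis ennreal_less_top le_less_trans)

lemma Metric_space_uniformized: "Metric_space pts (uniformized_dist X root (ln \<alpha>))"
  unfolding uniformized_dist_eq
proof
  fix x y z assume x: "x \<in> pts" and y: "y \<in> pts"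
  show "enn2real (ennreal_dist x y) = 0 \<longleftrightarrow> x = y"
  proof
    show "enn2real (ennreal_dist x y) = 0 \<Longrightarrow> x = y"
      using ennreal_dist_pos[OF x y] ennreal_dist_finite[OF x y] by (cases "x = y") (auto simp: enn2real_eq_0_iff)
    show "x = y \<Longrightarrow> enn2real (ennreal_dist x y) = 0"
      using ennreal_dist_chain[OF fill_chain_refl[OF x]] by simp
  qed
  assume z: "z \<in> pts"
  show "enn2real (ennreal_dist x z) \<le> enn2real (ennreal_dist x y) + enn2real (ennreal_dist y z)"
    using ennreal_dist_triangle[of x z y] ennreal_dist_finite[OF x y] ennreal_dist_finite[OF y z]
    by (subst enn2real_plus[symmetric]) (auto intro!: enn2real_mono)
qed (auto simp: ennreal_dist_sym)

lemma mspace_Xe [simp]: "mspace Xe = pts"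
  and mdist_Xe: "mdist Xe x y = enn2real (ennreal_dist x y)"
  unfolding uniformized_def
  using Metric_space.mspace_metric[OF Metric_space_uniformized]
    Metric_space.mdist_metric[OF Metric_space_uniformized]
  by (simp_all add: uniformized_dist_eq)

lemma mdist_Xe_edge:
  assumes "adj (x, n) (y, k)" "s \<in> {0..1}" "t \<in> {0..1}"
  shows "mdist Xe (edge_pt (x, n) (y, k) s) (edge_pt (x, n) (y, k) t) \<le> rad (min n k) * \<bar>s - t\<bar>"
  unfolding mdist_Xe using ennreal_dist_edge[OF assms] rad_pos[of "min n k"]
  by (intro enn2real_leI) auto

lemma mdist_Xe_le: 
  assumes "x \<in> pts" "y \<in> pts" shows "mdist Xe x y \<le> mdist X x y"
proof -
  have "mdist Xe x y \<le> l" if "chain x y l" for l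
    unfolding mdist_Xe using ennreal_dist_chain[OF that] chain_facts[OF that] by (intro enn2real_leI) auto
  then show ?thesis using assms by (simp, intro fill_dist_greatest) auto
qed

text \<open>Upper gradients are Borel for the uniformized metric, while \<open>mu_beta\<close> lives
  on the Borel sets of X. The identity from X to \<open>Xe\<close> is 1-Lipschitz, so open sets of
  \<open>Xe\<close> are open in X.\<close>

lemma borel_measurable_Xe_X:
  assumes "g \<in> borel_measurable (metric_borel Xe)"
  shows "g \<in> borel_measurable (metric_borel X)"
proof -
  have "Lipschitz_continuous_map X Xe id"
    unfolding Lipschitz_continuous_map_def using mdist_Xe_le by (auto intro!: exI[of _ 1])
  then have "continuous_map (mtopology_of X) (mtopology_of Xe) id"
    by (rule Lipschitz_continuous_imp_continuous_map)
  have "id \<in> measurable (metric_borel X) (metric_borel Xe)"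
    unfolding metric_borel_def[of Xe]
  proof (rule measurable_measure_of)
    show "{U. openin (mtopology_of Xe) U} \<subseteq> Pow (mspace Xe)"
      using openin_subset[of "mtopology_of Xe"] by auto
    have sp: "space (metric_borel X) = pts" by (simp add: metric_borel_def space_measure_of_conv)
    then show "id \<in> space (metric_borel X) \<rightarrow> mspace Xe" by simp
    fix U assume "U \<in> {U. openin (mtopology_of Xe) U}"
    then have U: "openin (mtopology_of X) U"
      using openin_continuous_map_preimage[OF \<open>continuous_map _ _ id\<close>, of U] openin_subset[of "mtopology_of Xe" U]
      by (auto simp: Int_def[symmetric] Collect_conj_eq inf.absorb2)
    have "{U. openin (mtopology_of X) U} \<subseteq> Pow (mspace X)"
      using openin_subset[of "mtopology_of X"] by auto
    then show "id -` U \<inter> space (metric_borel X) \<in> sets (metric_borel X)"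
      using U openin_subset[OF U] unfolding sp by (auto simp: metric_borel_def sets_measure_of inf.absorb1)
  qed
  from measurable_compose[OF this assms] show ?thesis by simp
qed

end

section \<open>Powers\<close>

lemma ennreal_powr_ennreal: "x \<ge> 0 \<Longrightarrow> ennreal_powr (ennreal x) p = ennreal (x powr p)"
  by (simp add: ennreal_powr_def)

lemma ennreal_powr_top: "ennreal_powr top p = top"
  by (simp add: ennreal_powr_def)

lemma borel_measurable_ennreal_powr [measurable]:
  assumes [measurable]: "f \<in> borel_measurable M"
  shows "(\<lambda>x. ennreal_powr (f x) p) \<in> borel_measurable M"
  unfolding ennreal_powr_def by measurable

lemma ennreal_powr_mono:
  assumes "x \<le> y" "p > 0" shows "ennreal_powr x p \<le> ennreal_powr y p"
proof (cases y)
  case (real b)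
  then obtain a where "x = ennreal a" "a \<ge> 0" "a \<le> b" using assms by (cases x) (auto simp: top_unique)
  then show ?thesis using real assms by (simp add: ennreal_powr_ennreal powr_mono2 ennreal_leI)
qed (simp add: ennreal_powr_top)

lemma ennreal_powr_cmult:
  assumes "c > 0" shows "ennreal_powr (ennreal c * x) p = ennreal (c powr p) * ennreal_powr x p"
proof (cases x)
  case (real a)
  then show ?thesis using assms
    by (simp add: ennreal_powr_ennreal ennreal_mult[symmetric] powr_mult)
next
  case top
  then show ?thesis using assms by (simp add: ennreal_powr_top ennreal_mult_top)
qed

lemma ennreal_powr_add_le:
  assumes "p > 0"
  shows "ennreal_powr (x + y) p \<le> ennreal (2 powr p) * (ennreal_powr x p + ennreal_powr y p)"
proof -
  have "x + y \<le> ennreal 2 * max x y"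
  proof -
    have "x + y \<le> max x y + max x y" by (intro add_mono) auto
    then show ?thesis by (simp add: mult_2)
  qed
  then have "ennreal_powr (x + y) p \<le> ennreal (2 powr p) * ennreal_powr (max x y) p"
    using ennreal_powr_mono[OF _ assms] by (metis ennreal_powr_cmult zero_less_numeral)
  also have "ennreal_powr (max x y) p \<le> ennreal_powr x p + ennreal_powr y p"
    by (auto simp: max_def add_increasing add_increasing2)
  finally show ?thesis by (simp add: mult_left_mono)
qed

text \<open>Values up to c are covered by the first term. Above c write a = a^(1-p) a^p and use
  a^(1-p) \<le> c^(1-p), as 1 - p \<le> 0.\<close>

lemma le_add_ennreal_powr:
  assumes "c > 0" "p \<ge> 1"
  shows "x \<le> ennreal c + ennreal (c powr (1 - p)) * ennreal_powr x p"
proof (cases x)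
  case (real a)
  have "a \<le> c + c powr (1 - p) * a powr p"
  proof (cases "a \<le> c")
    case False
    then have "a = a powr (1 - p) * a powr p" using assms by (simp add: powr_add[symmetric])
    also have "\<dots> \<le> c powr (1 - p) * a powr p"
      using False assms by (intro mult_right_mono powr_mono2') auto
    finally show ?thesis using assms by simp
  qed (use assms in \<open>simp add: add_increasing2\<close>)
  then show ?thesis
    using real assms by (simp add: ennreal_powr_ennreal ennreal_mult[symmetric] ennreal_plus[symmetric] ennreal_leI del: ennreal_plus)
next
  case top
  then show ?thesis using assms by (simp add: ennreal_powr_top ennreal_mult_top)
qed

text \<open>A form of Jensen's inequality with a nonoptimal constant, from the pointwise bound
  \<open>f \<le> c + c\<^bsup>1-p\<^esup> f\<^bsup>p\<^esup>\<close> with \<open>c = x / (2 k)\<close>.\<close>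

lemma powr_le_nn_integral_powr:
  assumes f: "f \<in> borel_measurable M" and M: "emeasure M (space M) \<le> 1" and p: "p \<ge> 1" and k: "k > 0"
    and x: "x \<ge> 0" "ennreal x \<le> ennreal k * (\<integral>\<^sup>+ t. f t \<partial>M)"
  shows "ennreal (x powr p) \<le> ennreal ((2 * k) powr p) * (\<integral>\<^sup>+ t. ennreal_powr (f t) p \<partial>M)"
proof (cases "x = 0 \<or> (\<integral>\<^sup>+ t. ennreal_powr (f t) p \<partial>M) = top")
  case True
  then show ?thesis using k p by (auto simp: ennreal_mult_top)
next
  case False
  then obtain G where G: "(\<integral>\<^sup>+ t. ennreal_powr (f t) p \<partial>M) = ennreal G" "G \<ge> 0"
    by (cases "(\<integral>\<^sup>+ t. ennreal_powr (f t) p \<partial>M)") auto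
  define c where "c = x / (2 * k)"
  have c: "c > 0" "x = 2 * k * c" using False x k by (auto simp: c_def)
  have "(\<integral>\<^sup>+ t. f t \<partial>M) \<le> (\<integral>\<^sup>+ t. ennreal c + ennreal (c powr (1 - p)) * ennreal_powr (f t) p \<partial>M)"
    by (intro nn_integral_mono le_add_ennreal_powr c p)
  also have "\<dots> = ennreal c * emeasure M (space M) + ennreal (c powr (1 - p)) * ennreal G"
    using f by (simp add: nn_integral_add nn_integral_cmult G)
  also have "\<dots> \<le> ennreal c * 1 + ennreal (c powr (1 - p)) * ennreal G"
    using M by (intro add_right_mono mult_left_mono) auto
  also have "\<dots> = ennreal (c + c powr (1 - p) * G)"
    using c G by (simp add: ennreal_mult)
  finally have "ennreal x \<le> ennreal k * ennreal (c + c powr (1 - p) * G)"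
    using x(2) by (meson mult_left_mono order_trans zero_le)
  \<comment> \<open>As \<open>k * c\<close> is half of x, it is absorbed on the left. What remains
    is c \<le> c^(1-p) G, that is c^p \<le> G.\<close>
  then have "2 * k * c \<le> k * (c + c powr (1 - p) * G)"
    using k c G by (simp add: ennreal_mult[symmetric] del: ennreal_plus)
  then have "c \<le> c powr (1 - p) * G" using k by (simp add: algebra_simps)
  then have "c powr (p - 1) * c \<le> c powr (p - 1) * (c powr (1 - p) * G)" by (intro mult_left_mono) auto
  moreover have "c powr (p - 1) * c = c powr p" using powr_add[of c "p - 1" 1] c by simp
  moreover have "c powr (p - 1) * c powr (1 - p) = 1" using powr_add[of c "p - 1" "1 - p"] c by simp
  ultimately have "c powr p \<le> G" by (simp only: mult.assoc[symmetric] mult_1_left)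
  then have "x powr p \<le> (2 * k) powr p * G"
    using c k by (simp add: powr_mult)
  then show ?thesis using G k by (simp add: ennreal_mult[symmetric] ennreal_leI)
qed

section \<open>The measure on the filling\<close>

abbreviation unit_interval :: "real measure" where
  "unit_interval \<equiv> restrict_space lborel {0..1}"

context hyperbolic_filling
begin

lemma space_metric_borel: "space (metric_borel m) = mspace m"
  by (simp add: metric_borel_def space_measure_of_conv)

lemma measurable_edge:
  assumes "adj v w"
  shows "edge_pt v w \<in> measurable unit_interval (metric_borel X)"
proof -
  have "edge_pt v w \<in> measurable (restrict_space borel {0..1}) (metric_borel X)"
    using edge_in_pts[OF assms] mdist_X_edge[OF assms]
    by (intro measurable_metric_borel_Lipschitz[where K=1] funcsetI) (simp_all add: dist_real_def)
  then show ?thesis unfolding measurable_cong_sets[OF sets_restrict_space_cong[OF sets_lborel] refl] .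
qed

definition edge_int :: "'z \<times> nat \<Rightarrow> 'z \<times> nat \<Rightarrow> (('z \<times> nat \<Rightarrow> real) \<Rightarrow> ennreal) \<Rightarrow> ennreal" where
  "edge_int v w f = (\<integral>\<^sup>+ t. f (edge_pt v w t) \<partial>unit_interval)"

lemma borel_measurable_edge [measurable (raw)]:
  "adj v w \<Longrightarrow> f \<in> borel_measurable (metric_borel X) \<Longrightarrow> (\<lambda>t. f (edge_pt v w t)) \<in> borel_measurable unit_interval"
  by (rule measurable_compose[OF measurable_edge])

lemma emeasure_unit_interval: "emeasure unit_interval {0..1} = 1"
  by (simp add: emeasure_restrict_space)

lemma edge_int_indicator:
  assumes "adj v w" "S \<in> sets (metric_borel X)"
  shows "edge_int v w (indicator S) = emeasure lborel {t \<in> {0..1}. edge_pt v w t \<in> S}"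
proof -
  have "edge_pt v w -` S \<inter> space unit_interval \<in> sets unit_interval"
    using measurable_sets[OF measurable_edge[OF assms(1)] assms(2)] .
  then have *: "{t \<in> {0..1}. edge_pt v w t \<in> S} \<in> sets unit_interval"
    by (simp add: space_restrict_space vimage_def Int_def conj_commute)
  have "edge_int v w (indicator S) = (\<integral>\<^sup>+ t. indicator {t \<in> {0..1}. edge_pt v w t \<in> S} t \<partial>unit_interval)"
    unfolding edge_int_def by (intro nn_integral_cong) (auto simp: indicator_def space_restrict_space)
  also have "\<dots> = emeasure lborel {t \<in> {0..1}. edge_pt v w t \<in> S}"
    using * by (subst nn_integral_indicator, simp, subst emeasure_restrict_space) auto
  finally show ?thesis .
qed

end

context doubling_filling
begin

abbreviation wt where "wt \<equiv> vertex_weight \<nu> \<alpha>"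
abbreviation mu where "mu \<equiv> mu_beta \<nu> \<alpha> \<tau> A"

lemma wt_pos: "0 < wt \<beta> v" and wt_finite: "wt \<beta> v < top"
  using emeasure_ball[of "rad (snd v)" "fst v"] rad_pos
  by (auto simp: vertex_weight_def split_beta ennreal_zero_less_mult_iff ennreal_mult_less_top)

definition edge_sum :: "real \<Rightarrow> (('z \<times> nat \<Rightarrow> real) \<Rightarrow> ennreal) \<Rightarrow> ennreal" where
  "edge_sum \<beta> f = (\<integral>\<^sup>+ v. (\<integral>\<^sup>+ w. (wt \<beta> v + wt \<beta> w) * edge_int v w f
     \<partial>count_space {w. adj v w}) \<partial>count_space (fill_vertices A))"

lemma mu_eq:
  "mu \<beta> = measure_of (space (metric_borel X)) (sets (metric_borel X))
     (\<lambda>S. \<integral>\<^sup>+ v. (\<integral>\<^sup>+ w. (wt \<beta> v + wt \<beta> w) * emeasure lborel {t \<in> {0..1}. edge_pt v w t \<in> S}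
        \<partial>count_space {w. adj v w}) \<partial>count_space (fill_vertices A))"
  unfolding mu_beta_def space_metric_borel mspace_X ..

lemma sets_mu [measurable_cong]: "sets (mu \<beta>) = sets (metric_borel X)"
  unfolding mu_eq by simp

lemma space_mu: "space (mu \<beta>) = pts"
  using sets_eq_imp_space_eq[OF sets_mu] by (simp add: space_metric_borel)

lemma edge_sum_suminf:
  assumes "\<And>i. f i \<in> borel_measurable (metric_borel X)"
  shows "edge_sum \<beta> (\<lambda>x. \<Sum>i. f i x) = (\<Sum>i. edge_sum \<beta> (f i))"
proof -
  have "edge_sum \<beta> (\<lambda>x. \<Sum>i. f i x) = (\<integral>\<^sup>+ v. (\<integral>\<^sup>+ w. (\<Sum>i. (wt \<beta> v + wt \<beta> w) * edge_int v w (f i))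
     \<partial>count_space {w. adj v w}) \<partial>count_space (fill_vertices A))"
    unfolding edge_sum_def edge_int_def
    by (intro nn_integral_cong) (simp add: nn_integral_suminf borel_measurable_edge assms ennreal_suminf_cmult)
  then show ?thesis by (simp add: nn_integral_suminf edge_sum_def del: ennreal_suminf_cmult)
qed

text \<open>\<open>measure_of\<close> returns the given set function only if it is countably
  additive. Here this is the additivity of \<open>edge_sum\<close> over series, applied to
  indicators.\<close>

lemma emeasure_mu:
  assumes "S \<in> sets (metric_borel X)"
  shows "emeasure (mu \<beta>) S = edge_sum \<beta> (indicator S)"
proof -
  let ?f = "\<lambda>S. \<integral>\<^sup>+ v. (\<integral>\<^sup>+ w. (wt \<beta> v + wt \<beta> w) * emeasure lborel {t \<in> {0..1}. edge_pt v w t \<in> S}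
        \<partial>count_space {w. adj v w}) \<partial>count_space (fill_vertices A)"
  have eq: "?f S = edge_sum \<beta> (indicator S)" if "S \<in> sets (metric_borel X)" for S
    unfolding edge_sum_def by (intro nn_integral_cong) (simp add: edge_int_indicator that)
  have "emeasure (mu \<beta>) S = ?f S"
    unfolding mu_eq
  proof (rule emeasure_measure_of_sigma)
    show "sigma_algebra (space (metric_borel X)) (sets (metric_borel X))" by (rule sets.sigma_algebra_axioms)
    show "positive (sets (metric_borel X)) ?f" by (simp add: positive_def)
    show "countably_additive (sets (metric_borel X)) ?f"
    proof (rule countably_additiveI)
      fix S :: "nat \<Rightarrow> _" assume S: "range S \<subseteq> sets (metric_borel X)" "disjoint_family S" "\<Union>(range S) \<in> sets (metric_borel X)"
      have "(\<lambda>x. \<Sum>i. indicator (S i) x) = (indicator (\<Union>(range S)) :: _ \<Rightarrow> ennreal)"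
        using suminf_indicator[OF S(2)] by auto
      moreover have "?f (S i) = edge_sum \<beta> (indicator (S i))" for i by (rule eq) (use S in auto)
      ultimately show "(\<Sum>i. ?f (S i)) = ?f (\<Union>(range S))"
        using edge_sum_suminf[of "\<lambda>i. indicator (S i)" \<beta>] S by (simp only: eq) (simp add: range_subsetD)
    qed
  qed fact
  then show ?thesis using eq[OF assms] by simp
qed

text \<open>Induction over nonnegative measurable functions. In the monotone limit the supremum
  passes through three layers: the edge, the neighbours and the vertices.\<close>

lemma nn_integral_mu:
  assumes "f \<in> borel_measurable (metric_borel X)"
  shows "(\<integral>\<^sup>+ x. f x \<partial>mu \<beta>) = edge_sum \<beta> f"
proof -
  have "f \<in> borel_measurable (mu \<beta>)" using assms by (simp cong: measurable_cong_sets)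
  then show ?thesis
  proof (induction rule: borel_measurable_induct)
    case (cong f g)
    have "edge_int v w f = edge_int v w g" if "adj v w" for v w
      unfolding edge_int_def using cong(3) edge_in_pts[OF that]
      by (intro nn_integral_cong) (simp add: space_mu space_restrict_space)
    then have "edge_sum \<beta> f = edge_sum \<beta> g" unfolding edge_sum_def by (intro nn_integral_cong) simp
    moreover have "(\<integral>\<^sup>+ x. f x \<partial>mu \<beta>) = (\<integral>\<^sup>+ x. g x \<partial>mu \<beta>)"
      using cong(3) by (intro nn_integral_cong) simp
    ultimately show ?case using cong(4) by simp
  next
    case (set S)
    then show ?case by (simp add: sets_mu emeasure_mu)
  next
    case (mult f c)
    then have "f \<in> borel_measurable (metric_borel X)" by (simp cong: measurable_cong_sets add: sets_mu)
    then have "edge_sum \<beta> (\<lambda>x. c * f x) = c * edge_sum \<beta> f"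
      unfolding edge_sum_def edge_int_def
      by (simp add: nn_integral_cmult[symmetric])
         (intro nn_integral_cong, simp add: nn_integral_cmult borel_measurable_edge mult.left_commute)
    then show ?case using mult by (simp add: nn_integral_cmult)
  next
    case (add f g)
    then have "f \<in> borel_measurable (metric_borel X)" "g \<in> borel_measurable (metric_borel X)"
      by (simp_all cong: measurable_cong_sets add: sets_mu)
    then have "edge_sum \<beta> (\<lambda>x. g x + f x) = edge_sum \<beta> g + edge_sum \<beta> f"
      unfolding edge_sum_def edge_int_def
      by (simp add: nn_integral_add[symmetric])
         (intro nn_integral_cong, simp add: nn_integral_add borel_measurable_edge distrib_left)
    then show ?case using add by (simp add: nn_integral_add)
  next
    case (seq F)
    then have F: "F i \<in> borel_measurable (metric_borel X)" for i
      by (simp cong: measurable_cong_sets add: sets_mu)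
    have inc: "F i x \<le> F j x" if "i \<le> j" for i j x
      using seq.hyps that by (auto simp: incseq_def le_fun_def)
    have int: "edge_int v w (SUP i. F i) = (SUP i. edge_int v w (F i))" if "adj v w" for v w
    proof -
      have "edge_int v w (SUP i. F i) = (\<integral>\<^sup>+ t. (SUP i. F i (edge_pt v w t)) \<partial>unit_interval)"
        by (simp add: edge_int_def image_comp)
      also have "\<dots> = (SUP i. edge_int v w (F i))"
        unfolding edge_int_def using F that inc
        by (intro nn_integral_monotone_convergence_SUP) (auto simp: incseq_def le_fun_def borel_measurable_edge)
      finally show ?thesis .
    qed
    have int_mono: "edge_int v w (F i) \<le> edge_int v w (F j)" if "i \<le> j" for v w i j
      unfolding edge_int_def by (intro nn_integral_mono inc that)
    have inner: "(\<integral>\<^sup>+ w. (wt \<beta> v + wt \<beta> w) * edge_int v w (SUP i. F i) \<partial>count_space {w. adj v w}) =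
        (SUP i. \<integral>\<^sup>+ w. (wt \<beta> v + wt \<beta> w) * edge_int v w (F i) \<partial>count_space {w. adj v w})" for v
    proof -
      have "(\<integral>\<^sup>+ w. (wt \<beta> v + wt \<beta> w) * edge_int v w (SUP i. F i) \<partial>count_space {w. adj v w}) =
          (\<integral>\<^sup>+ w. (SUP i. (wt \<beta> v + wt \<beta> w) * edge_int v w (F i)) \<partial>count_space {w. adj v w})"
        by (intro nn_integral_cong) (simp add: int SUP_mult_left_ennreal)
      also have "\<dots> = (SUP i. \<integral>\<^sup>+ w. (wt \<beta> v + wt \<beta> w) * edge_int v w (F i) \<partial>count_space {w. adj v w})"
        by (rule nn_integral_monotone_convergence_SUP)
           (auto simp: incseq_def le_fun_def intro!: mult_left_mono int_mono)
      finally show ?thesis .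
    qed
    have "edge_sum \<beta> (SUP i. F i) = (SUP i. edge_sum \<beta> (F i))"
      unfolding edge_sum_def inner
      by (rule nn_integral_monotone_convergence_SUP)
         (auto simp: incseq_def le_fun_def intro!: nn_integral_mono mult_left_mono int_mono)
    moreover have "(\<integral>\<^sup>+ x. (SUP i. F i) x \<partial>mu \<beta>) = (SUP i. \<integral>\<^sup>+ x. F i x \<partial>mu \<beta>)"
      using seq.hyps by (simp add: image_comp nn_integral_monotone_convergence_SUP)
    ultimately have "(\<integral>\<^sup>+ x. (SUP i. F i) x \<partial>mu \<beta>) = edge_sum \<beta> (SUP i. F i)"
      by (simp only: seq.IH)
    then show ?case .
  qed
qed

text \<open>Regrouping by level, to match the levelwise energies with integrals against
  \<open>mu_beta\<close>.\<close>

lemma nn_integral_count_space_vertices: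
  "(\<integral>\<^sup>+ v. f v \<partial>count_space (fill_vertices A)) = (\<Sum>n. \<Sum>z\<in>A n. f (z, n) :: ennreal)"
proof -
  have V: "fill_vertices A \<inter> A n \<times> {n} = A n \<times> {n}" for n by (auto simp: fill_vertices_def)
  have "f v = (\<Sum>n. f v * indicator (A n \<times> {n}) v)" if "v \<in> fill_vertices A" for v
  proof -
    define g where "g n = f v * indicator (A n \<times> {n}) v" for n
    have "(\<Sum>n. g n) = (\<Sum>n\<in>{snd v}. g n)"
      by (rule suminf_finite) (auto simp: g_def indicator_def)
    also have "\<dots> = f v" using that by (cases v) (simp, simp add: g_def fill_vertices_def)
    finally show ?thesis unfolding g_def ..
  qed
  then have "(\<integral>\<^sup>+ v. f v \<partial>count_space (fill_vertices A)) =
      (\<integral>\<^sup>+ v. (\<Sum>n. f v * indicator (A n \<times> {n}) v) \<partial>count_space (fill_vertices A))"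
    by (intro nn_integral_cong) auto
  also have "\<dots> = (\<Sum>n. \<integral>\<^sup>+ v. f v * indicator (A n \<times> {n}) v \<partial>count_space (fill_vertices A))"
    by (rule nn_integral_suminf) simp
  also have "\<dots> = (\<Sum>n. \<Sum>z\<in>A n. f (z, n))"
  proof (rule suminf_cong)
    fix n
    have "(\<integral>\<^sup>+ v. f v * indicator (A n \<times> {n}) v \<partial>count_space (fill_vertices A)) =
        (\<integral>\<^sup>+ v. f v \<partial>count_space (A n \<times> {n}))"
      using V[of n] by (subst (1 2) nn_integral_count_space_indicator)
         (auto intro!: nn_integral_cong simp: indicator_def fill_vertices_def)
    also have "\<dots> = (\<Sum>v\<in>A n \<times> {n}. f v)"
      using finite_net by (intro nn_integral_count_space_finite) auto
    also have "\<dots> = (\<Sum>z\<in>A n. f (z, n))"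
      by (rule sum.reindex_cong[of "\<lambda>z. (z, n)"]) (auto simp: inj_on_def)
    finally show "(\<integral>\<^sup>+ v. f v * indicator (A n \<times> {n}) v \<partial>count_space (fill_vertices A)) = (\<Sum>z\<in>A n. f (z, n))" .
  qed
  finally show ?thesis .
qed

section \<open>Estimates along single edges\<close>

lemma edge_sum_ge_edge:
  assumes "adj v w" shows "wt \<beta> v * edge_int v w f \<le> edge_sum \<beta> f"
proof -
  have "wt \<beta> v * edge_int v w f \<le> (wt \<beta> v + wt \<beta> w) * edge_int v w f"
    by (intro mult_right_mono) auto
  also have "\<dots> \<le> (\<integral>\<^sup>+ w. (wt \<beta> v + wt \<beta> w) * edge_int v w f \<partial>count_space {w. adj v w})"
    using assms by (intro nn_integral_ge_point) auto
  also have "\<dots> \<le> edge_sum \<beta> f"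
    unfolding edge_sum_def using adj_vertices[OF assms] by (intro nn_integral_ge_point) auto
  finally show ?thesis .
qed

text \<open>A function measurable only for the completion may fail to be Borel on an edge. Its Borel
  version, set to infinity on a Borel null set containing all disagreements, lies above g everywhere
  and has the same energy.\<close>

lemma borel_majorant:
  assumes "g \<in> borel_measurable (completion (mu \<beta>))"
  obtains h where "h \<in> borel_measurable (metric_borel X)" "\<And>x. x \<in> pts \<Longrightarrow> g x \<le> h x"
    "\<And>p. Lp_energy (mu \<beta>) p g = edge_sum \<beta> (\<lambda>x. ennreal_powr (h x) p)"
proof -
  obtain g' where g': "g' \<in> borel_measurable (mu \<beta>)" "AE x in mu \<beta>. g x = g' x"
    using completion_ex_borel_measurable[OF assms] by blast
  then obtain N where N: "{x \<in> space (mu \<beta>). g x \<noteq> g' x} \<subseteq> N" "N \<in> sets (mu \<beta>)" "emeasure (mu \<beta>) N = 0"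
    by (auto elim: AE_E)
  define h where "h x = (if x \<in> N then \<infinity> else g' x)" for x
  have h: "h \<in> borel_measurable (mu \<beta>)"
    unfolding h_def using g'(1) N(2) by measurable
  have "N \<in> null_sets (mu \<beta>)" using N by auto
  then have "AE x in mu \<beta>. h x = g x"
    using g'(2) AE_not_in[of N "mu \<beta>"] by (auto simp: h_def)
  then have "Lp_energy (mu \<beta>) p g = (\<integral>\<^sup>+ x. ennreal_powr (h x) p \<partial>mu \<beta>)" for p
    unfolding Lp_energy_def nn_integral_completion by (intro nn_integral_cong_AE) auto
  moreover have h': "h \<in> borel_measurable (metric_borel X)"
    using h by (simp cong: measurable_cong_sets add: sets_mu)
  moreover have "g x \<le> h x" if "x \<in> pts" for x
    using that N(1) by (auto simp: h_def space_mu)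
  ultimately show thesis using that[of h] by (simp add: nn_integral_mu)
qed

text \<open>Initial pieces are treated along with whole edges because the value at the root will be
  compared with the values at all points of an edge. The piece is Lipschitz with constant
  \<open>rad (min n k) * b\<close>, and the substitution t = b r turns its integral into one over
  [0, b].\<close>

lemma edge_curve:
  assumes vw: "adj (x, n) (y, k)" and b: "b \<in> {0<..1}" and h: "h \<in> borel_measurable (metric_borel X)"
  defines "\<gamma> \<equiv> \<lambda>r. edge_pt (x, n) (y, k) (b * r)"
  shows "rectifiable_curve Xe \<gamma>" "nonconstant_curve \<gamma>"
    "line_integral Xe \<gamma> h \<le> ennreal (rad (min n k)) * edge_int (x, n) (y, k) h"
proof -
  let ?e = "edge_pt (x, n) (y, k)" and ?K = "rad (min n k) * b"
  have I: "b * r \<in> {0..1}" if "r \<in> {0..1}" for r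
    using b that by (auto intro: mult_le_one)
  have in_pts: "\<gamma> \<in> {0..1} \<rightarrow> mspace Xe" using edge_in_pts[OF vw I] by (auto simp: \<gamma>_def)
  have K: "?K \<ge> 0" using b rad_pos[of "min n k"] by auto
  have lip: "mdist Xe (\<gamma> s) (\<gamma> t) \<le> ?K * \<bar>s - t\<bar>" if "s \<in> {0..1}" "t \<in> {0..1}" for s t
  proof -
    have "mdist Xe (\<gamma> s) (\<gamma> t) \<le> rad (min n k) * \<bar>b * s - b * t\<bar>"
      unfolding \<gamma>_def by (rule mdist_Xe_edge[OF vw I I]) (use that in auto)
    also have "\<bar>b * s - b * t\<bar> = b * \<bar>s - t\<bar>" using b by (simp add: abs_mult right_diff_distrib[symmetric])
    finally show ?thesis by (simp add: mult.assoc)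
  qed
  show "rectifiable_curve Xe \<gamma>" by (rule arc_len_le_Lipschitz(1)[OF in_pts K]) (rule lip)
  have "\<gamma> 1 (x, n) \<noteq> \<gamma> 0 (x, n)"
    using b adj_neq[OF vw] by (auto simp: \<gamma>_def edge_pt_def vertex_pt_def)
  then show "nonconstant_curve \<gamma>" unfolding nonconstant_curve_def by (metis atLeastAtMost_iff order_refl zero_le_one)
  \<comment> \<open>The function h is Borel for the graph metric, so \<gamma> is regarded here as a
    curve in X, although its length is measured in \<open>Xe\<close>.\<close>
  have meas: "(\<lambda>t. h (\<gamma> t)) \<in> borel_measurable (restrict_space borel {0..1})"
  proof (rule measurable_compose[OF _ h], rule measurable_metric_borel_Lipschitz[where K=1])
    show "\<gamma> \<in> {0..1} \<rightarrow> mspace X" using in_pts by simp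
    fix s t :: real assume "s \<in> {0..1}" "t \<in> {0..1}"
    then have "mdist X (\<gamma> s) (\<gamma> t) \<le> \<bar>b * s - b * t\<bar>"
      unfolding \<gamma>_def by (intro mdist_X_edge[OF vw] I)
    also have "\<dots> = b * \<bar>s - t\<bar>" using b by (simp add: abs_mult right_diff_distrib[symmetric])
    also have "\<dots> \<le> 1 * \<bar>s - t\<bar>" using b by (intro mult_right_mono) auto
    finally show "mdist X (\<gamma> s) (\<gamma> t) \<le> 1 * dist s t" by (simp add: dist_real_def)
  qed
  have "(\<lambda>t. h (?e t)) \<in> borel_measurable unit_interval" using borel_measurable_edge[OF vw h] .
  then have meas': "(\<lambda>t. h (?e t) * indicator {0..1} t) \<in> borel_measurable borel"
    by (subst (asm) borel_measurable_restrict_space_iff_ennreal) auto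
  then have meas'': "(\<lambda>t. h (?e t) * indicator {0..b} t) \<in> borel_measurable borel"
  proof -
    have "(\<lambda>t. h (?e t) * indicator {0..b} t) = (\<lambda>t. h (?e t) * indicator {0..1} t * indicator {0..b} t)"
      using b by (auto simp: indicator_def)
    then show ?thesis using meas' by simp
  qed
  have "line_integral Xe \<gamma> h \<le> ennreal ?K * (\<integral>\<^sup>+ t. h (\<gamma> t) * indicator {0..1} t \<partial>lborel)"
    by (rule line_integral_le_Lipschitz[where g=h and \<gamma>=\<gamma> and m=Xe, OF in_pts K _ meas]) (rule lip)
  also have "\<dots> = ennreal (rad (min n k)) * (ennreal \<bar>b\<bar> * (\<integral>\<^sup>+ t. h (\<gamma> t) * indicator {0..1} t \<partial>lborel))"
  proof -
    have "ennreal ?K = ennreal (rad (min n k)) * ennreal \<bar>b\<bar>"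
      using b rad_pos[of "min n k"] by (subst ennreal_mult) auto
    then show ?thesis by (simp only: mult.assoc)
  qed
  also have "(\<integral>\<^sup>+ t. h (\<gamma> t) * indicator {0..1} t \<partial>lborel) = (\<integral>\<^sup>+ t. h (?e (0 + b * t)) * indicator {0..b} (0 + b * t) \<partial>lborel)"
    unfolding \<gamma>_def using b by (intro nn_integral_cong) (auto simp: indicator_def zero_le_mult_iff)
  also have "ennreal \<bar>b\<bar> * \<dots> = (\<integral>\<^sup>+ t. h (?e t) * indicator {0..b} t \<partial>lborel)"
    using nn_integral_real_affine[OF meas'', of b 0] b by simp
  also have "\<dots> \<le> (\<integral>\<^sup>+ t. h (?e t) * indicator {0..1} t \<partial>lborel)"
    using b by (intro nn_integral_mono) (auto simp: indicator_def)
  also have "\<dots> = edge_int (x, n) (y, k) h" by (simp add: edge_int_def nn_integral_restrict_space)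
  finally show "line_integral Xe \<gamma> h \<le> ennreal (rad (min n k)) * edge_int (x, n) (y, k) h"
    by (simp add: mult_left_mono)
qed

text \<open>The edge has positive weight, so h^p is integrable on it, and h \<le> 1 + h^p on the
  unit interval gives integrability of h.\<close>

lemma edge_int_finite:
  assumes "adj v w" "h \<in> borel_measurable (metric_borel X)" "p \<ge> 1"
    "edge_sum \<beta> (\<lambda>x. ennreal_powr (h x) p) < top"
  shows "edge_int v w h < top"
proof -
  have [measurable]: "(\<lambda>t. h (edge_pt v w t)) \<in> borel_measurable unit_interval"
    by (rule borel_measurable_edge[OF assms(1,2)])
  have "wt \<beta> v * edge_int v w (\<lambda>x. ennreal_powr (h x) p) < top"
    using edge_sum_ge_edge[OF assms(1), of \<beta> "\<lambda>x. ennreal_powr (h x) p"] assms(4) by (rule le_less_trans)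
  then have *: "edge_int v w (\<lambda>x. ennreal_powr (h x) p) < top"
    using wt_pos[of \<beta> v] by (auto simp: ennreal_mult_less_top)
  have "edge_int v w h \<le> (\<integral>\<^sup>+ t. 1 + ennreal_powr (h (edge_pt v w t)) p \<partial>unit_interval)"
    unfolding edge_int_def using le_add_ennreal_powr[of 1 p] assms(3) by (intro nn_integral_mono) simp
  also have "\<dots> = 1 + edge_int v w (\<lambda>x. ennreal_powr (h x) p)"
    using emeasure_unit_interval by (simp add: nn_integral_add edge_int_def)
  also have "\<dots> < top" using * by (simp add: less_top[symmetric])
  finally show ?thesis .
qed

lemma Lp_energy_borel:
  assumes "\<rho> \<in> borel_measurable (metric_borel X)"
  shows "Lp_energy (mu \<beta>) p \<rho> = edge_sum \<beta> (\<lambda>x. ennreal_powr (\<rho> x) p)"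
  unfolding Lp_energy_def nn_integral_completion using assms by (intro nn_integral_mu) measurable

text \<open>Initial pieces of edges are never exceptional, because every edge carries a positive multiple
  of Lebesgue measure.\<close>

lemma weak_upper_gradient_edge:
  assumes g: "weak_upper_gradient Xe (mu \<beta>) p u g" and p: "p \<ge> 1"
    and h: "h \<in> borel_measurable (metric_borel X)" "\<And>x. x \<in> pts \<Longrightarrow> g x \<le> h x"
      "edge_sum \<beta> (\<lambda>x. ennreal_powr (h x) p) < top"
    and vw: "adj (x, n) (y, k)" and b: "b \<in> {0<..1}"
  shows "\<bar>u (vertex_pt (x, n))\<bar> \<noteq> \<infinity>" "\<bar>u (edge_pt (x, n) (y, k) b)\<bar> \<noteq> \<infinity>"
    "e2ennreal \<bar>u (vertex_pt (x, n)) - u (edge_pt (x, n) (y, k) b)\<bar>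
       \<le> ennreal (rad (min n k)) * edge_int (x, n) (y, k) h"
proof -
  define \<gamma> where "\<gamma> = (\<lambda>r. edge_pt (x, n) (y, k) (b * r))"
  note c = edge_curve[OF vw b, folded \<gamma>_def]
  obtain \<Gamma> where \<Gamma>: "exceptional_family Xe (mu \<beta>) p \<Gamma>"
    "\<And>\<gamma>. rectifiable_curve Xe \<gamma> \<Longrightarrow> nonconstant_curve \<gamma> \<Longrightarrow> \<gamma> \<notin> \<Gamma> \<Longrightarrow> upper_gradient_along Xe u g \<gamma>"
    using g unfolding weak_upper_gradient_def by blast
  obtain \<rho> where \<rho>: "\<rho> \<in> borel_measurable (metric_borel Xe)" "Lp_energy (mu \<beta>) p \<rho> < \<infinity>"
    "\<And>\<gamma>. \<gamma> \<in> \<Gamma> \<Longrightarrow> line_integral Xe \<gamma> \<rho> = \<infinity>"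
    using \<Gamma>(1) unfolding exceptional_family_def by blast
  have \<rho>': "\<rho> \<in> borel_measurable (metric_borel X)" by (rule borel_measurable_Xe_X[OF \<rho>(1)])
  have fin: "ennreal (rad (min n k)) * edge_int (x, n) (y, k) f < top"
    if "f \<in> borel_measurable (metric_borel X)" "edge_sum \<beta> (\<lambda>x. ennreal_powr (f x) p) < top" for f
    using edge_int_finite[OF vw that(1) p that(2)] by (simp add: ennreal_mult_less_top)
  have "line_integral Xe \<gamma> \<rho> < \<infinity>"
    using le_less_trans[OF c(3)[OF \<rho>'] fin[OF \<rho>']] \<rho>(2) by (simp add: Lp_energy_borel[OF \<rho>'])
  then have ug: "upper_gradient_along Xe u g \<gamma>"
    using \<Gamma>(2)[OF c(1)[OF h(1)] c(2)[OF h(1)]] \<rho>(3) by fastforce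
  have "line_integral Xe \<gamma> g \<le> line_integral Xe \<gamma> h"
    unfolding line_integral_eq
    using h(2) arclength_param_in_mspace[OF c(1)[OF h(1)]]
    by (intro nn_integral_mono) (auto simp: indicator_def)
  also have "\<dots> \<le> ennreal (rad (min n k)) * edge_int (x, n) (y, k) h" by (rule c(3)[OF h(1)])
  finally have le: "line_integral Xe \<gamma> g \<le> ennreal (rad (min n k)) * edge_int (x, n) (y, k) h" .
  then have "line_integral Xe \<gamma> g < \<infinity>" using fin[OF h(1,3)] by (auto intro: le_less_trans)
  moreover have "\<gamma> 0 = vertex_pt (x, n)" "\<gamma> 1 = edge_pt (x, n) (y, k) b"
    by (auto simp: \<gamma>_def edge_pt_0)
  ultimately show "\<bar>u (vertex_pt (x, n))\<bar> \<noteq> \<infinity>" "\<bar>u (edge_pt (x, n) (y, k) b)\<bar> \<noteq> \<infinity>"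
    "e2ennreal \<bar>u (vertex_pt (x, n)) - u (edge_pt (x, n) (y, k) b)\<bar>
       \<le> ennreal (rad (min n k)) * edge_int (x, n) (y, k) h"
    using ug le unfolding upper_gradient_along_def by (auto split: if_splits)
qed


text \<open>The upper gradient inequality on the whole edge is raised to the power p by the
  Jensen-type bound, which costs the factor 2. The factor \<alpha> is needed because the other
  endpoint may be one level closer to the root, where the radius is \<alpha> times larger.\<close>

lemma edge_difference_le:
  assumes g: "weak_upper_gradient Xe (mu \<beta>) p u g" and p: "p \<ge> 1"
    and h: "h \<in> borel_measurable (metric_borel X)" "\<And>x. x \<in> pts \<Longrightarrow> g x \<le> h x"
      "edge_sum \<beta> (\<lambda>x. ennreal_powr (h x) p) < top"
    and vw: "adj (x, n) (y, k)"
  defines "U \<equiv> \<lambda>v. real_of_ereal (u (vertex_pt v))"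
  shows "ennreal (\<bar>U (x, n) - U (y, k)\<bar> powr p)
    \<le> ennreal ((2 * \<alpha> * rad n) powr p) * edge_int (x, n) (y, k) (\<lambda>x. ennreal_powr (h x) p)"
proof -
  have b: "(1::real) \<in> {0<..1}" by simp
  note e = weak_upper_gradient_edge[OF g p h vw b]
  have U: "u (vertex_pt (x, n)) = ereal (U (x, n))" "u (edge_pt (x, n) (y, k) 1) = ereal (U (y, k))"
    using e(1,2) by (auto simp: U_def edge_pt_1 ereal_real)
  have "ennreal \<bar>U (x, n) - U (y, k)\<bar> \<le> ennreal (rad (min n k)) * edge_int (x, n) (y, k) h"
    using e(3) unfolding U by (simp add: e2ennreal_ereal)
  then have "ennreal (\<bar>U (x, n) - U (y, k)\<bar> powr p)
      \<le> ennreal ((2 * rad (min n k)) powr p) * edge_int (x, n) (y, k) (\<lambda>x. ennreal_powr (h x) p)"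
    unfolding edge_int_def
    by (intro powr_le_nn_integral_powr borel_measurable_edge[OF vw h(1)] p rad_pos)
       (auto simp: emeasure_unit_interval)
  also have "\<dots> \<le> ennreal ((2 * \<alpha> * rad n) powr p) * edge_int (x, n) (y, k) (\<lambda>x. ennreal_powr (h x) p)"
  proof (intro mult_right_mono ennreal_leI powr_mono2)
    have "rad (min n k) \<le> \<alpha> * rad n"
    proof (cases n)
      case 0
      then show ?thesis using alpha by simp
    next
      case (Suc j)
      then have "j \<le> min n k" using adj_level[OF vw] by auto
      from rad_antimono[OF this] show ?thesis using Suc alpha by simp
    qed
    then show "2 * rad (min n k) \<le> 2 * \<alpha> * rad n" by simp
  qed (use p rad_pos[of "min n k"] in auto)
  finally show ?thesis .
qed

lemma ennreal_mult_regroup: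
  assumes "a \<ge> 0" "b \<ge> 0" "m \<ge> 0"
  shows "ennreal (a * m) * (ennreal b * x) = ennreal (a * b * m) * x"
proof -
  have "ennreal (a * m) * ennreal b = ennreal (a * m * b)" using assms by (simp add: ennreal_mult[symmetric])
  also have "a * m * b = a * b * m" by simp
  finally show ?thesis by (simp only: mult.assoc[symmetric])
qed

text \<open>Edge differences contribute \<alpha>^(-n p), and the upper bound on \<theta> makes the
  product with \<alpha>^(n p \<theta>) at most exp(-\<beta> n), the factor in
  \<open>vertex_weight\<close>. The sum over vertices and neighbours is then \<open>edge_sum\<close>
  of the p-th power of the Borel majorant.\<close>

lemma discrete_energy_le:
  assumes g: "weak_upper_gradient Xe (mu \<beta>) p u g" "Lp_energy (mu \<beta>) p g < \<infinity>" and p: "p \<ge> 1"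
    and \<theta>: "\<theta> \<le> 1 - \<beta> / (ln \<alpha> * p)"
  defines "U \<equiv> \<lambda>v. real_of_ereal (u (vertex_pt v))"
  shows "(\<Sum>n. ennreal (\<alpha> powr (real n * (p * \<theta>)) * level_energy p U n))
    \<le> ennreal ((2 * \<alpha>) powr p) * Lp_energy (mu \<beta>) p g"
proof -
  have gm: "g \<in> borel_measurable (completion (mu \<beta>))" using g(1) by (simp add: weak_upper_gradient_def)
  obtain h where h: "h \<in> borel_measurable (metric_borel X)" "\<And>x. x \<in> pts \<Longrightarrow> g x \<le> h x"
    "\<And>p. Lp_energy (mu \<beta>) p g = edge_sum \<beta> (\<lambda>x. ennreal_powr (h x) p)"
    by (rule borel_majorant[OF gm]) (rule that)
  let ?hp = "\<lambda>x. ennreal_powr (h x) p" and ?K = "(2 * \<alpha>) powr p"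
  have fin: "edge_sum \<beta> ?hp < top" using g(2) h(3) by simp
  have weights: "\<alpha> powr (real n * (p * \<theta>)) * (2 * \<alpha> * rad n) powr p \<le> ?K * exp (- \<beta> * real n)" for n
  proof -
    have "p * \<theta> \<le> p - \<beta> / ln \<alpha>" using mult_left_mono[OF \<theta>, of p] p by (simp add: field_simps)
    then have "real n * (p * \<theta>) \<le> real n * (p - \<beta> / ln \<alpha>)" by (rule mult_left_mono) simp
    then have "\<alpha> powr (real n * (p * \<theta>) - real n * p) \<le> \<alpha> powr (- (\<beta> / ln \<alpha>) * real n)"
      using alpha by (intro powr_mono) (auto simp: algebra_simps)
    also have "\<dots> = exp (- \<beta> * real n)" using alpha by (simp add: powr_def)
    finally have *: "\<alpha> powr (real n * (p * \<theta>) - real n * p) \<le> exp (- \<beta> * real n)" .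
    have "rad n = \<alpha> powr (- real n)" using alpha by (simp add: powr_minus powr_realpow inverse_eq_divide)
    then have "(2 * \<alpha> * rad n) powr p = ?K * \<alpha> powr (- (real n * p))"
      using alpha by (simp add: powr_mult powr_powr)
    then have eq: "\<alpha> powr (real n * (p * \<theta>)) * (2 * \<alpha> * rad n) powr p = ?K * \<alpha> powr (real n * (p * \<theta>) - real n * p)"
      by (simp add: powr_add[symmetric] mult.left_commute)
    show ?thesis unfolding eq by (rule mult_left_mono[OF *]) simp
  qed
  have level_le: "ennreal (\<alpha> powr (real n * (p * \<theta>)) * level_energy p U n)
      \<le> (\<Sum>z\<in>A n. \<Sum>w | adj (z, n) w. ennreal ?K * ((wt \<beta> (z, n) + wt \<beta> w) * edge_int (z, n) w ?hp))" for n
  proof -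
    have "ennreal (\<alpha> powr (real n * (p * \<theta>)) * level_energy p U n) =
        (\<Sum>z\<in>A n. \<Sum>w | adj (z, n) w. ennreal (\<alpha> powr (real n * (p * \<theta>)) * measure \<nu> (ball z (rad n))) * ennreal (\<bar>U (z, n) - U w\<bar> powr p))"
    proof -
      have eq: "\<alpha> powr (real n * (p * \<theta>)) * level_energy p U n =
          (\<Sum>z\<in>A n. \<Sum>w | adj (z, n) w. (\<alpha> powr (real n * (p * \<theta>)) * measure \<nu> (ball z (rad n))) * \<bar>U (z, n) - U w\<bar> powr p)"
        unfolding level_energy_def sum_distrib_left by (simp only: mult.assoc)
      show ?thesis
        unfolding eq by (simp add: sum_ennreal[symmetric] sum_nonneg ennreal_mult'' del: sum_ennreal)
    qed
    also have "\<dots> \<le> (\<Sum>z\<in>A n. \<Sum>w | adj (z, n) w. ennreal ?K * ((wt \<beta> (z, n) + wt \<beta> w) * edge_int (z, n) w ?hp))"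
    proof (intro sum_mono)
      fix z w assume w: "w \<in> {w. adj (z, n) w}"
      obtain y k where yk: "w = (y, k)" by (cases w)
      have "ennreal (\<alpha> powr (real n * (p * \<theta>)) * measure \<nu> (ball z (rad n))) * ennreal (\<bar>U (z, n) - U w\<bar> powr p)
          \<le> ennreal (\<alpha> powr (real n * (p * \<theta>)) * measure \<nu> (ball z (rad n))) * (ennreal ((2 * \<alpha> * rad n) powr p) * edge_int (z, n) w ?hp)"
        using edge_difference_le[OF g(1) p h(1,2) fin, of z n y k] w unfolding yk U_def
        by (intro mult_left_mono) auto
      also have "\<dots> = ennreal ((\<alpha> powr (real n * (p * \<theta>)) * (2 * \<alpha> * rad n) powr p) * measure \<nu> (ball z (rad n))) * edge_int (z, n) w ?hp"
        using alpha by (intro ennreal_mult_regroup) auto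
      also have "\<dots> \<le> ennreal ((?K * exp (- \<beta> * real n)) * measure \<nu> (ball z (rad n))) * edge_int (z, n) w ?hp"
        by (intro mult_right_mono ennreal_leI weights) auto
      also have "\<dots> = ennreal ?K * (wt \<beta> (z, n) * edge_int (z, n) w ?hp)"
      proof -
        have eq: "ennreal ?K * (ennreal (exp (- \<beta> * real n)) * ennreal (measure \<nu> (ball z (rad n)))) =
            ennreal ((?K * exp (- \<beta> * real n)) * measure \<nu> (ball z (rad n)))"
          by (simp add: ennreal_mult[symmetric] mult.assoc)
        show ?thesis
          unfolding vertex_weight_def prod.case nu.emeasure_eq_measure eq[symmetric] by (simp only: mult.assoc)
      qed
      also have "\<dots> \<le> ennreal ?K * ((wt \<beta> (z, n) + wt \<beta> w) * edge_int (z, n) w ?hp)"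
        by (intro mult_left_mono mult_right_mono) auto
      finally show "ennreal (\<alpha> powr (real n * (p * \<theta>)) * measure \<nu> (ball z (rad n))) * ennreal (\<bar>U (z, n) - U w\<bar> powr p)
          \<le> ennreal ?K * ((wt \<beta> (z, n) + wt \<beta> w) * edge_int (z, n) w ?hp)" .
    qed
    finally show ?thesis .
  qed
  have "(\<Sum>n. ennreal (\<alpha> powr (real n * (p * \<theta>)) * level_energy p U n))
      \<le> (\<Sum>n. \<Sum>z\<in>A n. \<Sum>w | adj (z, n) w. ennreal ?K * ((wt \<beta> (z, n) + wt \<beta> w) * edge_int (z, n) w ?hp))"
    by (intro suminf_le level_le) auto
  also have "\<dots> = ennreal ?K * (\<Sum>n. \<Sum>z\<in>A n. \<Sum>w | adj (z, n) w. (wt \<beta> (z, n) + wt \<beta> w) * edge_int (z, n) w ?hp)"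
    by (simp only: sum_distrib_left[symmetric] ennreal_suminf_cmult)
  also have "(\<Sum>n. \<Sum>z\<in>A n. \<Sum>w | adj (z, n) w. (wt \<beta> (z, n) + wt \<beta> w) * edge_int (z, n) w ?hp) = edge_sum \<beta> ?hp"
    unfolding edge_sum_def nn_integral_count_space_vertices
    by (simp add: nn_integral_count_space_finite finite_neighbours)
  finally show ?thesis using h(3) by simp
qed

text \<open>For t in (0, 1] the root value differs from the value at the point t of the edge to
  \<open>(z0, 1)\<close> by at most the integral of h over this edge. This is averaged in t. The
  constant 4^p is 2^p from the Jensen-type bound times 2^p from splitting (f + h)^p.\<close>

lemma root_value_le:
  assumes g: "weak_upper_gradient Xe (mu \<beta>) p u g" "Lp_energy (mu \<beta>) p g < \<infinity>" and p: "p \<ge> 1"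
    and u: "u \<in> borel_measurable (completion (mu \<beta>))"
  shows "\<bar>u root\<bar> \<noteq> \<infinity>"
    "wt \<beta> (z0, 0) * ennreal (\<bar>real_of_ereal (u root)\<bar> powr p) \<le> ennreal (4 powr p) *
       (Lp_energy (mu \<beta>) p (\<lambda>x. e2ennreal \<bar>u x\<bar>) + Lp_energy (mu \<beta>) p g)"
proof -
  let ?v = "(z0, 0::nat)" and ?w = "(z0, 1::nat)"
  have gm: "g \<in> borel_measurable (completion (mu \<beta>))" using g(1) by (simp add: weak_upper_gradient_def)
  obtain h where h: "h \<in> borel_measurable (metric_borel X)" "\<And>x. x \<in> pts \<Longrightarrow> g x \<le> h x"
    "\<And>p. Lp_energy (mu \<beta>) p g = edge_sum \<beta> (\<lambda>x. ennreal_powr (h x) p)"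
    by (rule borel_majorant[OF gm]) (rule that)
  have um: "(\<lambda>x. e2ennreal \<bar>u x\<bar>) \<in> borel_measurable (completion (mu \<beta>))" using u by measurable
  obtain f where f: "f \<in> borel_measurable (metric_borel X)" "\<And>x. x \<in> pts \<Longrightarrow> e2ennreal \<bar>u x\<bar> \<le> f x"
    "\<And>p. Lp_energy (mu \<beta>) p (\<lambda>x. e2ennreal \<bar>u x\<bar>) = edge_sum \<beta> (\<lambda>x. ennreal_powr (f x) p)"
    by (rule borel_majorant[OF um]) (rule that)
  have fin: "edge_sum \<beta> (\<lambda>x. ennreal_powr (h x) p) < top" using g(2) h(3) by simp
  note e = weak_upper_gradient_edge[OF g(1) p h(1,2) fin adj_root]
  show root: "\<bar>u root\<bar> \<noteq> \<infinity>" using e(1)[of 1] by simp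
  define a where "a = \<bar>real_of_ereal (u root)\<bar>"
  have a0: "a \<ge> 0" by (simp add: a_def real_of_ereal_pos)
  have pt: "ennreal a \<le> f (edge_pt ?v ?w t) + edge_int ?v ?w h" if t: "t \<in> {0<..1}" for t
  proof -
    obtain r s where rs: "u root = ereal r" "u (edge_pt ?v ?w t) = ereal s"
      using root e(2)[OF _ t] by (cases "u root"; cases "u (edge_pt ?v ?w t)") auto
    have "a \<le> \<bar>s\<bar> + \<bar>r - s\<bar>" using rs by (simp add: a_def)
    then have "ennreal a \<le> ennreal \<bar>s\<bar> + ennreal \<bar>r - s\<bar>"
      by (simp add: ennreal_plus[symmetric] ennreal_leI del: ennreal_plus)
    also have "\<dots> = e2ennreal \<bar>u (edge_pt ?v ?w t)\<bar> + e2ennreal \<bar>u root - u (edge_pt ?v ?w t)\<bar>"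
      using rs by (simp add: e2ennreal_ereal)
    also have "\<dots> \<le> f (edge_pt ?v ?w t) + ennreal (rad (min 0 1)) * edge_int ?v ?w h"
      using e(3)[OF _ t] f(2)[OF edge_in_pts[OF adj_root, of t]] t by (intro add_mono) auto
    finally show ?thesis by simp
  qed
  let ?F = "\<lambda>t. f (edge_pt ?v ?w t) + h (edge_pt ?v ?w t)"
  have [measurable]: "(\<lambda>t. f (edge_pt ?v ?w t)) \<in> borel_measurable unit_interval" "(\<lambda>t. h (edge_pt ?v ?w t)) \<in> borel_measurable unit_interval"
    by (rule borel_measurable_edge[OF adj_root f(1)], rule borel_measurable_edge[OF adj_root h(1)])
  have "ennreal a = (\<integral>\<^sup>+ t. ennreal a \<partial>unit_interval)"
    using emeasure_unit_interval by simp
  also have "\<dots> \<le> (\<integral>\<^sup>+ t. f (edge_pt ?v ?w t) + edge_int ?v ?w h \<partial>unit_interval)"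
  proof (rule nn_integral_mono_AE)
    \<comment> \<open>At t = 0 the initial piece is constant and the upper gradient condition says
      nothing; a single parameter is negligible.\<close>
    have "AE t in lborel. t \<noteq> (0::real)" by (rule AE_lborel_singleton)
    then show "AE t in unit_interval. ennreal a \<le> f (edge_pt ?v ?w t) + edge_int ?v ?w h"
      by (subst AE_restrict_space_iff) (auto elim!: eventually_mono intro!: pt simp del: One_nat_def)
  qed
  also have "\<dots> = (\<integral>\<^sup>+ t. ?F t \<partial>unit_interval)"
    using emeasure_unit_interval by (simp add: nn_integral_add edge_int_def del: One_nat_def)
  finally have "ennreal (a powr p) \<le> ennreal ((2 * 1) powr p) * (\<integral>\<^sup>+ t. ennreal_powr (?F t) p \<partial>unit_interval)"
    using p a0 by (intro powr_le_nn_integral_powr) (auto simp: emeasure_unit_interval simp del: One_nat_def)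
  then have 1: "ennreal (a powr p) \<le> ennreal (2 powr p) * (\<integral>\<^sup>+ t. ennreal_powr (?F t) p \<partial>unit_interval)"
    by simp
  define P Q where "P = edge_int ?v ?w (\<lambda>x. ennreal_powr (f x) p)" and "Q = edge_int ?v ?w (\<lambda>x. ennreal_powr (h x) p)"
  have "(\<integral>\<^sup>+ t. ennreal_powr (?F t) p \<partial>unit_interval) \<le>
      (\<integral>\<^sup>+ t. ennreal (2 powr p) * (ennreal_powr (f (edge_pt ?v ?w t)) p + ennreal_powr (h (edge_pt ?v ?w t)) p) \<partial>unit_interval)"
    using p by (intro nn_integral_mono ennreal_powr_add_le) auto
  also have "\<dots> = ennreal (2 powr p) * (P + Q)"
    by (simp add: nn_integral_cmult nn_integral_add edge_int_def P_def Q_def del: One_nat_def)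
  finally have "ennreal (a powr p) \<le> ennreal (2 powr p) * (ennreal (2 powr p) * (P + Q))"
    by (rule order_trans[OF 1 mult_left_mono]) simp
  also have "\<dots> = ennreal (4 powr p) * (P + Q)"
  proof -
    have "ennreal (2 powr p) * ennreal (2 powr p) = ennreal (4 powr p)"
      by (simp add: ennreal_mult[symmetric] powr_mult[symmetric])
    then show ?thesis by (simp only: mult.assoc[symmetric])
  qed
  finally have "wt \<beta> ?v * ennreal (a powr p) \<le> wt \<beta> ?v * (ennreal (4 powr p) * (P + Q))"
    by (rule mult_left_mono) simp
  also have "\<dots> = ennreal (4 powr p) * (wt \<beta> ?v * P + wt \<beta> ?v * Q)"
    by (simp only: distrib_left mult.left_commute)
  also have "\<dots> \<le> ennreal (4 powr p) * (edge_sum \<beta> (\<lambda>x. ennreal_powr (f x) p) + edge_sum \<beta> (\<lambda>x. ennreal_powr (h x) p))"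
    unfolding P_def Q_def by (intro mult_left_mono add_mono edge_sum_ge_edge adj_root) auto
  finally show "wt \<beta> ?v * ennreal (\<bar>real_of_ereal (u root)\<bar> powr p) \<le> ennreal (4 powr p) *
       (Lp_energy (mu \<beta>) p (\<lambda>x. e2ennreal \<bar>u x\<bar>) + Lp_energy (mu \<beta>) p g)"
    unfolding a_def h(3) f(3) .
qed

text \<open>The nets are nested, so \<open>(z, n)\<close> has the neighbour
  \<open>(z, Suc n)\<close>, and the finite integral over that edge rules out infinite
  values.\<close>

lemma vertex_value_finite:
  assumes g: "weak_upper_gradient Xe (mu \<beta>) p u g" "Lp_energy (mu \<beta>) p g < \<infinity>" and p: "p \<ge> 1" and z: "z \<in> A n"
  shows "\<bar>u (vertex_pt (z, n))\<bar> \<noteq> \<infinity>"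
proof -
  have gm: "g \<in> borel_measurable (completion (mu \<beta>))" using g(1) by (simp add: weak_upper_gradient_def)
  obtain h where h: "h \<in> borel_measurable (metric_borel X)" "\<And>x. x \<in> pts \<Longrightarrow> g x \<le> h x"
    "\<And>p. Lp_energy (mu \<beta>) p g = edge_sum \<beta> (\<lambda>x. ennreal_powr (h x) p)"
    by (rule borel_majorant[OF gm]) (rule that)
  have "adj (z, n) (z, Suc n)"
    using z net_mono[of n "Suc n"] rad_pos[of n] rad_pos[of "Suc n"] by (intro adj_up[of _ _ _ z]) auto
  from weak_upper_gradient_edge(1)[OF g(1) p h(1,2) _ this, of 1] show ?thesis using g(2) h(3) by simp
qed

end

section \<open>Geometric series and averages\<close>

lemma geometric_increments_limit:
  fixes a :: "nat \<Rightarrow> real"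
  assumes "\<And>k. \<bar>a (Suc k) - a k\<bar> \<le> c * q ^ k" "0 \<le> q" "q < 1"
  shows "a \<longlonglongrightarrow> lim a" "\<bar>lim a - a 0\<bar> \<le> c / (1 - q)"
proof -
  let ?d = "\<lambda>k. a (Suc k) - a k"
  have geo: "(\<lambda>k. c * q ^ k) sums (c * (1 / (1 - q)))"
    using assms by (intro sums_mult geometric_sums) auto
  have sm: "summable (\<lambda>k. \<bar>?d k\<bar>)"
    by (rule summable_comparison_test'[OF sums_summable[OF geo], of 0]) (use assms in auto)
  have "?d sums suminf ?d" by (rule summable_sums[OF summable_rabs_cancel[OF sm]])
  then have "(\<lambda>k. a k - a 0) \<longlonglongrightarrow> suminf ?d" by (simp add: sums_def sum_lessThan_telescope)
  from tendsto_add[OF this tendsto_const[of "a 0"]] have *: "a \<longlonglongrightarrow> suminf ?d + a 0" by simp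
  then have eq: "lim a = suminf ?d + a 0" by (rule limI)
  show "a \<longlonglongrightarrow> lim a" using * unfolding eq .
  have "\<bar>suminf ?d\<bar> \<le> (\<Sum>k. \<bar>?d k\<bar>)" by (rule summable_rabs[OF sm])
  also have "\<dots> \<le> (\<Sum>k. c * q ^ k)" by (intro suminf_le sm sums_summable[OF geo] assms)
  also have "\<dots> = c / (1 - q)" using sums_unique[OF geo] by simp
  finally show "\<bar>lim a - a 0\<bar> \<le> c / (1 - q)" unfolding eq by simp
qed

lemma abs_average_diff_le:
  fixes f :: "'a \<Rightarrow> real"
  assumes "finite S" "S \<noteq> {}" "\<And>s. s \<in> S \<Longrightarrow> \<bar>f s - c\<bar> \<le> M"
  shows "\<bar>sum f S / card S - c\<bar> \<le> M"
proof -
  have card: "real (card S) > 0" using assms by (simp add: card_gt_0_iff)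
  have "\<bar>\<Sum>s\<in>S. f s - c\<bar> \<le> (\<Sum>s\<in>S. M)" by (rule order_trans[OF sum_abs sum_mono]) (use assms in auto)
  then have "\<bar>\<Sum>s\<in>S. f s - c\<bar> \<le> card S * M" by simp
  moreover have "sum f S / card S - c = (\<Sum>s\<in>S. f s - c) / card S"
    using card by (simp add: sum_subtractf field_simps)
  ultimately show ?thesis using card by (simp add: abs_divide field_simps)
qed

lemma abs_averages_diff_le:
  fixes f :: "'a \<Rightarrow> real" and g :: "'b \<Rightarrow> real"
  assumes "finite S" "S \<noteq> {}" "finite T" "T \<noteq> {}" "\<And>s t. s \<in> S \<Longrightarrow> t \<in> T \<Longrightarrow> \<bar>f s - g t\<bar> \<le> M"
  shows "\<bar>sum f S / card S - sum g T / card T\<bar> \<le> M"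
proof (rule abs_average_diff_le[OF assms(1,2)])
  fix s assume "s \<in> S"
  then have "\<bar>sum g T / card T - f s\<bar> \<le> M"
    using assms by (intro abs_average_diff_le) (auto simp: abs_minus_commute)
  then show "\<bar>f s - sum g T / card T\<bar> \<le> M" by (simp add: abs_minus_commute)
qed

lemma abs_le_powr_inverse: "\<bar>x :: real\<bar> powr p \<le> M \<Longrightarrow> p > 0 \<Longrightarrow> \<bar>x\<bar> \<le> M powr (1/p)"
  using powr_mono2[of "1/p" "\<bar>x\<bar> powr p" M] by (simp add: powr_powr)

lemma powr_inverse_powr: "M \<ge> 0 \<Longrightarrow> p > 0 \<Longrightarrow> (M powr (1/p)) powr p = M" for M :: real
  by (simp add: powr_powr)

lemma powr_sum3_le:
  fixes x y z :: real
  assumes "x \<ge> 0" "y \<ge> 0" "z \<ge> 0" "p > 0"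
  shows "(x + y + z) powr p \<le> 3 powr p * (x powr p + y powr p + z powr p)"
proof -
  let ?m = "max x (max y z)"
  have "(x + y + z) powr p \<le> (3 * ?m) powr p" using assms by (intro powr_mono2) auto
  also have "\<dots> = 3 powr p * ?m powr p" by (rule powr_mult)
  also have "?m powr p \<le> x powr p + y powr p + z powr p" by (auto simp: max_def add_increasing add_increasing2)
  finally show ?thesis by (simp add: mult_left_mono)
qed

lemma ennreal_suminf_shift_le: "(\<Sum>n. f (n + k)) \<le> (\<Sum>n. f n :: ennreal)"
proof (rule suminf_le_const)
  fix N
  have "sum (\<lambda>n. f (n + k)) {..<N} = sum f {k..<N + k}"
    using sum.shift_bounds_nat_ivl[of f 0 k N] by (simp add: lessThan_atLeast0)
  also have "\<dots> \<le> (\<Sum>n. f n)" by (rule sum_le_suminf) auto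
  finally show "sum (\<lambda>n. f (n + k)) {..<N} \<le> (\<Sum>n. f n)" .
qed auto

text \<open>A series is an integral over the counting measure, which turns the interchange into that
  of a series with an integral.\<close>

lemma ennreal_suminf_swap: "(\<Sum>n. \<Sum>k. f n k) = (\<Sum>k. \<Sum>n. f n k :: ennreal)"
proof -
  have "(\<Sum>n. \<Sum>k. f n k) = (\<integral>\<^sup>+ n. (\<Sum>k. f n k) \<partial>count_space UNIV)"
    by (rule nn_integral_count_space_nat[symmetric])
  also have "\<dots> = (\<Sum>k. \<integral>\<^sup>+ n. f n k \<partial>count_space UNIV)" by (rule nn_integral_suminf) simp
  also have "\<dots> = (\<Sum>k. \<Sum>n. f n k)" by (simp only: nn_integral_count_space_nat)
  finally show ?thesis .
qed

lemma ennreal_suminf_geometric: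
  assumes "0 \<le> q" "q < 1" shows "(\<Sum>k. ennreal (q ^ k)) = ennreal (1 / (1 - q))"
  using assms by (intro suminf_ennreal_eq geometric_sums) auto

context doubling_filling
begin

section \<open>Consequences of doubling\<close>

lemma doubling_scale:
  assumes "M > 0"
  shows "\<exists>C>0. \<forall>x r. r > 0 \<longrightarrow> measure \<nu> (ball x (M * r)) \<le> C * measure \<nu> (ball x r)"
proof -
  obtain C where C: "C > 0" "\<And>x r. r > 0 \<Longrightarrow> emeasure \<nu> (ball x (2 * r)) \<le> ennreal C * emeasure \<nu> (ball x r)"
    using doubling by (auto simp: doubling_measure_def)
  have step: "measure \<nu> (ball x (2 * r)) \<le> C * measure \<nu> (ball x r)" if "r > 0" for x r
    using C(2)[OF that, of x] C(1) by (simp add: nu.emeasure_eq_measure ennreal_mult[symmetric])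
  have iter: "measure \<nu> (ball x (2 ^ k * r)) \<le> C ^ k * measure \<nu> (ball x r)" if "r > 0" for x r k
  proof (induction k)
    case (Suc k)
    have "measure \<nu> (ball x (2 ^ Suc k * r)) \<le> C * measure \<nu> (ball x (2 ^ k * r))"
      using step[of "2 ^ k * r" x] that by (simp add: mult.assoc)
    also have "\<dots> \<le> C * (C ^ k * measure \<nu> (ball x r))" using Suc C(1) by (intro mult_left_mono) auto
    finally show ?case by (simp add: mult.assoc)
  qed simp
  obtain k where k: "M < 2 ^ k" using real_arch_pow[of 2 M] by auto
  have "measure \<nu> (ball x (M * r)) \<le> C ^ k * measure \<nu> (ball x r)" if "r > 0" for x r
  proof -
    have "ball x (M * r) \<subseteq> ball x (2 ^ k * r)" using k that by (intro subset_ball mult_right_mono) auto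
    then have "measure \<nu> (ball x (M * r)) \<le> measure \<nu> (ball x (2 ^ k * r))"
      by (intro nu.finite_measure_mono) (auto simp: sets_nu)
    then show ?thesis using iter[OF that] by (rule order_trans)
  qed
  then show ?thesis using C(1) by (intro exI[of _ "C ^ k"]) auto
qed

text \<open>Packing: the balls of radius \<open>rad n / 2\<close> around the counted points are
  disjoint, lie in the ball of radius \<open>(M + 1) * rad n\<close> around \<xi>, and by doubling
  each carries at least the fraction 1/C of its measure.\<close>

lemma overlap_bound:
  assumes "M > 0"
  shows "\<exists>N::nat. \<forall>n \<xi>. card {z \<in> A n. dist z \<xi> < M * rad n} \<le> N"
proof -
  \<comment> \<open>Applied to the radius \<open>rad n / 2\<close> this factor gives
    \<open>(2 * M + 1) * rad n\<close>, enough for a ball around a counted point to contain the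
    large ball around \<xi>.\<close>
  obtain C where C: "C > 0" "\<And>x r. r > 0 \<Longrightarrow> measure \<nu> (ball x ((2 * (2 * M + 1)) * r)) \<le> C * measure \<nu> (ball x r)"
    using doubling_scale[of "2 * (2 * M + 1)"] assms by auto
  have "card {z \<in> A n. dist z \<xi> < M * rad n} \<le> nat \<lceil>C\<rceil>" for n \<xi>
  proof -
    let ?S = "{z \<in> A n. dist z \<xi> < M * rad n}" and ?m = "measure \<nu> (ball \<xi> ((M + 1) * rad n))"
    have fin: "finite ?S" using finite_net by simp
    have r: "rad n > 0" by (rule rad_pos)
    have m: "?m > 0" using assms r by (intro measure_ball_pos) auto
    have each: "?m \<le> C * measure \<nu> (ball z (rad n / 2))" if "z \<in> ?S" for z
    proof -
      have "ball \<xi> ((M + 1) * rad n) \<subseteq> ball z ((2 * (2 * M + 1)) * (rad n / 2))"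
      proof
        fix y assume "y \<in> ball \<xi> ((M + 1) * rad n)"
        then have "dist z y < M * rad n + (M + 1) * rad n"
          using that dist_triangle[of z y \<xi>] by auto
        moreover have "2 * (2 * M + 1) * (\<rho> / 2) = M * \<rho> + (M + 1) * \<rho>" for \<rho> :: real by (simp add: field_simps)
        ultimately show "y \<in> ball z ((2 * (2 * M + 1)) * (rad n / 2))" unfolding mem_ball by (simp only:)
      qed
      then have "?m \<le> measure \<nu> (ball z ((2 * (2 * M + 1)) * (rad n / 2)))"
        by (intro nu.finite_measure_mono) (auto simp: sets_nu)
      also have "\<dots> \<le> C * measure \<nu> (ball z (rad n / 2))" using C(2)[of "rad n / 2" z] r by simp
      finally show ?thesis .
    qed
    have disj: "disjoint_family_on (\<lambda>z. ball z (rad n / 2)) ?S"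
    proof (unfold disjoint_family_on_def, intro ballI impI)
      fix z z' assume z: "z \<in> ?S" "z' \<in> ?S" "z \<noteq> z'"
      then have "rad n \<le> dist z z'" using net_separated by auto
      then show "ball z (rad n / 2) \<inter> ball z' (rad n / 2) = {}" by (intro disjoint_ballI) simp
    qed
    have "card ?S * ?m = (\<Sum>z\<in>?S. ?m)" by simp
    also have "\<dots> \<le> (\<Sum>z\<in>?S. C * measure \<nu> (ball z (rad n / 2)))" by (intro sum_mono each)
    also have "\<dots> = C * measure \<nu> (\<Union>z\<in>?S. ball z (rad n / 2))"
      using fin disj by (subst nu.finite_measure_finite_Union) (auto simp: sets_nu sum_distrib_left)
    also have "\<dots> \<le> C * ?m"
    proof (intro mult_left_mono nu.finite_measure_mono)
      show "(\<Union>z\<in>?S. ball z (rad n / 2)) \<subseteq> ball \<xi> ((M + 1) * rad n)"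
      proof (safe)
        fix y z assume "z \<in> A n" "dist z \<xi> < M * rad n" "y \<in> ball z (rad n / 2)"
        then have "dist \<xi> y < M * rad n + rad n / 2"
          using dist_triangle[of \<xi> y z] by (auto simp: dist_commute)
        moreover have "M * \<rho> + \<rho> / 2 \<le> (M + 1) * \<rho>" if "\<rho> > 0" for \<rho> :: real using that by (simp add: algebra_simps)
        ultimately show "y \<in> ball \<xi> ((M + 1) * rad n)" unfolding mem_ball using r by (meson less_le_trans)
      qed
    qed (use C in \<open>auto simp: sets_nu\<close>)
    finally have "real (card ?S) \<le> C" using m by simp
    then show ?thesis by linarith
  qed
  then show ?thesis by blast
qed

section \<open>The trace of a function on the vertices\<close>

definition near :: "nat \<Rightarrow> 'z \<Rightarrow> 'z set" where
  "near n \<zeta> = A n \<inter> ball \<zeta> (rad n)"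

lemma finite_near: "finite (near n \<zeta>)" and near_nonempty: "near n \<zeta> \<noteq> {}"
  using finite_net net_cover[of n \<zeta>] by (auto simp: near_def dist_commute)

lemma near_0: "near 0 \<zeta> = {z0}"
  using net_0 dist_less_1[of \<zeta> z0] by (auto simp: near_def)

definition average :: "('z \<times> nat \<Rightarrow> real) \<Rightarrow> nat \<Rightarrow> 'z \<Rightarrow> real" where
  "average U n \<zeta> = (\<Sum>z\<in>near n \<zeta>. U (z, n)) / card (near n \<zeta>)"

text \<open>With \<open>lim\<close> the function is defined and measurable on all of Z. Where the
  averages diverge the value is arbitrary; those points will form a null set.\<close>

definition trace :: "('z \<times> nat \<Rightarrow> real) \<Rightarrow> 'z \<Rightarrow> real" where
  "trace U \<zeta> = lim (\<lambda>n. average U n \<zeta>)"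

lemma ball_sets [measurable]: "ball x r \<in> sets \<nu>"
  by (simp add: sets_nu)

text \<open>Membership in \<open>near\<close> is rewritten as a condition on balls around finitely
  many fixed points, so the average becomes a quotient of sums of indicators.\<close>

lemma average_measurable [measurable]: "average U n \<in> borel_measurable \<nu>"
proof -
  have eq: "average U n = (\<lambda>\<zeta>. (\<Sum>z\<in>A n. U (z, n) * indicator (ball z (rad n)) \<zeta>) / (\<Sum>z\<in>A n. indicator (ball z (rad n)) \<zeta>))"
  proof
    fix \<zeta>
    have near: "near n \<zeta> = {z \<in> A n. \<zeta> \<in> ball z (rad n)}" by (auto simp: near_def dist_commute)
    have "(\<Sum>z\<in>A n. f z * indicator (ball z (rad n)) \<zeta>) = (\<Sum>z\<in>near n \<zeta>. f z)" for f :: "'z \<Rightarrow> real"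
      unfolding near sum.inter_filter[OF finite_net] by (intro sum.cong refl) (simp add: indicator_def)
    from this[of "\<lambda>z. U (z, n)"] this[of "\<lambda>_. 1"]
    show "average U n \<zeta> = (\<Sum>z\<in>A n. U (z, n) * indicator (ball z (rad n)) \<zeta>) / (\<Sum>z\<in>A n. indicator (ball z (rad n)) \<zeta>)"
      by (simp add: average_def)
  qed
  show ?thesis unfolding eq by measurable
qed

lemma trace_measurable: "trace U \<in> borel_measurable \<nu>"
  unfolding trace_def by (rule borel_measurable_lim_metric) simp

section \<open>Increments of the averages and their weighted tails\<close>

definition jump :: "real \<Rightarrow> ('z \<times> nat \<Rightarrow> real) \<Rightarrow> nat \<Rightarrow> 'z \<Rightarrow> real" where
  "jump p U n \<zeta> = (\<Sum>z\<in>near n \<zeta>. \<Sum>z'\<in>near (Suc n) \<zeta>. \<bar>U (z, n) - U (z', Suc n)\<bar> powr p)"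

lemma jump_nonneg: "jump p U n \<zeta> \<ge> 0"
  by (simp add: jump_def sum_nonneg)

text \<open>The sum of p-th powers in \<open>jump\<close> dominates each of its terms, so its p-th
  root bounds every single difference and with it the difference of the averages. A sum rather than
  a maximum is convenient because it is integrated term by term.\<close>

lemma average_step_le:
  assumes "p > 0"
  shows "\<bar>average U (Suc n) \<zeta> - average U n \<zeta>\<bar> \<le> jump p U n \<zeta> powr (1/p)"
  unfolding average_def
proof (rule abs_averages_diff_le)
  fix z' z assume z: "z' \<in> near (Suc n) \<zeta>" "z \<in> near n \<zeta>"
  have "\<bar>U (z', Suc n) - U (z, n)\<bar> powr p \<le> (\<Sum>z'\<in>near (Suc n) \<zeta>. \<bar>U (z, n) - U (z', Suc n)\<bar> powr p)"
    using member_le_sum[of z' "near (Suc n) \<zeta>" "\<lambda>z'. \<bar>U (z, n) - U (z', Suc n)\<bar> powr p"] z finite_near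
    by (simp add: abs_minus_commute)
  also have "\<dots> \<le> jump p U n \<zeta>"
    unfolding jump_def
    by (rule member_le_sum[of z "near n \<zeta>" "\<lambda>z. \<Sum>z'\<in>near (Suc n) \<zeta>. \<bar>U (z, n) - U (z', Suc n)\<bar> powr p"])
       (use z finite_near in \<open>auto intro: sum_nonneg\<close>)
  finally show "\<bar>U (z', Suc n) - U (z, n)\<bar> \<le> jump p U n \<zeta> powr (1/p)"
    using assms by (rule abs_le_powr_inverse)
qed (use finite_near near_nonempty in auto)

lemma jump_eq:
  "ennreal (jump p U n \<zeta>) = (\<Sum>z\<in>A n. \<Sum>z'\<in>A (Suc n). ennreal (\<bar>U (z, n) - U (z', Suc n)\<bar> powr p) *
     indicator (ball z (rad n) \<inter> ball z' (rad (Suc n))) \<zeta>)"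
proof -
  have near: "near n \<zeta> = {z \<in> A n. \<zeta> \<in> ball z (rad n)}" for n by (auto simp: near_def dist_commute)
  have "ennreal (jump p U n \<zeta>) = (\<Sum>z\<in>near n \<zeta>. \<Sum>z'\<in>near (Suc n) \<zeta>. ennreal (\<bar>U (z, n) - U (z', Suc n)\<bar> powr p))"
    by (simp add: jump_def sum_ennreal sum_nonneg)
  also have "\<dots> = (\<Sum>z\<in>A n. if \<zeta> \<in> ball z (rad n) then (\<Sum>z'\<in>A (Suc n). if \<zeta> \<in> ball z' (rad (Suc n)) then ennreal (\<bar>U (z, n) - U (z', Suc n)\<bar> powr p) else 0) else 0)"
    unfolding near by (simp only: sum.inter_filter[OF finite_net])
  also have "\<dots> = (\<Sum>z\<in>A n. \<Sum>z'\<in>A (Suc n). ennreal (\<bar>U (z, n) - U (z', Suc n)\<bar> powr p) *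
     indicator (ball z (rad n) \<inter> ball z' (rad (Suc n))) \<zeta>)"
    by (intro sum.cong refl) (auto simp: indicator_def intro!: sum.cong)
  finally show ?thesis .
qed

lemma jump_measurable [measurable]: "(\<lambda>\<zeta>. ennreal (jump p U n \<zeta>)) \<in> borel_measurable \<nu>"
  unfolding jump_eq by measurable

text \<open>A pair whose balls do not meet contributes nothing; if the balls meet, the vertices are
  joined by a vertical edge. The measure of the intersection is bounded by that of the ball of the
  vertex of level n.\<close>

lemma nn_integral_jump_le: "(\<integral>\<^sup>+ \<zeta>. ennreal (jump p U n \<zeta>) \<partial>\<nu>) \<le> ennreal (level_energy p U n)"
proof -
  let ?T = "\<lambda>z w. \<bar>U (z, n) - U w\<bar> powr p" and ?B = "\<lambda>z. ball z (rad n)" and ?B' = "\<lambda>z. ball z (rad (Suc n))"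
  have "(\<integral>\<^sup>+ \<zeta>. ennreal (jump p U n \<zeta>) \<partial>\<nu>) =
      (\<Sum>z\<in>A n. \<Sum>z'\<in>A (Suc n). ennreal (?T z (z', Suc n)) * emeasure \<nu> (?B z \<inter> ?B' z'))"
    unfolding jump_eq by (simp add: nn_integral_sum nn_integral_cmult)
  also have "\<dots> \<le> (\<Sum>z\<in>A n. \<Sum>z'\<in>A (Suc n). ennreal (if adj (z, n) (z', Suc n) then ?T z (z', Suc n) * measure \<nu> (?B z) else 0))"
  proof (intro sum_mono)
    fix z z' assume z: "z \<in> A n" "z' \<in> A (Suc n)"
    show "ennreal (?T z (z', Suc n)) * emeasure \<nu> (?B z \<inter> ?B' z') \<le> ennreal (if adj (z, n) (z', Suc n) then ?T z (z', Suc n) * measure \<nu> (?B z) else 0)"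
    proof (cases "adj (z, n) (z', Suc n)")
      case True
      have "emeasure \<nu> (?B z \<inter> ?B' z') \<le> emeasure \<nu> (?B z)" by (intro emeasure_mono) auto
      then have "ennreal (?T z (z', Suc n)) * emeasure \<nu> (?B z \<inter> ?B' z') \<le> ennreal (?T z (z', Suc n)) * emeasure \<nu> (?B z)"
        by (rule mult_left_mono) simp
      then show ?thesis using True by (simp add: nu.emeasure_eq_measure ennreal_mult)
    next
      case False
      then have "?B z \<inter> ?B' z' = {}" using adj_up[OF z] by auto
      then show ?thesis by simp
    qed
  qed
  also have "\<dots> = ennreal (\<Sum>z\<in>A n. \<Sum>z'\<in>A (Suc n). if adj (z, n) (z', Suc n) then ?T z (z', Suc n) * measure \<nu> (?B z) else 0)"
    by (simp add: sum_ennreal sum_nonneg)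
  also have "\<dots> \<le> ennreal (level_energy p U n)"
    unfolding level_energy_def
  proof (intro ennreal_leI sum_mono)
    fix z
    have "(\<Sum>z'\<in>A (Suc n). if adj (z, n) (z', Suc n) then ?T z (z', Suc n) * measure \<nu> (?B z) else 0) =
        (\<Sum>z'\<in>{z' \<in> A (Suc n). adj (z, n) (z', Suc n)}. ?T z (z', Suc n) * measure \<nu> (?B z))"
      by (simp add: sum.inter_filter[OF finite_net])
    also have "\<dots> = (\<Sum>w\<in>(\<lambda>z'. (z', Suc n)) ` {z' \<in> A (Suc n). adj (z, n) (z', Suc n)}. ?T z w * measure \<nu> (?B z))"
      by (subst sum.reindex) (auto simp: inj_on_def)
    also have "\<dots> \<le> (\<Sum>w | adj (z, n) w. ?T z w * measure \<nu> (?B z))"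
      by (intro sum_mono2 finite_neighbours) auto
    finally show "(\<Sum>z'\<in>A (Suc n). if adj (z, n) (z', Suc n) then ?T z (z', Suc n) * measure \<nu> (?B z) else 0) \<le>
        measure \<nu> (?B z) * (\<Sum>w | adj (z, n) w. ?T z w)"
      by (simp add: sum_distrib_left mult.commute)
  qed
  finally show ?thesis .
qed


text \<open>The weight \<alpha>^(k p \<theta> / 2) uses half of the exponent available in the
  energy: finiteness forces geometric decay of the increments, and the other half makes the sum over
  starting levels converge.\<close>

definition tail :: "real \<Rightarrow> real \<Rightarrow> ('z \<times> nat \<Rightarrow> real) \<Rightarrow> nat \<Rightarrow> 'z \<Rightarrow> ennreal" where
  "tail p \<theta> U n \<zeta> = (\<Sum>k. ennreal (\<alpha> powr (real k * (p * \<theta>) / 2)) * ennreal (jump p U (n + k) \<zeta>))"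

lemma tail_measurable [measurable]: "tail p \<theta> U n \<in> borel_measurable \<nu>"
  unfolding tail_def by measurable

text \<open>Terms are added and weights increased. Hence finiteness at level 0, true off one null
  set, gives finiteness at all levels at once.\<close>

lemma tail_le_tail_0:
  assumes "p > 0" "\<theta> > 0" shows "tail p \<theta> U n \<zeta> \<le> tail p \<theta> U 0 \<zeta>"
proof -
  let ?f = "\<lambda>k. ennreal (\<alpha> powr (real k * (p * \<theta>) / 2)) * ennreal (jump p U k \<zeta>)"
  have "tail p \<theta> U n \<zeta> \<le> (\<Sum>k. ?f (k + n))"
    unfolding tail_def
  proof (rule suminf_le)
    fix k
    show "ennreal (\<alpha> powr (real k * (p * \<theta>) / 2)) * ennreal (jump p U (n + k) \<zeta>) \<le> ?f (k + n)"
      unfolding add.commute[of n k] using alpha assms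
      by (intro mult_right_mono ennreal_leI powr_mono divide_right_mono mult_right_mono) auto
  qed auto
  also have "\<dots> \<le> tail p \<theta> U 0 \<zeta>"
    using ennreal_suminf_shift_le[of ?f n] by (simp add: tail_def)
  finally show ?thesis .
qed

text \<open>Each term of the tail is at most its value \<rho>, so the increment at level n + k is at
  most \<rho>^(1/p) q^k with q = \<alpha>^(-\<theta>/2), and the telescoping sum is
  geometric.\<close>

lemma trace_limit:
  assumes p: "p \<ge> 1" and \<theta>: "\<theta> > 0" and fin: "tail p \<theta> U n \<zeta> < top"
  shows "(\<lambda>n. average U n \<zeta>) \<longlonglongrightarrow> trace U \<zeta>"
    "ennreal (\<bar>trace U \<zeta> - average U n \<zeta>\<bar> powr p) \<le> ennreal ((1 / (1 - \<alpha> powr (- \<theta> / 2))) powr p) * tail p \<theta> U n \<zeta>"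
proof -
  obtain \<rho> where \<rho>: "tail p \<theta> U n \<zeta> = ennreal \<rho>" "\<rho> \<ge> 0" using fin by (cases "tail p \<theta> U n \<zeta>") auto
  define q where "q = \<alpha> powr (- \<theta> / 2)"
  have q: "0 < q" "q < 1" using alpha \<theta> powr_less_mono[of "- \<theta> / 2" 0 \<alpha>] by (auto simp: q_def)
  define c where "c = \<rho> powr (1/p)"
  have step: "\<bar>average U (Suc k + n) \<zeta> - average U (k + n) \<zeta>\<bar> \<le> c * q ^ k" for k
  proof -
    let ?e = "real k * (p * \<theta>) / 2"
    have "ennreal (\<alpha> powr ?e) * ennreal (jump p U (n + k) \<zeta>) \<le> tail p \<theta> U n \<zeta>"
      unfolding tail_def
      using sum_le_suminf[of "\<lambda>k. ennreal (\<alpha> powr (real k * (p * \<theta>) / 2)) * ennreal (jump p U (n + k) \<zeta>)" "{k}"]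
      by simp
    then have "\<alpha> powr ?e * jump p U (n + k) \<zeta> \<le> \<rho>"
      using \<rho> by (simp add: ennreal_mult[symmetric] jump_nonneg)
    then have "jump p U (n + k) \<zeta> \<le> \<rho> * \<alpha> powr (- ?e)"
      using alpha by (simp add: powr_minus field_simps)
    then have "jump p U (n + k) \<zeta> powr (1/p) \<le> (\<rho> * \<alpha> powr (- ?e)) powr (1/p)"
      using p jump_nonneg by (intro powr_mono2) auto
    also have "\<dots> = c * \<alpha> powr (- ?e * (1/p))" by (simp only: powr_mult powr_powr c_def)
    also have "- ?e * (1/p) = (- \<theta> / 2) * real k" using p by simp
    also have "\<alpha> powr ((- \<theta> / 2) * real k) = q ^ k"
      using q by (simp only: powr_powr[symmetric] q_def[symmetric] powr_realpow)
    finally show ?thesis using average_step_le[of p U "n + k" \<zeta>] p by (simp add: add.commute)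
  qed
  note lim = geometric_increments_limit[of "\<lambda>k. average U (k + n) \<zeta>", OF step less_imp_le[OF q(1)] q(2)]
  have "(\<lambda>n. average U n \<zeta>) \<longlonglongrightarrow> lim (\<lambda>k. average U (k + n) \<zeta>)"
    using lim(1) by (rule LIMSEQ_offset)
  moreover from limI[OF this] have tr: "trace U \<zeta> = lim (\<lambda>k. average U (k + n) \<zeta>)" by (simp add: trace_def)
  ultimately show "(\<lambda>n. average U n \<zeta>) \<longlonglongrightarrow> trace U \<zeta>" by simp
  have "\<bar>trace U \<zeta> - average U n \<zeta>\<bar> \<le> c * (1 / (1 - q))" using lim(2) tr by simp
  then have "\<bar>trace U \<zeta> - average U n \<zeta>\<bar> powr p \<le> (c * (1 / (1 - q))) powr p" using p by (intro powr_mono2) auto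
  also have "\<dots> = \<rho> * (1 / (1 - q)) powr p"
    using \<rho>(2) p by (simp only: powr_mult) (simp add: c_def powr_powr)
  finally show "ennreal (\<bar>trace U \<zeta> - average U n \<zeta>\<bar> powr p) \<le> ennreal ((1 / (1 - \<alpha> powr (- \<theta> / 2))) powr p) * tail p \<theta> U n \<zeta>"
    unfolding \<rho>(1) q_def[symmetric] using \<rho>(2) by (simp add: ennreal_mult[symmetric] ennreal_leI mult.commute)
qed

text \<open>The size of d^(-p \<theta>) at the scale d = \<alpha>^-n.\<close>

definition weight :: "real \<Rightarrow> real \<Rightarrow> nat \<Rightarrow> real" where
  "weight p \<theta> n = \<alpha> powr (real n * (p * \<theta>))"

lemma weight_pos: "weight p \<theta> n > 0"
  using alpha by (simp add: weight_def)

definition energy :: "real \<Rightarrow> real \<Rightarrow> ('z \<times> nat \<Rightarrow> real) \<Rightarrow> ennreal" where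
  "energy p \<theta> U = (\<Sum>n. ennreal (weight p \<theta> n * level_energy p U n))"

text \<open>The weight at n times \<alpha>^(k p \<theta> / 2) is q^k times the weight at n + k,
  where q = \<alpha>^(-p \<theta> / 2). After the sums are interchanged, the sum over n is at most
  the energy and the sum over k is geometric.\<close>

lemma sum_tail_le:
  assumes p: "p \<ge> 1" and \<theta>: "\<theta> > 0"
  shows "(\<Sum>n. ennreal (weight p \<theta> n) * (\<integral>\<^sup>+ \<zeta>. tail p \<theta> U n \<zeta> \<partial>\<nu>))
    \<le> ennreal (1 / (1 - \<alpha> powr (- (p * \<theta>) / 2))) * energy p \<theta> U"
proof -
  define q where "q = \<alpha> powr (- (p * \<theta>) / 2)"
  have q: "0 < q" "q < 1" using alpha \<theta> p powr_less_mono[of "- (p * \<theta>) / 2" 0 \<alpha>] by (auto simp: q_def)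
  let ?f = "\<lambda>n. ennreal (weight p \<theta> n * level_energy p U n)"
  have level: "ennreal (weight p \<theta> n) * (ennreal (\<alpha> powr (real k * (p * \<theta>) / 2)) * (\<integral>\<^sup>+ \<zeta>. ennreal (jump p U (n + k) \<zeta>) \<partial>\<nu>))
      \<le> ennreal (q ^ k) * ?f (n + k)" for n k
  proof -
    have eq: "weight p \<theta> n * \<alpha> powr (real k * (p * \<theta>) / 2) = q ^ k * weight p \<theta> (n + k)"
    proof -
      have "q ^ k = \<alpha> powr ((- (p * \<theta>) / 2) * real k)"
        using q by (simp only: powr_powr[symmetric] q_def[symmetric] powr_realpow)
      then show ?thesis by (simp add: weight_def powr_add[symmetric] algebra_simps)
    qed
    have "ennreal (weight p \<theta> n) * (ennreal (\<alpha> powr (real k * (p * \<theta>) / 2)) * (\<integral>\<^sup>+ \<zeta>. ennreal (jump p U (n + k) \<zeta>) \<partial>\<nu>))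
        \<le> ennreal (weight p \<theta> n) * (ennreal (\<alpha> powr (real k * (p * \<theta>) / 2)) * ennreal (level_energy p U (n + k)))"
      by (intro mult_left_mono nn_integral_jump_le) auto
    also have "\<dots> = ennreal ((weight p \<theta> n * \<alpha> powr (real k * (p * \<theta>) / 2)) * level_energy p U (n + k))"
      using weight_pos[of p \<theta> n] by (simp add: ennreal_mult[symmetric] level_energy_nonneg mult.assoc)
    also have "\<dots> = ennreal (q ^ k) * ?f (n + k)"
      unfolding eq using q weight_pos[of p \<theta> "n + k"]
      by (simp add: ennreal_mult[symmetric] level_energy_nonneg mult.assoc less_imp_le)
    finally show ?thesis .
  qed
  have "(\<Sum>n. ennreal (weight p \<theta> n) * (\<integral>\<^sup>+ \<zeta>. tail p \<theta> U n \<zeta> \<partial>\<nu>)) =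
      (\<Sum>n. \<Sum>k. ennreal (weight p \<theta> n) * (ennreal (\<alpha> powr (real k * (p * \<theta>) / 2)) * (\<integral>\<^sup>+ \<zeta>. ennreal (jump p U (n + k) \<zeta>) \<partial>\<nu>)))"
    by (simp add: tail_def nn_integral_suminf nn_integral_cmult)
  also have "\<dots> \<le> (\<Sum>n. \<Sum>k. ennreal (q ^ k) * ?f (n + k))"
    by (intro suminf_le level) auto
  also have "\<dots> = (\<Sum>k. \<Sum>n. ennreal (q ^ k) * ?f (n + k))" by (rule ennreal_suminf_swap)
  also have "\<dots> = (\<Sum>k. ennreal (q ^ k) * (\<Sum>n. ?f (n + k)))" by (simp only: ennreal_suminf_cmult)
  also have "\<dots> \<le> (\<Sum>k. ennreal (q ^ k) * energy p \<theta> U)"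
  proof (rule suminf_le)
    fix k
    show "ennreal (q ^ k) * (\<Sum>n. ?f (n + k)) \<le> ennreal (q ^ k) * energy p \<theta> U"
      unfolding energy_def by (rule mult_left_mono[OF ennreal_suminf_shift_le[of ?f]]) simp
  qed auto
  also have "\<dots> = ennreal (1 / (1 - q)) * energy p \<theta> U"
    unfolding ennreal_suminf_multc ennreal_suminf_geometric[OF less_imp_le[OF q(1)] q(2)] ..
  finally show ?thesis unfolding q_def .
qed

lemma nn_integral_tail_0_le:
  assumes p: "p \<ge> 1" and \<theta>: "\<theta> > 0"
  shows "(\<integral>\<^sup>+ \<zeta>. tail p \<theta> U 0 \<zeta> \<partial>\<nu>) \<le> ennreal (1 / (1 - \<alpha> powr (- (p * \<theta>) / 2))) * energy p \<theta> U"
proof -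
  have "(\<integral>\<^sup>+ \<zeta>. tail p \<theta> U 0 \<zeta> \<partial>\<nu>) = (\<Sum>n\<in>{0}. ennreal (weight p \<theta> n) * (\<integral>\<^sup>+ \<zeta>. tail p \<theta> U n \<zeta> \<partial>\<nu>))"
    using alpha by (simp add: weight_def)
  also have "\<dots> \<le> (\<Sum>n. ennreal (weight p \<theta> n) * (\<integral>\<^sup>+ \<zeta>. tail p \<theta> U n \<zeta> \<partial>\<nu>))"
    by (rule sum_le_suminf) auto
  finally show ?thesis using sum_tail_le[OF assms] by (rule order_trans)
qed

lemma AE_tail_finite:
  assumes "p \<ge> 1" "\<theta> > 0" "energy p \<theta> U < top"
  shows "AE \<zeta> in \<nu>. tail p \<theta> U 0 \<zeta> < top"
proof -
  have "(\<integral>\<^sup>+ \<zeta>. tail p \<theta> U 0 \<zeta> \<partial>\<nu>) < top"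
    by (rule le_less_trans[OF nn_integral_tail_0_le[OF assms(1,2)]]) (use assms(3) in \<open>simp add: ennreal_mult_less_top\<close>)
  then have "AE \<zeta> in \<nu>. tail p \<theta> U 0 \<zeta> \<noteq> \<infinity>"
    by (intro nn_integral_noteq_infinite) auto
  then show ?thesis by (simp add: less_top)
qed

lemma average_0: "average U 0 \<zeta> = U (z0, 0)"
  by (simp add: average_def near_0)

text \<open>At level 0 the average is the constant \<open>U (z0, 0)\<close> and \<nu> is finite, so
  only the integral of the tail at level 0 remains to be bounded.\<close>

lemma trace_Lp_le:
  assumes p: "p \<ge> 1" and \<theta>: "\<theta> > 0"
  shows "\<exists>C>0. \<forall>U. energy p \<theta> U < top \<longrightarrow>
    (\<integral>\<^sup>+ \<zeta>. ennreal (\<bar>trace U \<zeta>\<bar> powr p) \<partial>\<nu>) \<le> ennreal C * (ennreal (\<bar>U (z0, 0)\<bar> powr p) + energy p \<theta> U)"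
proof -
  define K where "K = (1 / (1 - \<alpha> powr (- \<theta> / 2))) powr p"
  define W where "W = 1 / (1 - \<alpha> powr (- (p * \<theta>) / 2))"
  have W: "W > 0" using alpha \<theta> p powr_less_mono[of "- (p * \<theta>) / 2" 0 \<alpha>] by (auto simp: W_def)
  define C where "C = 3 powr p * (measure \<nu> UNIV + K * W + 1)"
  have K: "K \<ge> 0" by (simp add: K_def)
  have "(\<integral>\<^sup>+ \<zeta>. ennreal (\<bar>trace U \<zeta>\<bar> powr p) \<partial>\<nu>) \<le> ennreal C * (ennreal (\<bar>U (z0, 0)\<bar> powr p) + energy p \<theta> U)"
    if fin: "energy p \<theta> U < top" for U
  proof -
    let ?u = "\<bar>U (z0, 0)\<bar> powr p"
    have "AE \<zeta> in \<nu>. ennreal (\<bar>trace U \<zeta>\<bar> powr p) \<le> ennreal (3 powr p) * (ennreal ?u + ennreal K * tail p \<theta> U 0 \<zeta>)"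
      using AE_tail_finite[OF p \<theta> fin]
    proof eventually_elim
      case (elim \<zeta>)
      let ?d = "\<bar>trace U \<zeta> - average U 0 \<zeta>\<bar>"
      have "\<bar>trace U \<zeta>\<bar> powr p \<le> (\<bar>U (z0, 0)\<bar> + ?d + 0) powr p"
        using p by (intro powr_mono2) (auto simp: average_0)
      also have "\<dots> \<le> 3 powr p * (?u + ?d powr p + 0 powr p)" using p by (intro powr_sum3_le) auto
      finally have "ennreal (\<bar>trace U \<zeta>\<bar> powr p) \<le> ennreal (3 powr p * (?u + ?d powr p))" by (intro ennreal_leI) simp
      also have "\<dots> = ennreal (3 powr p) * (ennreal ?u + ennreal (?d powr p))"
        by (simp add: ennreal_mult[symmetric] ennreal_plus[symmetric] del: ennreal_plus)
      also have "\<dots> \<le> ennreal (3 powr p) * (ennreal ?u + ennreal K * tail p \<theta> U 0 \<zeta>)"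
        using trace_limit(2)[OF p \<theta> elim] unfolding K_def by (intro mult_left_mono add_left_mono) auto
      finally show ?case .
    qed
    then have "(\<integral>\<^sup>+ \<zeta>. ennreal (\<bar>trace U \<zeta>\<bar> powr p) \<partial>\<nu>) \<le>
        (\<integral>\<^sup>+ \<zeta>. ennreal (3 powr p) * (ennreal ?u + ennreal K * tail p \<theta> U 0 \<zeta>) \<partial>\<nu>)"
      by (rule nn_integral_mono_AE)
    also have "\<dots> = ennreal (3 powr p) * (ennreal ?u * ennreal (measure \<nu> UNIV) + ennreal K * (\<integral>\<^sup>+ \<zeta>. tail p \<theta> U 0 \<zeta> \<partial>\<nu>))"
      using nu.emeasure_eq_measure[of UNIV] by (simp add: nn_integral_cmult nn_integral_add)
    also have "\<dots> \<le> ennreal (3 powr p) * (ennreal ?u * ennreal (measure \<nu> UNIV) + ennreal K * (ennreal W * energy p \<theta> U))"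
      unfolding W_def by (intro mult_left_mono add_left_mono nn_integral_tail_0_le p \<theta>) auto
    also have "\<dots> \<le> ennreal (3 powr p) * (ennreal (measure \<nu> UNIV + K * W + 1) * (ennreal ?u + energy p \<theta> U))"
    proof (rule mult_left_mono)
      have "ennreal K * (ennreal W * energy p \<theta> U) = ennreal (K * W) * energy p \<theta> U"
        using K W by (simp add: ennreal_mult mult.assoc)
      moreover have "ennreal (K * W) * energy p \<theta> U \<le> ennreal (measure \<nu> UNIV + K * W + 1) * energy p \<theta> U"
        by (intro mult_right_mono ennreal_leI) auto
      moreover have "ennreal ?u * ennreal (measure \<nu> UNIV) \<le> ennreal (measure \<nu> UNIV + K * W + 1) * ennreal ?u"
        unfolding mult.commute[of "ennreal ?u"] using K W by (intro mult_right_mono ennreal_leI) auto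
      ultimately show "ennreal ?u * ennreal (measure \<nu> UNIV) + ennreal K * (ennreal W * energy p \<theta> U)
          \<le> ennreal (measure \<nu> UNIV + K * W + 1) * (ennreal ?u + energy p \<theta> U)"
        unfolding distrib_left by (metis add_mono)
    qed simp
    also have "\<dots> = ennreal C * (ennreal ?u + energy p \<theta> U)"
      unfolding C_def using K W by (subst ennreal_mult) (auto simp: mult.assoc intro!: add_nonneg_nonneg)
    finally show ?thesis .
  qed
  moreover have "C > 0" unfolding C_def using K W by (intro mult_pos_pos add_nonneg_pos) auto
  ultimately show ?thesis by blast
qed


text \<open>A bound for the part of the Besov kernel where \<open>d(\<zeta>, \<xi>)\<close> is comparable to \<open>\<alpha>\<^bsup>-n\<^esup>\<close>. It is a
  sum of products of functions of one variable, so that no measurability on the product space is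
  needed to integrate it.\<close>

definition kernel_bound :: "real \<Rightarrow> real \<Rightarrow> ('z \<times> nat \<Rightarrow> real) \<Rightarrow> nat \<Rightarrow> 'z \<Rightarrow> 'z \<Rightarrow> ennreal" where
  "kernel_bound p \<theta> U n \<zeta> \<xi> = ennreal (weight p \<theta> n) *
     ((\<Sum>z\<in>A n. ennreal (1 / measure \<nu> (ball z (rad n))) * indicator (ball z (rad n)) \<zeta> *
         (indicator (ball z ((\<tau> + 1) * rad n)) \<xi> * (tail p \<theta> U n \<zeta> + tail p \<theta> U n \<xi>))) +
      (\<Sum>z\<in>A n. \<Sum>z'\<in>A n. if adj (z, n) (z', n)
         then ennreal (\<bar>U (z, n) - U (z', n)\<bar> powr p / measure \<nu> (ball z (rad n))) *
           indicator (ball z (rad n)) \<zeta> * indicator (ball z' (rad n)) \<xi> else 0))"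

lemma kernel_bound_measurable [measurable]: "kernel_bound p \<theta> U n \<zeta> \<in> borel_measurable \<nu>"
  unfolding kernel_bound_def by measurable

text \<open>The integral in \<xi> is carried out term by term. The explicit result also shows that
  the inner integral is measurable in \<zeta>, which the outer integration relies on.\<close>

lemma nn_integral_kernel_bound_inner:
  "(\<integral>\<^sup>+ \<xi>. kernel_bound p \<theta> U n \<zeta> \<xi> \<partial>\<nu>) = ennreal (weight p \<theta> n) *
     ((\<Sum>z\<in>A n. ennreal (1 / measure \<nu> (ball z (rad n))) * indicator (ball z (rad n)) \<zeta> *
         (tail p \<theta> U n \<zeta> * emeasure \<nu> (ball z ((\<tau> + 1) * rad n)) +
          (\<integral>\<^sup>+ \<xi>. indicator (ball z ((\<tau> + 1) * rad n)) \<xi> * tail p \<theta> U n \<xi> \<partial>\<nu>))) +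
      (\<Sum>z\<in>A n. \<Sum>z'\<in>A n. if adj (z, n) (z', n)
         then ennreal (\<bar>U (z, n) - U (z', n)\<bar> powr p / measure \<nu> (ball z (rad n))) *
           indicator (ball z (rad n)) \<zeta> * emeasure \<nu> (ball z' (rad n)) else 0))"
proof -
  have 1: "(\<integral>\<^sup>+ \<xi>. ennreal (1 / measure \<nu> (ball z (rad n))) * indicator (ball z (rad n)) \<zeta> *
         (indicator (ball z ((\<tau> + 1) * rad n)) \<xi> * (tail p \<theta> U n \<zeta> + tail p \<theta> U n \<xi>)) \<partial>\<nu>) =
      ennreal (1 / measure \<nu> (ball z (rad n))) * indicator (ball z (rad n)) \<zeta> *
         (tail p \<theta> U n \<zeta> * emeasure \<nu> (ball z ((\<tau> + 1) * rad n)) +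
          (\<integral>\<^sup>+ \<xi>. indicator (ball z ((\<tau> + 1) * rad n)) \<xi> * tail p \<theta> U n \<xi> \<partial>\<nu>))" for z
    by (simp add: nn_integral_cmult nn_integral_add distrib_left mult.commute[of "indicator _ _" "tail p \<theta> U n \<zeta>"])
  have 2: "(\<integral>\<^sup>+ \<xi>. (if adj (z, n) (z', n) then ennreal (\<bar>U (z, n) - U (z', n)\<bar> powr p / measure \<nu> (ball z (rad n))) *
           indicator (ball z (rad n)) \<zeta> * indicator (ball z' (rad n)) \<xi> else 0) \<partial>\<nu>) =
      (if adj (z, n) (z', n) then ennreal (\<bar>U (z, n) - U (z', n)\<bar> powr p / measure \<nu> (ball z (rad n))) *
           indicator (ball z (rad n)) \<zeta> * emeasure \<nu> (ball z' (rad n)) else 0)" for z z'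
    by (simp add: nn_integral_cmult)
  define f where "f z \<xi> = ennreal (1 / measure \<nu> (ball z (rad n))) * indicator (ball z (rad n)) \<zeta> *
         (indicator (ball z ((\<tau> + 1) * rad n)) \<xi> * (tail p \<theta> U n \<zeta> + tail p \<theta> U n \<xi>))" for z \<xi>
  define g where "g z z' \<xi> = (if adj (z, n) (z', n) then ennreal (\<bar>U (z, n) - U (z', n)\<bar> powr p / measure \<nu> (ball z (rad n))) *
           indicator (ball z (rad n)) \<zeta> * indicator (ball z' (rad n)) \<xi> else 0)" for z z' \<xi>
  have [measurable]: "f z \<in> borel_measurable \<nu>" "g z z' \<in> borel_measurable \<nu>" for z z'
    unfolding f_def g_def by measurable
  have "(\<integral>\<^sup>+ \<xi>. kernel_bound p \<theta> U n \<zeta> \<xi> \<partial>\<nu>) =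
      (\<integral>\<^sup>+ \<xi>. ennreal (weight p \<theta> n) * ((\<Sum>z\<in>A n. f z \<xi>) + (\<Sum>z\<in>A n. \<Sum>z'\<in>A n. g z z' \<xi>)) \<partial>\<nu>)"
    unfolding kernel_bound_def f_def g_def ..
  also have "\<dots> = ennreal (weight p \<theta> n) * ((\<Sum>z\<in>A n. \<integral>\<^sup>+ \<xi>. f z \<xi> \<partial>\<nu>) + (\<Sum>z\<in>A n. \<Sum>z'\<in>A n. \<integral>\<^sup>+ \<xi>. g z z' \<xi> \<partial>\<nu>))"
    by (simp add: nn_integral_cmult nn_integral_add nn_integral_sum)
  finally show ?thesis unfolding f_def g_def 1 2 .
qed

text \<open>Tail part: integration over the ball of z cancels the factor 1/\<nu>(B), doubling
  compares the ball enlarged by \<tau> + 1 with B, and bounded overlap of the enlarged balls adds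
  the local integrals up to a multiple of the full one. Edge part: the same cancellation leaves
  horizontal terms of the level energy.\<close>

lemma nn_integral_kernel_bound_le:
  "\<exists>D>0. \<forall>p \<theta> U n. (\<integral>\<^sup>+ \<zeta>. (\<integral>\<^sup>+ \<xi>. kernel_bound p \<theta> U n \<zeta> \<xi> \<partial>\<nu>) \<partial>\<nu>)
     \<le> ennreal (weight p \<theta> n) * (ennreal D * (\<integral>\<^sup>+ \<zeta>. tail p \<theta> U n \<zeta> \<partial>\<nu>) + ennreal (level_energy p U n))"
proof -
  have \<tau>1: "\<tau> + 1 > 0" using tau by simp
  obtain C where C: "C > 0" "\<And>x r. r > 0 \<Longrightarrow> measure \<nu> (ball x ((\<tau> + 1) * r)) \<le> C * measure \<nu> (ball x r)"
    using doubling_scale[OF \<tau>1] by blast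
  obtain N where N: "\<And>n \<xi>. card {z \<in> A n. dist z \<xi> < (\<tau> + 1) * rad n} \<le> (N::nat)"
    using overlap_bound[OF \<tau>1] by blast
  \<comment> \<open>\<open>C + 1\<close> collects the contributions of the tails at \<zeta> and at
    \<xi>; the 1 added to the overlap bound N keeps D positive.\<close>
  define D where "D = (C + 1) * (real N + 1)"
  have "(\<integral>\<^sup>+ \<zeta>. (\<integral>\<^sup>+ \<xi>. kernel_bound p \<theta> U n \<zeta> \<xi> \<partial>\<nu>) \<partial>\<nu>)
     \<le> ennreal (weight p \<theta> n) * (ennreal D * (\<integral>\<^sup>+ \<zeta>. tail p \<theta> U n \<zeta> \<partial>\<nu>) + ennreal (level_energy p U n))" for p \<theta> U n
  proof -
    define B B' m where "B z = ball z (rad n)" and "B' z = ball z ((\<tau> + 1) * rad n)" and "m z = measure \<nu> (B z)" for z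
    let ?R = "tail p \<theta> U n" and ?T = "\<lambda>z z'. \<bar>U (z, n) - U (z', n)\<bar> powr p"
    have m: "m z > 0" for z unfolding m_def B_def using measure_ball_pos[OF rad_pos] .
    have [measurable]: "B z \<in> sets \<nu>" "B' z \<in> sets \<nu>" for z by (auto simp: B_def B'_def)
    define I where "I z = (\<integral>\<^sup>+ \<xi>. indicator (B' z) \<xi> * ?R \<xi> \<partial>\<nu>)" for z
    define J where "J z = (\<integral>\<^sup>+ \<xi>. indicator (B z) \<xi> * ?R \<xi> \<partial>\<nu>)" for z
    have sub: "B z \<subseteq> B' z" for z
      using rad_pos[of n] tau unfolding B_def B'_def by (intro subset_ball) (simp add: field_simps)
    have JI: "J z \<le> I z" for z
      unfolding I_def J_def using sub[of z] by (intro nn_integral_mono mult_right_mono) (auto simp: indicator_def)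
    have t1: "(\<integral>\<^sup>+ \<zeta>. ennreal (1 / m z) * indicator (B z) \<zeta> * (?R \<zeta> * emeasure \<nu> (B' z) + I z) \<partial>\<nu>) \<le> ennreal (C + 1) * I z" for z
    proof -
      have "(\<integral>\<^sup>+ \<zeta>. ennreal (1 / m z) * indicator (B z) \<zeta> * (?R \<zeta> * emeasure \<nu> (B' z) + I z) \<partial>\<nu>) =
          (\<integral>\<^sup>+ \<zeta>. ennreal (1 / m z) * emeasure \<nu> (B' z) * (indicator (B z) \<zeta> * ?R \<zeta>) + ennreal (1 / m z) * I z * indicator (B z) \<zeta> \<partial>\<nu>)"
      proof (rule nn_integral_cong)
        fix \<zeta>
        show "ennreal (1 / m z) * indicator (B z) \<zeta> * (?R \<zeta> * emeasure \<nu> (B' z) + I z) =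
          ennreal (1 / m z) * emeasure \<nu> (B' z) * (indicator (B z) \<zeta> * ?R \<zeta>) + ennreal (1 / m z) * I z * indicator (B z) \<zeta>"
          by (simp only: distrib_left mult_ac)
      qed
      also have "\<dots> = ennreal (1 / m z) * emeasure \<nu> (B' z) * J z + ennreal (1 / m z) * I z * emeasure \<nu> (B z)"
        by (simp add: nn_integral_add nn_integral_cmult J_def)
      also have "ennreal (1 / m z) * I z * emeasure \<nu> (B z) = I z"
      proof -
        have "ennreal (1 / m z) * emeasure \<nu> (B z) = 1"
          using m[of z] by (simp add: nu.emeasure_eq_measure m_def[symmetric] ennreal_mult[symmetric])
        moreover have "ennreal (1 / m z) * I z * emeasure \<nu> (B z) = (ennreal (1 / m z) * emeasure \<nu> (B z)) * I z"
          by (simp only: mult_ac)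
        ultimately show ?thesis by simp
      qed
      also have "ennreal (1 / m z) * emeasure \<nu> (B' z) * J z \<le> ennreal C * I z"
      proof (intro mult_mono JI)
        have "1 / m z * measure \<nu> (B' z) \<le> C" using C(2)[OF rad_pos, of z n] m[of z]
          unfolding B_def[symmetric] B'_def[symmetric] m_def[symmetric] by (simp add: field_simps)
        then show "ennreal (1 / m z) * emeasure \<nu> (B' z) \<le> ennreal C"
          using m[of z] by (simp add: nu.emeasure_eq_measure ennreal_mult[symmetric] ennreal_leI)
      qed auto
      also have "ennreal C * I z + I z = ennreal (C + 1) * I z" using C(1) by (simp add: distrib_right)
      finally show ?thesis by (simp add: add_right_mono)
    qed
    have sumI: "(\<Sum>z\<in>A n. I z) \<le> ennreal (real N) * (\<integral>\<^sup>+ \<zeta>. ?R \<zeta> \<partial>\<nu>)"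
    proof -
      have "(\<Sum>z\<in>A n. I z) = (\<integral>\<^sup>+ \<xi>. (\<Sum>z\<in>A n. indicator (B' z) \<xi>) * ?R \<xi> \<partial>\<nu>)"
        unfolding I_def sum_distrib_right by (subst nn_integral_sum) auto
      also have "\<dots> \<le> (\<integral>\<^sup>+ \<xi>. ennreal (real N) * ?R \<xi> \<partial>\<nu>)"
      proof (intro nn_integral_mono mult_right_mono)
        fix \<xi>
        have "(\<Sum>z\<in>A n. indicator (B' z) \<xi> :: ennreal) = (\<Sum>z\<in>A n. if dist z \<xi> < (\<tau> + 1) * rad n then 1 else 0)"
          unfolding B'_def by (intro sum.cong refl) (simp add: indicator_def)
        also have "\<dots> = (\<Sum>z\<in>{z \<in> A n. dist z \<xi> < (\<tau> + 1) * rad n}. 1)"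
          by (rule sum.inter_filter[OF finite_net, symmetric])
        also have "\<dots> = of_nat (card {z \<in> A n. dist z \<xi> < (\<tau> + 1) * rad n})" by simp
        also have "\<dots> \<le> ennreal (real N)" using N[of n \<xi>] by (simp add: ennreal_of_nat_eq_real_of_nat)
        finally show "(\<Sum>z\<in>A n. indicator (B' z) \<xi> :: ennreal) \<le> ennreal (real N)" .
      qed auto
      also have "\<dots> = ennreal (real N) * (\<integral>\<^sup>+ \<xi>. ?R \<xi> \<partial>\<nu>)" by (simp add: nn_integral_cmult)
      finally show ?thesis .
    qed
    have t2: "(\<Sum>z\<in>A n. \<Sum>z'\<in>A n. \<integral>\<^sup>+ \<zeta>. (if adj (z, n) (z', n) then ennreal (?T z z' / m z) * indicator (B z) \<zeta> * emeasure \<nu> (B z') else 0) \<partial>\<nu>)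
        \<le> ennreal (level_energy p U n)"
    proof -
      have "(\<integral>\<^sup>+ \<zeta>. (if adj (z, n) (z', n) then ennreal (?T z z' / m z) * indicator (B z) \<zeta> * emeasure \<nu> (B z') else 0) \<partial>\<nu>) =
          ennreal (if adj (z, n) (z', n) then ?T z z' * m z' else 0)" for z z'
      proof -
        have "(\<integral>\<^sup>+ \<zeta>. ennreal (?T z z' / m z) * indicator (B z) \<zeta> * emeasure \<nu> (B z') \<partial>\<nu>) = ennreal (?T z z' / m z) * emeasure \<nu> (B z) * emeasure \<nu> (B z')"
          by (subst nn_integral_multc) (auto simp: nn_integral_cmult)
        also have "\<dots> = ennreal (?T z z' / m z * m z * m z')"
          using m[of z] m[of z'] by (simp add: nu.emeasure_eq_measure m_def[symmetric] ennreal_mult[symmetric])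
        finally show ?thesis using m[of z] by simp
      qed
      then have "(\<Sum>z\<in>A n. \<Sum>z'\<in>A n. \<integral>\<^sup>+ \<zeta>. (if adj (z, n) (z', n) then ennreal (?T z z' / m z) * indicator (B z) \<zeta> * emeasure \<nu> (B z') else 0) \<partial>\<nu>)
          = ennreal (\<Sum>z\<in>A n. \<Sum>z'\<in>A n. if adj (z, n) (z', n) then ?T z z' * m z' else 0)"
        using less_imp_le[OF m] by (simp add: sum_ennreal sum_nonneg)
      \<comment> \<open>The remaining factor is the measure of the ball of z', so z and z' exchange
        roles, by symmetry of adjacency, to match \<open>level_energy\<close>.\<close>
      also have "(\<Sum>z\<in>A n. \<Sum>z'\<in>A n. if adj (z, n) (z', n) then ?T z z' * m z' else 0) = (\<Sum>z'\<in>A n. \<Sum>z\<in>A n. if adj (z, n) (z', n) then ?T z z' * m z' else 0)"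
        by (rule sum.swap)
      also have "ennreal \<dots> \<le> ennreal (level_energy p U n)"
        unfolding level_energy_def B_def[symmetric] m_def[symmetric]
      proof (intro ennreal_leI sum_mono)
        fix z'
        have "(\<Sum>z\<in>A n. if adj (z, n) (z', n) then ?T z z' * m z' else 0) =
            (\<Sum>z\<in>{z \<in> A n. adj (z', n) (z, n)}. \<bar>U (z', n) - U (z, n)\<bar> powr p * m z')"
          unfolding sum.inter_filter[OF finite_net]
          by (intro sum.cong refl) (auto simp: abs_minus_commute dest: adj_sym)
        also have "\<dots> = (\<Sum>w\<in>(\<lambda>z. (z, n)) ` {z \<in> A n. adj (z', n) (z, n)}. \<bar>U (z', n) - U w\<bar> powr p * m z')"
          by (subst sum.reindex) (auto simp: inj_on_def)
        also have "\<dots> \<le> (\<Sum>w | adj (z', n) w. \<bar>U (z', n) - U w\<bar> powr p * m z')"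
          using less_imp_le[OF m] by (intro sum_mono2 finite_neighbours) auto
        finally show "(\<Sum>z\<in>A n. if adj (z, n) (z', n) then ?T z z' * m z' else 0) \<le> m z' * (\<Sum>w | adj (z', n) w. \<bar>U (z', n) - U w\<bar> powr p)"
          by (simp add: sum_distrib_left mult.commute)
      qed
      finally show ?thesis .
    qed
    define f where "f z \<zeta> = ennreal (1 / m z) * indicator (B z) \<zeta> * (?R \<zeta> * emeasure \<nu> (B' z) + I z)" for z \<zeta>
    define g where "g z z' \<zeta> = (if adj (z, n) (z', n) then ennreal (?T z z' / m z) * indicator (B z) \<zeta> * emeasure \<nu> (B z') else 0)" for z z' \<zeta>
    have [measurable]: "f z \<in> borel_measurable \<nu>" "g z z' \<in> borel_measurable \<nu>" for z z'
      unfolding f_def g_def by measurable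
    have "(\<integral>\<^sup>+ \<zeta>. (\<integral>\<^sup>+ \<xi>. kernel_bound p \<theta> U n \<zeta> \<xi> \<partial>\<nu>) \<partial>\<nu>) =
        (\<integral>\<^sup>+ \<zeta>. ennreal (weight p \<theta> n) * ((\<Sum>z\<in>A n. f z \<zeta>) + (\<Sum>z\<in>A n. \<Sum>z'\<in>A n. g z z' \<zeta>)) \<partial>\<nu>)"
      unfolding nn_integral_kernel_bound_inner B_def[symmetric] B'_def[symmetric] m_def[symmetric] I_def[symmetric]
        f_def g_def ..
    also have "\<dots> = ennreal (weight p \<theta> n) * ((\<Sum>z\<in>A n. \<integral>\<^sup>+ \<zeta>. f z \<zeta> \<partial>\<nu>) + (\<Sum>z\<in>A n. \<Sum>z'\<in>A n. \<integral>\<^sup>+ \<zeta>. g z z' \<zeta> \<partial>\<nu>))"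
      by (simp add: nn_integral_cmult nn_integral_add nn_integral_sum)
    also have "\<dots> = ennreal (weight p \<theta> n) *
        ((\<Sum>z\<in>A n. \<integral>\<^sup>+ \<zeta>. ennreal (1 / m z) * indicator (B z) \<zeta> * (?R \<zeta> * emeasure \<nu> (B' z) + I z) \<partial>\<nu>) +
         (\<Sum>z\<in>A n. \<Sum>z'\<in>A n. \<integral>\<^sup>+ \<zeta>. (if adj (z, n) (z', n) then ennreal (?T z z' / m z) * indicator (B z) \<zeta> * emeasure \<nu> (B z') else 0) \<partial>\<nu>))"
      unfolding f_def g_def ..
    also have "\<dots> \<le> ennreal (weight p \<theta> n) * ((\<Sum>z\<in>A n. ennreal (C + 1) * I z) + ennreal (level_energy p U n))"
      by (intro mult_left_mono add_mono sum_mono t1 t2) auto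
    also have "\<dots> \<le> ennreal (weight p \<theta> n) * (ennreal D * (\<integral>\<^sup>+ \<zeta>. ?R \<zeta> \<partial>\<nu>) + ennreal (level_energy p U n))"
    proof (intro mult_left_mono add_right_mono)
      have "(\<Sum>z\<in>A n. ennreal (C + 1) * I z) \<le> ennreal (C + 1) * (ennreal (real N) * (\<integral>\<^sup>+ \<zeta>. ?R \<zeta> \<partial>\<nu>))"
        unfolding sum_distrib_left[symmetric] by (intro mult_left_mono sumI) auto
      also have "\<dots> = ennreal ((C + 1) * real N) * (\<integral>\<^sup>+ \<zeta>. ?R \<zeta> \<partial>\<nu>)"
      proof -
        have "ennreal (C + 1) * ennreal (real N) = ennreal ((C + 1) * real N)"
          by (rule ennreal_mult[symmetric]) (use C in auto)
        then show ?thesis by (simp only: mult.assoc[symmetric])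
      qed
      also have "\<dots> \<le> ennreal D * (\<integral>\<^sup>+ \<zeta>. ?R \<zeta> \<partial>\<nu>)"
        using C(1) by (intro mult_right_mono ennreal_leI) (auto simp: D_def)
      finally show "(\<Sum>z\<in>A n. ennreal (C + 1) * I z) \<le> ennreal D * (\<integral>\<^sup>+ \<zeta>. ?R \<zeta> \<partial>\<nu>)" .
    qed auto
    finally show ?thesis .
  qed
  moreover have "D > 0" using C(1) by (auto simp: D_def)
  ultimately show ?thesis by blast
qed


end

context doubling_filling
begin

section \<open>Pointwise estimate of the Besov kernel\<close>

lemma scale_exists:
  assumes "d > 0" "\<kappa> > 0"
  shows "\<exists>n. (n = 0 \<or> d < \<kappa> * rad n) \<and> \<kappa> / \<alpha> * rad n \<le> d"
proof (cases "\<kappa> \<le> d")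
  case True
  have "\<kappa> / \<alpha> \<le> \<kappa> / 1" using alpha assms by (intro divide_left_mono) auto
  then show ?thesis using True by (intro exI[of _ 0]) auto
next
  case False
  obtain k where "\<kappa> / d < \<alpha> ^ k" using real_arch_pow[OF alpha] by blast
  then have ex: "\<kappa> * rad k \<le> d" using assms alpha by (simp add: field_simps)
  \<comment> \<open>The first level whose scale is at most d. The witness is its predecessor j,
    where d is still below \<open>\<kappa> * rad j\<close>; the step back costs the factor
    1/\<alpha> in the lower bound.\<close>
  define n where "n = (LEAST k. \<kappa> * rad k \<le> d)"
  have n: "\<kappa> * rad n \<le> d" unfolding n_def using ex by (rule LeastI)
  have "n \<noteq> 0" using n False by (cases n) auto
  then obtain j where j: "n = Suc j" by (cases n) auto
  have "\<not> \<kappa> * rad j \<le> d" using not_less_Least[of j "\<lambda>k. \<kappa> * rad k \<le> d"] j n_def by auto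
  then show ?thesis using n j by (intro exI[of _ j]) (simp add: field_simps)
qed

text \<open>Net points near \<zeta> or \<xi> all lie within \<open>\<tau> * rad n\<close> of
  \<zeta>, because 1 + (\<tau> - 1) = \<tau>, so distinct ones are horizontal neighbours. At n = 0
  there is a single vertex and the averages agree, which makes large distances harmless.\<close>

lemma average_diff_le:
  fixes U :: "'z \<times> nat \<Rightarrow> real"
  assumes p: "p \<ge> 1" and n: "n = 0 \<or> dist \<zeta> \<xi> < (\<tau> - 1) * rad n"
  defines "T \<equiv> \<lambda>z z'. \<bar>U (z, n) - U (z', n)\<bar> powr p"
  shows "\<bar>average U n \<zeta> - average U n \<xi>\<bar> powr p \<le> (\<Sum>z\<in>near n \<zeta>. \<Sum>z'\<in>near n \<xi>. T z z')"
    and "z \<in> near n \<zeta> \<Longrightarrow> z' \<in> near n \<xi> \<Longrightarrow> adj (z, n) (z', n) \<or> T z z' = 0"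
proof -
  let ?H = "\<Sum>z\<in>near n \<zeta>. \<Sum>z'\<in>near n \<xi>. T z z'"
  have T: "T z z' \<ge> 0" for z z' by (simp add: T_def)
  have "\<bar>average U n \<zeta> - average U n \<xi>\<bar> \<le> ?H powr (1/p)"
    unfolding average_def
  proof (rule abs_averages_diff_le)
    fix z z' assume z: "z \<in> near n \<zeta>" "z' \<in> near n \<xi>"
    have "T z z' \<le> (\<Sum>z'\<in>near n \<xi>. T z z')" using z finite_near T by (intro member_le_sum) auto
    also have "\<dots> \<le> ?H"
      by (rule member_le_sum[of z "near n \<zeta>" "\<lambda>z. \<Sum>z'\<in>near n \<xi>. T z z'"]) (use z finite_near T in \<open>auto intro: sum_nonneg\<close>)
    finally show "\<bar>U (z, n) - U (z', n)\<bar> \<le> ?H powr (1/p)"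
      unfolding T_def by (rule abs_le_powr_inverse) (use p in simp)
  qed (use finite_near near_nonempty in auto)
  then have "\<bar>average U n \<zeta> - average U n \<xi>\<bar> powr p \<le> (?H powr (1/p)) powr p" using p by (intro powr_mono2) auto
  also have "\<dots> = ?H" using p T by (intro powr_inverse_powr sum_nonneg) auto
  finally show "\<bar>average U n \<zeta> - average U n \<xi>\<bar> powr p \<le> ?H" .
  assume z: "z \<in> near n \<zeta>" "z' \<in> near n \<xi>"
  show "adj (z, n) (z', n) \<or> T z z' = 0"
  proof (cases "z = z' \<or> n = 0")
    case True
    then have "z = z'" using z near_0 by auto
    then show ?thesis using p by (simp add: T_def)
  next
    case False
    have zA: "z \<in> A n" "z' \<in> A n" "dist z \<zeta> < rad n" "dist z' \<xi> < rad n"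
      using z by (auto simp: near_def dist_commute)
    have "rad n \<le> \<tau> * rad n" using mult_right_mono[of 1 \<tau> "rad n"] tau rad_pos[of n] by simp
    then have "dist z \<zeta> < \<tau> * rad n" using zA(3) by (rule less_le_trans[rotated])
    moreover have "dist z' \<zeta> < \<tau> * rad n"
    proof -
      have "dist z' \<zeta> \<le> dist z' \<xi> + dist \<zeta> \<xi>" using dist_triangle[of z' \<zeta> \<xi>] by (simp add: dist_commute)
      also have "\<dots> < rad n + (\<tau> - 1) * rad n" using zA(4) n False by (intro add_strict_mono) auto
      also have "\<dots> = \<tau> * rad n" by (simp only: left_diff_distrib mult_1_left)
      finally show ?thesis .
    qed
    ultimately show ?thesis using adj_same_level[OF zA(1,2)] False by blast
  qed
qed

text \<open>The indicators in \<open>kernel_bound\<close> equal 1 at the vertices near \<zeta> and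
  \<xi>, so the left side is part of the sum on the right. Pairs that are not adjacent contribute 0
  to both.\<close>

lemma kernel_bound_ge:
  assumes fin: "tail p \<theta> U n \<zeta> = ennreal s" "tail p \<theta> U n \<xi> = ennreal s'" "s \<ge> 0" "s' \<ge> 0"
    and z: "z \<in> near n \<zeta>" and p: "p \<ge> 1" and n: "n = 0 \<or> dist \<zeta> \<xi> < (\<tau> - 1) * rad n"
  shows "ennreal (weight p \<theta> n * ((s + s') / measure \<nu> (ball z (rad n)) +
     (\<Sum>z\<in>near n \<zeta>. \<Sum>z'\<in>near n \<xi>. \<bar>U (z, n) - U (z', n)\<bar> powr p / measure \<nu> (ball z (rad n)))))
    \<le> kernel_bound p \<theta> U n \<zeta> \<xi>"
proof -
  let ?m = "\<lambda>z. measure \<nu> (ball z (rad n))" and ?T = "\<lambda>z z'. \<bar>U (z, n) - U (z', n)\<bar> powr p"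
  have zA: "z \<in> A n" "\<zeta> \<in> ball z (rad n)" using z by (auto simp: near_def dist_commute)
  have far: "\<xi> \<in> ball z ((\<tau> + 1) * rad n)"
  proof (cases "n = 0")
    case True
    then show ?thesis using dist_less_1[of z \<xi>] tau by simp
  next
    case False
    have "dist z \<xi> \<le> dist z \<zeta> + dist \<zeta> \<xi>" by (rule dist_triangle)
    also have "\<dots> < rad n + (\<tau> - 1) * rad n" using zA(2) n False by (intro add_strict_mono) auto
    also have "\<dots> \<le> (\<tau> + 1) * rad n" using rad_pos[of n] by (simp only: left_diff_distrib distrib_right mult_1_left)
    finally show ?thesis unfolding mem_ball .
  qed
  have 1: "ennreal ((s + s') / ?m z) \<le> (\<Sum>z\<in>A n. ennreal (1 / ?m z) * indicator (ball z (rad n)) \<zeta> *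
         (indicator (ball z ((\<tau> + 1) * rad n)) \<xi> * (tail p \<theta> U n \<zeta> + tail p \<theta> U n \<xi>)))"
  proof -
    have "ennreal ((s + s') / ?m z) = ennreal (1 / ?m z) * indicator (ball z (rad n)) \<zeta> *
         (indicator (ball z ((\<tau> + 1) * rad n)) \<xi> * (tail p \<theta> U n \<zeta> + tail p \<theta> U n \<xi>))"
      using zA(2) far fin by (simp add: ennreal_mult[symmetric] ennreal_plus[symmetric] del: ennreal_plus)
    also have "\<dots> \<le> (\<Sum>z\<in>A n. ennreal (1 / ?m z) * indicator (ball z (rad n)) \<zeta> *
         (indicator (ball z ((\<tau> + 1) * rad n)) \<xi> * (tail p \<theta> U n \<zeta> + tail p \<theta> U n \<xi>)))"
      by (rule member_le_sum[where f="\<lambda>z. ennreal (1 / ?m z) * indicator (ball z (rad n)) \<zeta> *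
         (indicator (ball z ((\<tau> + 1) * rad n)) \<xi> * (tail p \<theta> U n \<zeta> + tail p \<theta> U n \<xi>))"]) (use zA finite_net in auto)
    finally show ?thesis .
  qed
  let ?f = "\<lambda>z z'. if adj (z, n) (z', n) then ennreal (?T z z' / ?m z) *
           indicator (ball z (rad n)) \<zeta> * indicator (ball z' (rad n)) \<xi> else 0"
  have sub: "near n y \<subseteq> A n" for y by (auto simp: near_def)
  have 2: "ennreal (\<Sum>z\<in>near n \<zeta>. \<Sum>z'\<in>near n \<xi>. ?T z z' / ?m z) \<le> (\<Sum>z\<in>A n. \<Sum>z'\<in>A n. ?f z z')"
  proof -
    have "ennreal (\<Sum>z\<in>near n \<zeta>. \<Sum>z'\<in>near n \<xi>. ?T z z' / ?m z) = (\<Sum>z\<in>near n \<zeta>. \<Sum>z'\<in>near n \<xi>. ennreal (?T z z' / ?m z))"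
      by (simp add: sum_ennreal sum_nonneg)
    also have "\<dots> = (\<Sum>z\<in>near n \<zeta>. \<Sum>z'\<in>near n \<xi>. ?f z z')"
    proof (intro sum.cong refl)
      fix z z' assume zz: "z \<in> near n \<zeta>" "z' \<in> near n \<xi>"
      then have "\<zeta> \<in> ball z (rad n)" "\<xi> \<in> ball z' (rad n)" by (auto simp: near_def dist_commute)
      then show "ennreal (?T z z' / ?m z) = ?f z z'"
        using average_diff_le(2)[OF p n zz, of U] by (auto simp: indicator_def)
    qed
    also have "\<dots> \<le> (\<Sum>z\<in>near n \<zeta>. \<Sum>z'\<in>A n. ?f z z')"
      by (intro sum_mono sum_mono2 finite_net sub) auto
    also have "\<dots> \<le> (\<Sum>z\<in>A n. \<Sum>z'\<in>A n. ?f z z')"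
      by (intro sum_mono2 finite_net sub) auto
    finally show ?thesis .
  qed
  have nonneg: "(\<Sum>z\<in>near n \<zeta>. \<Sum>z'\<in>near n \<xi>. ?T z z' / ?m z) \<ge> 0" by (intro sum_nonneg) auto
  have "ennreal (weight p \<theta> n * ((s + s') / ?m z + (\<Sum>z\<in>near n \<zeta>. \<Sum>z'\<in>near n \<xi>. ?T z z' / ?m z))) =
      ennreal (weight p \<theta> n) * (ennreal ((s + s') / ?m z) + ennreal (\<Sum>z\<in>near n \<zeta>. \<Sum>z'\<in>near n \<xi>. ?T z z' / ?m z))"
    using weight_pos[of p \<theta> n] fin nonneg
    by (simp add: ennreal_mult[symmetric] ennreal_plus[symmetric] del: ennreal_plus)
  also have "\<dots> \<le> kernel_bound p \<theta> U n \<zeta> \<xi>"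
    unfolding kernel_bound_def by (intro mult_left_mono add_mono 1 2) simp
  finally show ?thesis .
qed

text \<open>Passing through the averages at the level n of \<open>scale_exists\<close> splits the
  difference of the traces into two tails and one horizontal term. As d is at least \<kappa> times
  the scale of level n, doubling bounds the kernel by \<open>weight\<close> divided by the measure
  of a ball of that level.\<close>

lemma trace_kernel_le:
  assumes p: "p \<ge> 1" and \<theta>: "\<theta> > 0"
  shows "\<exists>C>0. \<forall>U \<zeta> \<xi>. \<zeta> \<noteq> \<xi> \<and> tail p \<theta> U 0 \<zeta> < top \<and> tail p \<theta> U 0 \<xi> < top \<longrightarrow>
    ennreal (\<bar>trace U \<zeta> - trace U \<xi>\<bar> powr p / (dist \<zeta> \<xi> powr (p * \<theta>) * measure \<nu> (ball \<zeta> (dist \<zeta> \<xi>))))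
      \<le> ennreal C * (\<Sum>n. kernel_bound p \<theta> U n \<zeta> \<xi>)"
proof -
  define K where "K = (1 / (1 - \<alpha> powr (- \<theta> / 2))) powr p"
  \<comment> \<open>The lower constant that \<open>scale_exists\<close> yields when the upper one is
    \<tau> - 1, the threshold for horizontal adjacency.\<close>
  define \<kappa> where "\<kappa> = (\<tau> - 1) / \<alpha>"
  have \<kappa>: "\<kappa> > 0" using tau alpha by (simp add: \<kappa>_def)
  have K: "K \<ge> 0" by (simp add: K_def)
  \<comment> \<open>The ball of a near vertex lies within \<open>2 * rad n\<close> of \<zeta>; the
    factor \<open>2 / \<kappa>\<close> brings this radius down to \<open>\<kappa> * rad n\<close>,
    which is at most d.\<close>
  obtain C1 where C1: "C1 > 0" "\<And>x r. r > 0 \<Longrightarrow> measure \<nu> (ball x ((2 / \<kappa>) * r)) \<le> C1 * measure \<nu> (ball x r)"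
    using doubling_scale[of "2 / \<kappa>"] \<kappa> by auto
  define C3 where "C3 = C1 / \<kappa> powr (p * \<theta>)"
  have C3: "C3 > 0" using C1 \<kappa> by (simp add: C3_def)
  define C where "C = 3 powr p * C3 * (K + 1)"
  have "ennreal (\<bar>trace U \<zeta> - trace U \<xi>\<bar> powr p / (dist \<zeta> \<xi> powr (p * \<theta>) * measure \<nu> (ball \<zeta> (dist \<zeta> \<xi>))))
      \<le> ennreal C * (\<Sum>n. kernel_bound p \<theta> U n \<zeta> \<xi>)"
    if neq: "\<zeta> \<noteq> \<xi>" and fin: "tail p \<theta> U 0 \<zeta> < top" "tail p \<theta> U 0 \<xi> < top" for U \<zeta> \<xi>
  proof -
    define d where "d = dist \<zeta> \<xi>"
    have d: "d > 0" using neq by (simp add: d_def)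
    obtain n where n: "n = 0 \<or> dist \<zeta> \<xi> < (\<tau> - 1) * rad n" "\<kappa> * rad n \<le> d"
      using scale_exists[OF d, of "\<tau> - 1"] tau unfolding \<kappa>_def d_def by auto
    have "tail p \<theta> U n y \<le> tail p \<theta> U 0 y" for y using p \<theta> by (intro tail_le_tail_0) auto
    then have finn: "tail p \<theta> U n \<zeta> < top" "tail p \<theta> U n \<xi> < top" using fin by (metis le_less_trans)+
    then obtain s s' where s: "tail p \<theta> U n \<zeta> = ennreal s" "tail p \<theta> U n \<xi> = ennreal s'" "s \<ge> 0" "s' \<ge> 0"
      by (cases "tail p \<theta> U n \<zeta>"; cases "tail p \<theta> U n \<xi>") auto
    let ?m = "\<lambda>z. measure \<nu> (ball z (rad n))" and ?T = "\<lambda>z z'. \<bar>U (z, n) - U (z', n)\<bar> powr p"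
    define H where "H = (\<Sum>z\<in>near n \<zeta>. \<Sum>z'\<in>near n \<xi>. ?T z z')"
    define H' where "H' = (\<Sum>z\<in>near n \<zeta>. \<Sum>z'\<in>near n \<xi>. ?T z z' / ?m z)"
    define den where "den = d powr (p * \<theta>) * measure \<nu> (ball \<zeta> d)"
    have den_pos: "den > 0" unfolding den_def using d measure_ball_pos[of d \<zeta>] by simp
    have m: "?m z > 0" for z by (rule measure_ball_pos[OF rad_pos])
    have den: "1 / den \<le> C3 * weight p \<theta> n / ?m z" if z: "z \<in> near n \<zeta>" for z
    proof -
      have "ball z (rad n) \<subseteq> ball \<zeta> ((2 / \<kappa>) * (\<kappa> * rad n))"
      proof
        fix y assume "y \<in> ball z (rad n)"
        then have "dist \<zeta> y < rad n + rad n"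
          using z dist_triangle[of \<zeta> y z] by (auto simp: near_def)
        then show "y \<in> ball \<zeta> ((2 / \<kappa>) * (\<kappa> * rad n))" using \<kappa> by simp
      qed
      then have "?m z \<le> measure \<nu> (ball \<zeta> ((2 / \<kappa>) * (\<kappa> * rad n)))"
        by (intro nu.finite_measure_mono) (auto simp: sets_nu)
      also have "\<dots> \<le> C1 * measure \<nu> (ball \<zeta> (\<kappa> * rad n))"
        using \<kappa> rad_pos[of n] by (intro C1(2) mult_pos_pos) auto
      also have "\<dots> \<le> C1 * measure \<nu> (ball \<zeta> d)"
        using C1(1) n(2) by (intro mult_left_mono nu.finite_measure_mono subset_ball) (auto simp: sets_nu)
      finally have 1: "?m z \<le> C1 * measure \<nu> (ball \<zeta> d)" .
      have "\<kappa> powr (p * \<theta>) * (1 / weight p \<theta> n) = (\<kappa> * rad n) powr (p * \<theta>)"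
      proof -
        have "rad n = \<alpha> powr (- real n)" using alpha by (simp add: powr_minus powr_realpow inverse_eq_divide)
        then have "(\<kappa> * rad n) powr (p * \<theta>) = \<kappa> powr (p * \<theta>) * \<alpha> powr (- (real n * (p * \<theta>)))"
          by (simp only: powr_mult powr_powr mult_minus_left)
        then show ?thesis by (simp add: weight_def powr_minus inverse_eq_divide)
      qed
      also have "\<dots> \<le> d powr (p * \<theta>)"
        using n(2) \<kappa> rad_pos[of n] p \<theta> by (intro powr_mono2) auto
      finally have 2: "\<kappa> powr (p * \<theta>) * (1 / weight p \<theta> n) \<le> d powr (p * \<theta>)" .
      have "(\<kappa> powr (p * \<theta>) * (1 / weight p \<theta> n)) * ?m z \<le> d powr (p * \<theta>) * (C1 * measure \<nu> (ball \<zeta> d))"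
        by (rule mult_mono[OF 2 1]) auto
      also have "\<dots> = C1 * den" by (simp add: den_def)
      finally have "\<kappa> powr (p * \<theta>) / weight p \<theta> n * ?m z \<le> C1 * den" by simp
      then have "\<kappa> powr (p * \<theta>) * ?m z \<le> C1 * den * weight p \<theta> n"
        using weight_pos[of p \<theta> n] by (simp add: pos_divide_le_eq)
      then show ?thesis
        unfolding C3_def using den_pos m[of z] \<kappa> by (simp add: divide_le_eq le_divide_eq mult_ac)
    qed
    \<comment> \<open>One near vertex suffices for the tails. In the horizontal term the estimate
      \<open>den\<close> is used at each z of the sum.\<close>
    obtain z where z: "z \<in> near n \<zeta>" using near_nonempty by blast
    have "\<bar>trace U \<zeta> - average U n \<zeta>\<bar> powr p \<le> K * s" "\<bar>trace U \<xi> - average U n \<xi>\<bar> powr p \<le> K * s'"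
      using trace_limit(2)[OF p \<theta> finn(1)] trace_limit(2)[OF p \<theta> finn(2)] s K
      unfolding K_def[symmetric] by (simp_all add: ennreal_mult[symmetric])
    moreover have "\<bar>average U n \<zeta> - average U n \<xi>\<bar> powr p \<le> H"
      unfolding H_def by (rule average_diff_le(1)[OF p n(1)])
    moreover have "\<bar>trace U \<zeta> - trace U \<xi>\<bar> powr p \<le> (\<bar>trace U \<zeta> - average U n \<zeta>\<bar> + \<bar>trace U \<xi> - average U n \<xi>\<bar> + \<bar>average U n \<zeta> - average U n \<xi>\<bar>) powr p"
      using p by (intro powr_mono2) auto
    moreover note powr_sum3_le[of "\<bar>trace U \<zeta> - average U n \<zeta>\<bar>" "\<bar>trace U \<xi> - average U n \<xi>\<bar>" "\<bar>average U n \<zeta> - average U n \<xi>\<bar>" p]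
    ultimately have num: "\<bar>trace U \<zeta> - trace U \<xi>\<bar> powr p \<le> 3 powr p * (K * s + K * s' + H)"
      using p by (smt (verit, best) abs_ge_zero mult_left_mono powr_ge_zero)
    have base: "(s + s') / den \<le> C3 * weight p \<theta> n * ((s + s') / ?m z)"
      using mult_left_mono[OF den[OF z], of "s + s'"] s by (simp add: mult_ac)
    have "(K * s + K * s') / den = K * ((s + s') / den)" by (simp add: distrib_left)
    also have "\<dots> \<le> K * (C3 * weight p \<theta> n * ((s + s') / ?m z))" by (rule mult_left_mono[OF base K])
    finally have 1: "(K * s + K * s') / den \<le> C3 * weight p \<theta> n * (K * ((s + s') / ?m z))"
      by (simp only: mult_ac)
    have 2: "H / den \<le> C3 * weight p \<theta> n * H'"
      unfolding H_def H'_def sum_divide_distrib sum_distrib_left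
    proof (intro sum_mono)
      fix z z' assume "z \<in> near n \<zeta>"
      then have "?T z z' * (1 / den) \<le> ?T z z' * (C3 * weight p \<theta> n / ?m z)"
        by (intro mult_left_mono den) auto
      then show "?T z z' / den \<le> C3 * weight p \<theta> n * (?T z z' / ?m z)" by (simp add: mult.commute)
    qed
    have H': "H' \<ge> 0" unfolding H'_def by (intro sum_nonneg) auto
    have "\<bar>trace U \<zeta> - trace U \<xi>\<bar> powr p / den \<le> (3 powr p * (K * s + K * s' + H)) / den"
      by (rule divide_right_mono[OF num]) (use den_pos in simp)
    also have "\<dots> = 3 powr p * ((K * s + K * s') / den + H / den)"
      by (simp only: add_divide_distrib[symmetric] times_divide_eq_right)
    also have "\<dots> \<le> 3 powr p * (C3 * weight p \<theta> n * (K * ((s + s') / ?m z)) + C3 * weight p \<theta> n * H')"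
      by (intro mult_left_mono add_mono 1 2) auto
    also have "\<dots> = (3 powr p * C3 * weight p \<theta> n) * (K * ((s + s') / ?m z) + H')" by (simp only: distrib_left mult.assoc)
    also have "\<dots> \<le> (3 powr p * C3 * weight p \<theta> n) * ((K + 1) * ((s + s') / ?m z + H'))"
    proof (rule mult_left_mono)
      have "K * x + H' \<le> (K + 1) * (x + H')" if "x \<ge> 0" for x
        using mult_nonneg_nonneg[OF K H'] that by (simp add: algebra_simps)
      moreover have "(s + s') / ?m z \<ge> 0" using s m[of z] by simp
      ultimately show "K * ((s + s') / ?m z) + H' \<le> (K + 1) * ((s + s') / ?m z + H')" .
    qed (use C3 weight_pos[of p \<theta> n] in auto)
    also have "\<dots> = C * (weight p \<theta> n * ((s + s') / ?m z + H'))" by (simp only: C_def mult_ac)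
    finally have "ennreal (\<bar>trace U \<zeta> - trace U \<xi>\<bar> powr p / den) \<le> ennreal (C * (weight p \<theta> n * ((s + s') / ?m z + H')))"
      by (rule ennreal_leI)
    also have "\<dots> = ennreal C * ennreal (weight p \<theta> n * ((s + s') / ?m z + H'))"
      using C3 K by (intro ennreal_mult') (simp add: C_def)
    also have "\<dots> \<le> ennreal C * kernel_bound p \<theta> U n \<zeta> \<xi>"
      unfolding H'_def by (intro mult_left_mono kernel_bound_ge[OF s z p n(1)]) auto
    also have "\<dots> \<le> ennreal C * (\<Sum>n. kernel_bound p \<theta> U n \<zeta> \<xi>)"
      using sum_le_suminf[of "\<lambda>n. kernel_bound p \<theta> U n \<zeta> \<xi>" "{n}"] by (intro mult_left_mono) auto
    finally show ?thesis unfolding den_def d_def .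
  qed
  moreover have "C > 0" using C3 K by (simp add: C_def)
  ultimately show ?thesis by blast
qed

text \<open>The pointwise bound requires finite tails at both points; this is inserted for almost
  every \<zeta> in the outer integral and, separately, for almost every \<xi> in the inner one. The
  series over n then leaves both integrals.\<close>

lemma trace_besov_le:
  assumes p: "p \<ge> 1" and \<theta>: "\<theta> > 0"
  shows "\<exists>C>0. \<forall>U. energy p \<theta> U < top \<longrightarrow> besov_energy \<nu> \<theta> p (trace U) \<le> ennreal C * energy p \<theta> U"
proof -
  obtain C where C: "C > 0" "\<And>U \<zeta> \<xi>. \<zeta> \<noteq> \<xi> \<Longrightarrow> tail p \<theta> U 0 \<zeta> < top \<Longrightarrow> tail p \<theta> U 0 \<xi> < top \<Longrightarrow>
    ennreal (\<bar>trace U \<zeta> - trace U \<xi>\<bar> powr p / (dist \<zeta> \<xi> powr (p * \<theta>) * measure \<nu> (ball \<zeta> (dist \<zeta> \<xi>))))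
      \<le> ennreal C * (\<Sum>n. kernel_bound p \<theta> U n \<zeta> \<xi>)"
    using trace_kernel_le[OF assms] by auto
  obtain D where D: "D > 0" "\<And>U n. (\<integral>\<^sup>+ \<zeta>. (\<integral>\<^sup>+ \<xi>. kernel_bound p \<theta> U n \<zeta> \<xi> \<partial>\<nu>) \<partial>\<nu>)
     \<le> ennreal (weight p \<theta> n) * (ennreal D * (\<integral>\<^sup>+ \<zeta>. tail p \<theta> U n \<zeta> \<partial>\<nu>) + ennreal (level_energy p U n))"
    using nn_integral_kernel_bound_le by blast
  define W where "W = 1 / (1 - \<alpha> powr (- (p * \<theta>) / 2))"
  have W: "W > 0" using alpha \<theta> p powr_less_mono[of "- (p * \<theta>) / 2" 0 \<alpha>] by (auto simp: W_def)
  have "besov_energy \<nu> \<theta> p (trace U) \<le> ennreal (C * (D * W + 1)) * energy p \<theta> U" if fin: "energy p \<theta> U < top" for U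
  proof -
    have "besov_energy \<nu> \<theta> p (trace U) \<le> (\<integral>\<^sup>+ \<zeta>. (\<integral>\<^sup>+ \<xi>. ennreal C * (\<Sum>n. kernel_bound p \<theta> U n \<zeta> \<xi>) \<partial>\<nu>) \<partial>\<nu>)"
      unfolding besov_energy_def nn_integral_completion
    proof (rule nn_integral_mono_AE, use AE_tail_finite[OF p \<theta> fin] in eventually_elim)
      case (elim \<zeta>)
      show ?case
      proof (rule nn_integral_mono_AE, use AE_tail_finite[OF p \<theta> fin] in eventually_elim)
        fix \<xi> assume "tail p \<theta> U 0 \<xi> < top"
        then show "ennreal (\<bar>trace U \<zeta> - trace U \<xi>\<bar> powr p / (dist \<zeta> \<xi> powr (p * \<theta>) * measure \<nu> (ball \<zeta> (dist \<zeta> \<xi>)))) *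
            indicator (- {\<zeta>}) \<xi> \<le> ennreal C * (\<Sum>n. kernel_bound p \<theta> U n \<zeta> \<xi>)"
          using C(2)[of \<zeta> \<xi> U] elim by (cases "\<zeta> = \<xi>") auto
      qed
    qed
    also have "\<dots> = ennreal C * (\<Sum>n. \<integral>\<^sup>+ \<zeta>. (\<integral>\<^sup>+ \<xi>. kernel_bound p \<theta> U n \<zeta> \<xi> \<partial>\<nu>) \<partial>\<nu>)"
    proof -
      have "(\<integral>\<^sup>+ \<xi>. ennreal C * (\<Sum>n. kernel_bound p \<theta> U n \<zeta> \<xi>) \<partial>\<nu>) = ennreal C * (\<Sum>n. \<integral>\<^sup>+ \<xi>. kernel_bound p \<theta> U n \<zeta> \<xi> \<partial>\<nu>)" for \<zeta>
        by (subst nn_integral_cmult) (auto simp: nn_integral_suminf)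
      moreover have "(\<lambda>\<zeta>. \<integral>\<^sup>+ \<xi>. kernel_bound p \<theta> U n \<zeta> \<xi> \<partial>\<nu>) \<in> borel_measurable \<nu>" for n
        unfolding nn_integral_kernel_bound_inner by measurable
      ultimately show ?thesis by (simp add: nn_integral_cmult nn_integral_suminf)
    qed
    also have "\<dots> \<le> ennreal C * (\<Sum>n. ennreal (weight p \<theta> n) * (ennreal D * (\<integral>\<^sup>+ \<zeta>. tail p \<theta> U n \<zeta> \<partial>\<nu>) + ennreal (level_energy p U n)))"
      by (intro mult_left_mono suminf_le D(2)) auto
    also have "(\<Sum>n. ennreal (weight p \<theta> n) * (ennreal D * (\<integral>\<^sup>+ \<zeta>. tail p \<theta> U n \<zeta> \<partial>\<nu>) + ennreal (level_energy p U n))) =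
        (\<Sum>n. ennreal D * (ennreal (weight p \<theta> n) * (\<integral>\<^sup>+ \<zeta>. tail p \<theta> U n \<zeta> \<partial>\<nu>)) + ennreal (weight p \<theta> n * level_energy p U n))"
    proof (rule suminf_cong)
      fix n
      have "ennreal (weight p \<theta> n * level_energy p U n) = ennreal (weight p \<theta> n) * ennreal (level_energy p U n)"
        by (rule ennreal_mult) (use weight_pos[of p \<theta> n] level_energy_nonneg in auto)
      then show "ennreal (weight p \<theta> n) * (ennreal D * (\<integral>\<^sup>+ \<zeta>. tail p \<theta> U n \<zeta> \<partial>\<nu>) + ennreal (level_energy p U n)) =
          ennreal D * (ennreal (weight p \<theta> n) * (\<integral>\<^sup>+ \<zeta>. tail p \<theta> U n \<zeta> \<partial>\<nu>)) + ennreal (weight p \<theta> n * level_energy p U n)"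
        by (simp only: distrib_left mult.left_commute)
    qed
    also have "\<dots> = ennreal D * (\<Sum>n. ennreal (weight p \<theta> n) * (\<integral>\<^sup>+ \<zeta>. tail p \<theta> U n \<zeta> \<partial>\<nu>)) + energy p \<theta> U"
      unfolding energy_def by (subst suminf_add[symmetric]) auto
    also have "\<dots> \<le> ennreal D * (ennreal W * energy p \<theta> U) + energy p \<theta> U"
      unfolding W_def by (intro add_right_mono mult_left_mono sum_tail_le p \<theta>) auto
    also have "\<dots> = ennreal (D * W + 1) * energy p \<theta> U"
    proof -
      have "ennreal D * ennreal W = ennreal (D * W)" by (rule ennreal_mult[symmetric]) (use D W in auto)
      moreover have "ennreal (D * W + 1) = ennreal (D * W) + 1" using D(1) W by (simp add: ennreal_plus)
      ultimately show ?thesis by (simp only: mult.assoc[symmetric] distrib_right mult_1_left)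
    qed
    finally have "besov_energy \<nu> \<theta> p (trace U) \<le> ennreal C * (ennreal (D * W + 1) * energy p \<theta> U)"
      by (simp add: mult_left_mono)
    also have "\<dots> = ennreal (C * (D * W + 1)) * energy p \<theta> U"
    proof -
      have "ennreal C * ennreal (D * W + 1) = ennreal (C * (D * W + 1))" by (rule ennreal_mult[symmetric]) (use C D W in auto)
      then show ?thesis by (simp only: mult.assoc[symmetric])
    qed
    finally show ?thesis .
  qed
  moreover have "C * (D * W + 1) > 0" using C(1) D(1) W by (intro mult_pos_pos add_pos_pos) auto
  ultimately show ?thesis by blast
qed

lemma AE_trace_limit:
  assumes "p \<ge> 1" "\<theta> > 0" "energy p \<theta> U < top"
  shows "AE \<zeta> in \<nu>. (\<lambda>n. average U n \<zeta>) \<longlonglongrightarrow> trace U \<zeta>"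
  using AE_tail_finite[OF assms] by eventually_elim (rule trace_limit(1)[OF assms(1,2)])

end

section \<open>Lipschitz functions\<close>

context doubling_filling
begin

lemma mdist_Xe_vertices:
  assumes "adj (x, n) (y, k)"
  shows "mdist Xe (vertex_pt (x, n)) (vertex_pt (y, k)) \<le> rad (min n k)"
  using mdist_Xe_edge[OF assms, of 0 1] by (simp add: edge_pt_0 edge_pt_1)

text \<open>As \<tau> > 1, distinct vertices of one level near a common \<zeta> are horizontal
  neighbours.\<close>

lemma mdist_Xe_same_level:
  assumes "x \<in> A n" "y \<in> A n" "dist x \<zeta> < rad n" "dist y \<zeta> < rad n"
  shows "mdist Xe (vertex_pt (x, n)) (vertex_pt (y, n)) \<le> rad n"
proof (cases "x = y")
  case True
  have "vertex_pt (x, n) \<in> pts" using assms by (intro vertex_in_pts) (simp add: fill_vertices_def)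
  then have "mdist Xe (vertex_pt (x, n)) (vertex_pt (x, n)) = 0" by (intro mdist_props(3)) simp
  then show ?thesis using True rad_pos[of n] by simp
next
  case False
  have "rad n \<le> \<tau> * rad n" using mult_right_mono[of 1 \<tau> "rad n"] tau rad_pos[of n] by simp
  then have "adj (x, n) (y, n)"
    using assms False by (intro adj_same_level[of _ _ _ \<zeta>]) (auto intro: less_le_trans)
  from mdist_Xe_vertices[OF this] show ?thesis by simp
qed

section \<open>Boundary points as limits of vertices\<close>

definition approach :: "'z \<Rightarrow> (nat \<Rightarrow> 'z) \<Rightarrow> bool" where
  "approach \<zeta> z \<longleftrightarrow> (\<forall>j. z j \<in> A j \<and> dist (z j) \<zeta> < rad j)"

lemma approach_exists: "\<exists>z. approach \<zeta> z"
  unfolding approach_def using net_cover[of _ \<zeta>] by metis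

lemma approach_in_pts: "approach \<zeta> z \<Longrightarrow> vertex_pt (z j, j) \<in> pts"
  by (intro vertex_in_pts) (simp add: approach_def fill_vertices_def)

text \<open>Consecutive vertices are neighbours at distance at most \<open>rad k\<close>. Writing
  \<open>rad k\<close> as \<open>(rad k - rad (Suc k)) * (\<alpha> / (\<alpha> - 1))\<close> lets
  the geometric sum telescope in the induction.\<close>

lemma approach_mdist_le:
  assumes "approach \<zeta> z"
  shows "n \<le> k \<Longrightarrow> mdist Xe (vertex_pt (z n, n)) (vertex_pt (z k, k)) \<le> (rad n - rad k) * (\<alpha> / (\<alpha> - 1))"
proof (induction k rule: dec_induct)
  case base
  have "mdist Xe (vertex_pt (z n, n)) (vertex_pt (z n, n)) = 0"
    by (rule mdist_props(3)) (simp add: approach_in_pts[OF assms])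
  then show ?case by simp
next
  case (step k)
  have "adj (z k, k) (z (Suc k), Suc k)"
    using assms by (intro adj_up[of _ _ _ \<zeta>]) (auto simp only: approach_def)
  from mdist_Xe_vertices[OF this]
  have "mdist Xe (vertex_pt (z k, k)) (vertex_pt (z (Suc k), Suc k)) \<le> rad k" by simp
  also have "rad k = (rad k - rad (Suc k)) * (\<alpha> / (\<alpha> - 1))" using alpha by (simp add: field_simps)
  finally have "mdist Xe (vertex_pt (z n, n)) (vertex_pt (z (Suc k), Suc k)) \<le>
      (rad n - rad k) * (\<alpha> / (\<alpha> - 1)) + (rad k - rad (Suc k)) * (\<alpha> / (\<alpha> - 1))"
    using step.IH mdist_props(4)[of "vertex_pt (z n, n)" Xe "vertex_pt (z k, k)" "vertex_pt (z (Suc k), Suc k)"]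
      approach_in_pts[OF assms] by simp
  then show ?case by (simp only: distrib_right[symmetric]) simp
qed

lemma rad_tendsto_0: "rad \<longlonglongrightarrow> 0"
proof -
  have "(\<lambda>n. (1 / \<alpha>) ^ n) \<longlonglongrightarrow> 0" using alpha by (intro LIMSEQ_power_zero) simp
  then show ?thesis by (simp add: power_one_over)
qed

text \<open>Completeness gives a limit along one approaching sequence. Any other has the same limit,
  because its vertices of level n are within \<open>rad n\<close> of the first ones, so the
  description in \<open>boundary_map\<close> determines a unique point.\<close>

lemma boundary_map_limit:
  assumes compl: "is_completion Xe Xbar \<iota>" and z: "approach \<zeta> z"
  shows "limitin (mtopology_of Xbar) (\<lambda>j. \<iota> (vertex_pt (z j, j))) (boundary_map \<alpha> A Xbar \<iota> \<zeta>) sequentially"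
proof -
  interpret M: Metric_space "mspace Xbar" "mdist Xbar" by (rule Metric_space_mspace_mdist)
  have \<iota>: "\<iota> x \<in> mspace Xbar" "mdist Xbar (\<iota> x) (\<iota> y) = mdist Xe x y" if "x \<in> pts" "y \<in> pts" for x y
    using compl that by (auto simp: is_completion_def)
  have top: "mtopology_of Xbar = M.mtopology" by (simp add: mtopology_of_def)
  let ?\<sigma> = "\<lambda>z j. \<iota> (vertex_pt (z j, j))" and ?c = "\<alpha> / (\<alpha> - 1)"
  have c: "?c > 0" using alpha by simp
  have small: "\<exists>N. \<forall>n\<ge>N. rad n * ?c < \<epsilon>" if "\<epsilon> > 0" for \<epsilon>
  proof -
    have "(\<lambda>n. rad n * ?c) \<longlonglongrightarrow> 0" using tendsto_mult_right[OF rad_tendsto_0, of ?c] by simp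
    from order_tendstoD(2)[OF this that] show ?thesis by (simp add: eventually_sequentially)
  qed
  have dist_le: "mdist Xbar (?\<sigma> z n) (?\<sigma> z k) \<le> rad n * ?c" if "n \<le> k" for n k
  proof -
    have "mdist Xbar (?\<sigma> z n) (?\<sigma> z k) \<le> (rad n - rad k) * ?c"
      using approach_mdist_le[OF z that] \<iota>(2) approach_in_pts[OF z] by simp
    also have "\<dots> \<le> rad n * ?c" using c rad_pos[of k] by (intro mult_right_mono) auto
    finally show ?thesis .
  qed
  have "M.MCauchy (?\<sigma> z)"
    unfolding M.MCauchy_def
  proof (intro conjI allI impI)
    show "range (?\<sigma> z) \<subseteq> mspace Xbar" using \<iota>(1) approach_in_pts[OF z] by auto
    fix \<epsilon> :: real assume "\<epsilon> > 0"
    then obtain N where N: "\<And>n. n \<ge> N \<Longrightarrow> rad n * ?c < \<epsilon>" using small by blast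
    have "mdist Xbar (?\<sigma> z n) (?\<sigma> z k) < \<epsilon>" if "N \<le> n" "N \<le> k" for n k
      using dist_le[of n k] dist_le[of k n] N[OF that(1)] N[OF that(2)] mdist_props(2)[of Xbar "?\<sigma> z n" "?\<sigma> z k"]
      by (cases "n \<le> k") auto
    then show "\<exists>N. \<forall>n n'. N \<le> n \<longrightarrow> N \<le> n' \<longrightarrow> mdist Xbar (?\<sigma> z n) (?\<sigma> z n') < \<epsilon>" by blast
  qed
  then obtain q where q: "limitin M.mtopology (?\<sigma> z) q sequentially"
    using compl unfolding is_completion_def mcomplete_of_def M.mcomplete_def by blast
  have same: "limitin M.mtopology (?\<sigma> y) q sequentially" if y: "approach \<zeta> y" for y
    unfolding M.limit_metric_sequentially
  proof (intro conjI allI impI)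
    show "q \<in> mspace Xbar" using q by (simp add: M.limit_metric_sequentially)
    fix \<epsilon> :: real assume \<epsilon>: "\<epsilon> > 0"
    then obtain N where N: "\<And>n. n \<ge> N \<Longrightarrow> mdist Xbar (?\<sigma> z n) q < \<epsilon> / 2"
      using q unfolding M.limit_metric_sequentially by (meson half_gt_zero)
    obtain N' where N': "\<And>n. n \<ge> N' \<Longrightarrow> rad n < \<epsilon> / 2"
      using order_tendstoD(2)[OF rad_tendsto_0, of "\<epsilon> / 2"] \<epsilon> by (auto simp: eventually_sequentially)
    have "?\<sigma> y n \<in> mspace Xbar \<and> mdist Xbar (?\<sigma> y n) q < \<epsilon>" if n: "n \<ge> max N N'" for n
    proof
      show "?\<sigma> y n \<in> mspace Xbar" using \<iota>(1) approach_in_pts[OF y] by blast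
      have "mdist Xbar (?\<sigma> y n) (?\<sigma> z n) \<le> rad n"
        using mdist_Xe_same_level[of "y n" n "z n" \<zeta>] y z \<iota>(2) approach_in_pts[OF y] approach_in_pts[OF z]
        by (simp add: approach_def)
      moreover have "mdist Xbar (?\<sigma> y n) q \<le> mdist Xbar (?\<sigma> y n) (?\<sigma> z n) + mdist Xbar (?\<sigma> z n) q"
        using \<iota>(1) approach_in_pts[OF y] approach_in_pts[OF z] \<open>q \<in> mspace Xbar\<close> by (intro mdist_props(4)) auto
      ultimately show "mdist Xbar (?\<sigma> y n) q < \<epsilon>" using N[of n] N'[of n] n by simp
    qed
    then show "\<exists>N. \<forall>n\<ge>N. ?\<sigma> y n \<in> mspace Xbar \<and> mdist Xbar (?\<sigma> y n) q < \<epsilon>" by blast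
  qed
  have "boundary_map \<alpha> A Xbar \<iota> \<zeta> = q"
    unfolding boundary_map_def top approach_def[symmetric]
  proof (rule the_equality)
    show "\<forall>z. approach \<zeta> z \<longrightarrow> limitin M.mtopology (?\<sigma> z) q sequentially" using same by blast
    fix q' assume "\<forall>z. approach \<zeta> z \<longrightarrow> limitin M.mtopology (?\<sigma> z) q' sequentially"
    then have "limitin M.mtopology (?\<sigma> z) q' sequentially" using z by blast
    then show "q' = q" using M.limitin_metric_unique[of "?\<sigma> z" q' sequentially q] q by simp
  qed
  then show ?thesis using q top by simp
qed

text \<open>f is transported to the dense image of \<iota> and extended to its closure. Vertices
  near \<zeta> at level n are within \<open>rad n\<close> of each other in d_\<epsilon>, so the
  averages differ from f along an approaching sequence by at most \<open>B * rad n\<close>; this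
  argument applies to every single \<zeta>.\<close>

lemma Lipschitz_trace:
  fixes Xbar :: "'c metric"
  assumes f: "Lipschitz_continuous_map Xe euclidean_metric f" and compl: "is_completion Xe Xbar \<iota>"
    and U: "\<And>v. v \<in> fill_vertices A \<Longrightarrow> U v = f (vertex_pt v)"
  shows "\<exists>uhat. Lipschitz_continuous_map Xbar euclidean_metric uhat \<and> (\<forall>x\<in>pts. uhat (\<iota> x) = f x) \<and>
     (\<forall>h. Lipschitz_continuous_map Xbar euclidean_metric h \<and> (\<forall>x\<in>pts. h (\<iota> x) = f x) \<longrightarrow> (\<forall>q\<in>mspace Xbar. h q = uhat q)) \<and>
     (\<forall>\<zeta>. trace U \<zeta> = uhat (boundary_map \<alpha> A Xbar \<iota> \<zeta>))"
proof -
  have \<iota>: "\<And>x. x \<in> pts \<Longrightarrow> \<iota> x \<in> mspace Xbar" "\<And>x y. x \<in> pts \<Longrightarrow> y \<in> pts \<Longrightarrow> mdist Xbar (\<iota> x) (\<iota> y) = mdist Xe x y"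
    and dense: "mtopology_of Xbar closure_of \<iota> ` pts = mspace Xbar"
    using compl by (auto simp: is_completion_def)
  obtain B where B: "B > 0" "\<And>x y. x \<in> pts \<Longrightarrow> y \<in> pts \<Longrightarrow> dist (f x) (f y) \<le> B * mdist Xe x y"
    using f by (auto simp: Lipschitz_continuous_map_pos)
  have inj: "inj_on \<iota> pts"
  proof (rule inj_onI)
    fix x y assume xy: "x \<in> pts" "y \<in> pts" "\<iota> x = \<iota> y"
    then have "mdist Xe x y = 0" using \<iota>(2)[OF xy(1,2)] mdist_props(3)[OF \<iota>(1)[OF xy(1)]] by simp
    then show "x = y" using xy mdist_props(5)[of x Xe y] by simp
  qed
  let ?g = "f \<circ> inv_into pts \<iota>"
  have g: "?g (\<iota> x) = f x" if "x \<in> pts" for x using inj that by simp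
  have "Lipschitz_continuous_map (submetric Xbar (\<iota> ` pts)) euclidean_metric ?g"
    unfolding Lipschitz_continuous_map_def using B(2) \<iota>(2) inj by (auto intro!: exI[of _ B])
  then obtain uhat where uhat: "Lipschitz_continuous_map (submetric Xbar (mtopology_of Xbar closure_of \<iota> ` pts)) euclidean_metric uhat"
    "\<And>x. x \<in> \<iota> ` pts \<Longrightarrow> uhat x = ?g x"
    using Lipschitz_continuous_map_extends_to_closure_of[of euclidean_metric Xbar "\<iota> ` pts" ?g]
    by (auto simp: mcomplete_of_def complete_UNIV)
  have lip: "Lipschitz_continuous_map Xbar euclidean_metric uhat"
    using uhat(1) unfolding dense by simp
  have ext: "uhat (\<iota> x) = f x" if "x \<in> pts" for x using uhat(2)[of "\<iota> x"] g that by simp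
  have cont: "continuous_map (mtopology_of Xbar) euclidean h"
    if "Lipschitz_continuous_map Xbar euclidean_metric h" for h :: "'c \<Rightarrow> real"
    using Lipschitz_continuous_imp_continuous_map[OF that] by simp
  have uniq: "h q = uhat q" if h: "Lipschitz_continuous_map Xbar euclidean_metric h" "\<forall>x\<in>pts. h (\<iota> x) = f x" and q: "q \<in> mspace Xbar" for h q
  proof (rule forall_in_closure_of_eq[of q "mtopology_of Xbar" "\<iota> ` pts" euclidean h uhat])
    show "q \<in> mtopology_of Xbar closure_of \<iota> ` pts" using q dense by simp
  qed (use cont lip h ext in auto)
  have tr: "trace U \<zeta> = uhat (boundary_map \<alpha> A Xbar \<iota> \<zeta>)" for \<zeta>
  proof -
    obtain z where z: "approach \<zeta> z" using approach_exists by blast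
    let ?q = "boundary_map \<alpha> A Xbar \<iota> \<zeta>"
    have "limitin euclidean (uhat \<circ> (\<lambda>j. \<iota> (vertex_pt (z j, j)))) (uhat ?q) sequentially"
      by (rule continuous_map_limit[OF cont[OF lip] boundary_map_limit[OF compl z]])
    then have lim: "(\<lambda>j. f (vertex_pt (z j, j))) \<longlonglongrightarrow> uhat ?q"
      using ext approach_in_pts[OF z] by (simp add: o_def)
    have close: "\<bar>average U n \<zeta> - f (vertex_pt (z n, n))\<bar> \<le> B * rad n" for n
      unfolding average_def
    proof (rule abs_average_diff_le[OF finite_near near_nonempty])
      fix y assume y: "y \<in> near n \<zeta>"
      then have yA: "y \<in> A n" "dist y \<zeta> < rad n" by (auto simp: near_def dist_commute)
      have "dist (f (vertex_pt (y, n))) (f (vertex_pt (z n, n))) \<le> B * mdist Xe (vertex_pt (y, n)) (vertex_pt (z n, n))"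
        using yA z by (intro B(2) vertex_in_pts) (auto simp: fill_vertices_def approach_def)
      also have "\<dots> \<le> B * rad n"
        using mdist_Xe_same_level[of y n "z n" \<zeta>] yA z B(1) by (intro mult_left_mono) (auto simp: approach_def)
      finally show "\<bar>U (y, n) - f (vertex_pt (z n, n))\<bar> \<le> B * rad n"
        using U[of "(y, n)"] yA by (simp add: dist_real_def fill_vertices_def)
    qed
    have "(\<lambda>n. B * rad n) \<longlonglongrightarrow> 0" using tendsto_mult_left[OF rad_tendsto_0, of B] by simp
    then have "(\<lambda>n. average U n \<zeta> - f (vertex_pt (z n, n))) \<longlonglongrightarrow> 0"
      by (rule Lim_null_comparison[rotated]) (intro always_eventually allI, unfold real_norm_def, rule close)
    from tendsto_add[OF this lim] have "(\<lambda>n. average U n \<zeta>) \<longlonglongrightarrow> uhat ?q" by simp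
    then show ?thesis unfolding trace_def by (rule limI)
  qed
  show ?thesis using lip ext uniq tr by blast
qed

section \<open>Norm estimates\<close>

lemma upper_gradient_imp_weak:
  assumes "upper_gradient Xe u g" "p > 0"
  shows "weak_upper_gradient Xe (mu \<beta>) p u g"
proof -
  have g: "g \<in> borel_measurable (metric_borel Xe)" using assms by (simp add: upper_gradient_def)
  have "g \<in> borel_measurable (mu \<beta>)"
    using borel_measurable_Xe_X[OF g] by (simp cong: measurable_cong_sets add: sets_mu)
  then have 1: "g \<in> borel_measurable (completion (mu \<beta>))" by (rule measurable_completion)
  have "exceptional_family Xe (mu \<beta>) p {}"
    unfolding exceptional_family_def using assms(2)
    by (intro exI[of _ "\<lambda>_. 0"]) (simp add: Lp_energy_def ennreal_powr_def)
  then show ?thesis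
    unfolding weak_upper_gradient_def using 1 assms(1) measurable_along_borel[OF _ g]
    by (intro conjI exI[of _ "{}"]) (auto simp: upper_gradient_def)
qed

text \<open>\<open>newtonian_seminorm\<close> ranges over genuine upper gradients, while g_u is
  minimal among weak ones of finite energy; a competitor of infinite energy satisfies the bound
  trivially.\<close>

lemma Lp_energy_le_INF:
  assumes "minimal_weak_upper_gradient Xe (mu \<beta>) p u gu" "p > 0"
  shows "Lp_energy (mu \<beta>) p gu \<le> (INF g \<in> {g. upper_gradient Xe u g}. Lp_energy (mu \<beta>) p g)"
proof (rule INF_greatest)
  fix g assume "g \<in> {g. upper_gradient Xe u g}"
  then have g: "weak_upper_gradient Xe (mu \<beta>) p u g" using upper_gradient_imp_weak assms(2) by blast
  show "Lp_energy (mu \<beta>) p gu \<le> Lp_energy (mu \<beta>) p g"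
  proof (cases "Lp_energy (mu \<beta>) p g < \<infinity>")
    case True
    then have "AE x in completion (mu \<beta>). gu x \<le> g x"
      using assms(1) g by (simp add: minimal_weak_upper_gradient_def)
    then show ?thesis
      unfolding Lp_energy_def by (intro nn_integral_mono_AE) (auto intro: ennreal_powr_mono[OF _ assms(2)])
  next
    case False
    then show ?thesis by (simp add: not_less top_unique)
  qed
qed

lemma ennreal_powr_root_cmult_mono:
  assumes "x \<le> ennreal c * y" "c > 0" "p > 0"
  shows "ennreal_powr x (1 / p) \<le> ennreal (c powr (1 / p)) * ennreal_powr y (1 / p)"
  using ennreal_powr_mono[OF assms(1), of "1 / p"] assms(2,3) by (simp add: ennreal_powr_cmult)


text \<open>With finite vertex values the extended real sum is a real one, which connects the
  averages of the statement with the real-valued vertex function.\<close>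

lemma trace_avg_eq:
  assumes "\<And>z. z \<in> A n \<Longrightarrow> \<bar>u (vertex_pt (z, n))\<bar> \<noteq> \<infinity>"
  shows "trace_avg \<alpha> A u n \<zeta> = ereal (average (\<lambda>v. real_of_ereal (u (vertex_pt v))) n \<zeta>)"
proof -
  have "(\<Sum>z\<in>near n \<zeta>. u (vertex_pt (z, n))) = (\<Sum>z\<in>near n \<zeta>. ereal (real_of_ereal (u (vertex_pt (z, n)))))"
    by (intro sum.cong refl) (use assms in \<open>auto simp: near_def ereal_real\<close>)
  also have "\<dots> = ereal (\<Sum>z\<in>near n \<zeta>. real_of_ereal (u (vertex_pt (z, n))))" by (rule sum_ereal)
  finally show ?thesis
    using near_nonempty[of n \<zeta>] finite_near[of n \<zeta>]
    unfolding trace_avg_def average_def near_def[symmetric] by simp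
qed

text \<open>Stated for an arbitrary weak upper gradient of finite energy, with a constant
  independent of it: one such g supplied by \<open>newtonian\<close> yields membership and
  convergence, and the minimal one is inserted for the norms.\<close>

lemma trace_estimates:
  assumes p: "p \<ge> 1" and \<theta>: "0 < \<theta>" "\<theta> \<le> 1 - \<beta> / (ln \<alpha> * p)"
  shows "\<exists>C>0. \<forall>u g. weak_upper_gradient Xe (mu \<beta>) p u g \<and> Lp_energy (mu \<beta>) p g < \<infinity> \<longrightarrow>
     trace (\<lambda>v. real_of_ereal (u (vertex_pt v))) \<in> besov_space \<nu> \<theta> p \<and>
     (AE \<zeta> in \<nu>. (\<lambda>n. trace_avg \<alpha> A u n \<zeta>) \<longlonglongrightarrow> ereal (trace (\<lambda>v. real_of_ereal (u (vertex_pt v))) \<zeta>)) \<and>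
     besov_seminorm \<nu> \<theta> p (trace (\<lambda>v. real_of_ereal (u (vertex_pt v)))) \<le> ennreal C * Lp_norm (mu \<beta>) p g \<and>
     Lp_norm \<nu> p (\<lambda>\<zeta>. ennreal \<bar>trace (\<lambda>v. real_of_ereal (u (vertex_pt v))) \<zeta>\<bar>) \<le>
       ennreal C * (e2ennreal \<bar>u root\<bar> + Lp_norm (mu \<beta>) p g)"
proof -
  have p0: "p > 0" using p by simp
  define K where "K = (2 * \<alpha>) powr p"
  have K: "K > 0" using alpha by (simp add: K_def)
  obtain CL where CL: "CL > 0" "\<And>U. energy p \<theta> U < top \<Longrightarrow>
    (\<integral>\<^sup>+ \<zeta>. ennreal (\<bar>trace U \<zeta>\<bar> powr p) \<partial>\<nu>) \<le> ennreal CL * (ennreal (\<bar>U (z0, 0)\<bar> powr p) + energy p \<theta> U)"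
    using trace_Lp_le[OF p \<theta>(1)] by auto
  obtain CB where CB: "CB > 0" "\<And>U. energy p \<theta> U < top \<Longrightarrow> besov_energy \<nu> \<theta> p (trace U) \<le> ennreal CB * energy p \<theta> U"
    using trace_besov_le[OF p \<theta>(1)] by auto
  define C1 where "C1 = (CB * K) powr (1 / p)"
  \<comment> \<open>The factor 2^(1/p) comes from splitting the p-th root of the sum of the root
    value and the gradient energy.\<close>
  define C2 where "C2 = (CL * (K + 1)) powr (1 / p) * 2 powr (1 / p)"
  have C: "C1 > 0" "C2 > 0" using CB(1) CL(1) K by (auto simp: C1_def C2_def)
  have main: "trace U \<in> besov_space \<nu> \<theta> p \<and> (AE \<zeta> in \<nu>. (\<lambda>n. trace_avg \<alpha> A u n \<zeta>) \<longlonglongrightarrow> ereal (trace U \<zeta>)) \<and>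
     besov_seminorm \<nu> \<theta> p (trace U) \<le> ennreal (C1 + C2) * Lp_norm (mu \<beta>) p g \<and>
     Lp_norm \<nu> p (\<lambda>\<zeta>. ennreal \<bar>trace U \<zeta>\<bar>) \<le> ennreal (C1 + C2) * (e2ennreal \<bar>u root\<bar> + Lp_norm (mu \<beta>) p g)"
    if g: "weak_upper_gradient Xe (mu \<beta>) p u g" "Lp_energy (mu \<beta>) p g < \<infinity>"
      and U_def: "U = (\<lambda>v. real_of_ereal (u (vertex_pt v)))" for u g U
  proof -
    let ?E = "Lp_energy (mu \<beta>) p g"
    have en: "energy p \<theta> U \<le> ennreal K * ?E"
      unfolding energy_def weight_def U_def K_def by (rule discrete_energy_le[OF g p \<theta>(2)])
    also have "\<dots> < top" using g(2) by (simp add: ennreal_mult_less_top)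
    finally have fin: "energy p \<theta> U < top" .
    have meas: "trace U \<in> borel_measurable (completion \<nu>)" by (rule measurable_completion[OF trace_measurable])
    have Lp_eq: "Lp_energy \<nu> p (\<lambda>\<zeta>. ennreal \<bar>trace U \<zeta>\<bar>) = (\<integral>\<^sup>+ \<zeta>. ennreal (\<bar>trace U \<zeta>\<bar> powr p) \<partial>\<nu>)"
      unfolding Lp_energy_def nn_integral_completion by (simp add: ennreal_powr_ennreal)
    have Lp_fin: "Lp_energy \<nu> p (\<lambda>\<zeta>. ennreal \<bar>trace U \<zeta>\<bar>) < \<infinity>"
      unfolding Lp_eq by (rule le_less_trans[OF CL(2)[OF fin]]) (use fin in \<open>simp add: ennreal_mult_less_top\<close>)
    have B_fin: "besov_energy \<nu> \<theta> p (trace U) < \<infinity>"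
      by (rule le_less_trans[OF CB(2)[OF fin]]) (use fin in \<open>simp add: ennreal_mult_less_top\<close>)
    have 1: "trace U \<in> besov_space \<nu> \<theta> p" using meas Lp_fin B_fin by (simp add: besov_space_def)
    have avg: "trace_avg \<alpha> A u n \<zeta> = ereal (average U n \<zeta>)" for n \<zeta>
      unfolding U_def by (rule trace_avg_eq) (rule vertex_value_finite[OF g p])
    have 2: "AE \<zeta> in \<nu>. (\<lambda>n. trace_avg \<alpha> A u n \<zeta>) \<longlonglongrightarrow> ereal (trace U \<zeta>)"
      using AE_trace_limit[OF p \<theta>(1) fin] by eventually_elim (simp add: avg)
    have "besov_energy \<nu> \<theta> p (trace U) \<le> ennreal CB * (ennreal K * ?E)"
      by (rule order_trans[OF CB(2)[OF fin]]) (intro mult_left_mono en, simp)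
    also have "\<dots> = ennreal (CB * K) * ?E"
    proof -
      have "ennreal CB * ennreal K = ennreal (CB * K)" by (rule ennreal_mult[symmetric]) (use CB K in auto)
      then show ?thesis by (simp only: mult.assoc[symmetric])
    qed
    finally have "besov_seminorm \<nu> \<theta> p (trace U) \<le> ennreal C1 * Lp_norm (mu \<beta>) p g"
      unfolding besov_seminorm_def Lp_norm_def C1_def using CB(1) K p0
      by (intro ennreal_powr_root_cmult_mono) auto
    also have "\<dots> \<le> ennreal (C1 + C2) * Lp_norm (mu \<beta>) p g"
      using C by (intro mult_right_mono ennreal_leI) auto
    finally have 3: "besov_seminorm \<nu> \<theta> p (trace U) \<le> ennreal (C1 + C2) * Lp_norm (mu \<beta>) p g" .
    define a where "a = \<bar>U (z0, 0)\<bar>"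
    have "z0 \<in> A 0" using net_0 by simp
    from vertex_value_finite[OF g p this] have ua: "e2ennreal \<bar>u root\<bar> = ennreal a"
      by (cases "u root") (auto simp: a_def U_def e2ennreal_ereal)
    have "Lp_energy \<nu> p (\<lambda>\<zeta>. ennreal \<bar>trace U \<zeta>\<bar>) \<le> ennreal CL * (ennreal (a powr p) + energy p \<theta> U)"
      unfolding Lp_eq a_def by (rule CL(2)[OF fin])
    also have "\<dots> \<le> ennreal CL * (ennreal (K + 1) * (ennreal (a powr p) + ?E))"
    proof (rule mult_left_mono)
      have "ennreal (a powr p) + energy p \<theta> U \<le> 1 * ennreal (a powr p) + ennreal K * ?E" using en by (simp add: add_left_mono)
      also have "\<dots> \<le> ennreal (K + 1) * ennreal (a powr p) + ennreal (K + 1) * ?E"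
        using K by (intro add_mono mult_right_mono ennreal_leI) (auto simp: ennreal_le_iff2 one_ennreal_def)
      finally show "ennreal (a powr p) + energy p \<theta> U \<le> ennreal (K + 1) * (ennreal (a powr p) + ?E)" by (simp only: distrib_left)
    qed simp
    also have "\<dots> = ennreal (CL * (K + 1)) * (ennreal (a powr p) + ?E)"
    proof -
      have "ennreal CL * ennreal (K + 1) = ennreal (CL * (K + 1))" by (rule ennreal_mult[symmetric]) (use CL K in auto)
      then show ?thesis by (simp only: mult.assoc[symmetric])
    qed
    finally have "Lp_norm \<nu> p (\<lambda>\<zeta>. ennreal \<bar>trace U \<zeta>\<bar>) \<le> ennreal ((CL * (K + 1)) powr (1 / p)) * ennreal_powr (ennreal (a powr p) + ?E) (1 / p)"
      unfolding Lp_norm_def using CL(1) K p0 by (intro ennreal_powr_root_cmult_mono) auto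
    also have "\<dots> \<le> ennreal ((CL * (K + 1)) powr (1 / p)) * (ennreal (2 powr (1 / p)) * (ennreal_powr (ennreal (a powr p)) (1 / p) + ennreal_powr ?E (1 / p)))"
      using p0 by (intro mult_left_mono ennreal_powr_add_le) auto
    also have "\<dots> = ennreal C2 * (ennreal_powr (ennreal (a powr p)) (1 / p) + ennreal_powr ?E (1 / p))"
    proof -
      have "ennreal ((CL * (K + 1)) powr (1 / p)) * ennreal (2 powr (1 / p)) = ennreal C2"
        unfolding C2_def by (rule ennreal_mult[symmetric]) auto
      then show ?thesis by (simp only: mult.assoc[symmetric])
    qed
    also have "ennreal_powr (ennreal (a powr p)) (1 / p) = e2ennreal \<bar>u root\<bar>"
      unfolding ua using p0 by (simp add: ennreal_powr_ennreal powr_powr a_def)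
    also have "ennreal_powr ?E (1 / p) = Lp_norm (mu \<beta>) p g" by (simp add: Lp_norm_def)
    also have "ennreal C2 * (e2ennreal \<bar>u root\<bar> + Lp_norm (mu \<beta>) p g) \<le> ennreal (C1 + C2) * (e2ennreal \<bar>u root\<bar> + Lp_norm (mu \<beta>) p g)"
      using C by (intro mult_right_mono ennreal_leI) auto
    finally have 4: "Lp_norm \<nu> p (\<lambda>\<zeta>. ennreal \<bar>trace U \<zeta>\<bar>) \<le> ennreal (C1 + C2) * (e2ennreal \<bar>u root\<bar> + Lp_norm (mu \<beta>) p g)" .
    show ?thesis using 1 2 3 4 by blast
  qed
  show ?thesis
    by (intro exI[of _ "C1 + C2"], rule conjI, use C in simp, intro allI impI, erule conjE,
        rule main[OF _ _ refl]; assumption)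
qed

text \<open>The root value is bounded by \<open>root_value_le\<close> after division by the positive
  weight \<omega> of the root, and the gradient part by passing to the infimum over upper
  gradients.\<close>

lemma newtonian_seminorm_ge:
  assumes p: "p \<ge> 1"
  shows "\<exists>C>0. \<forall>u \<in> newtonian Xe (mu \<beta>) p. \<forall>gu. minimal_weak_upper_gradient Xe (mu \<beta>) p u gu \<longrightarrow>
     e2ennreal \<bar>u root\<bar> + Lp_norm (mu \<beta>) p gu \<le> ennreal C * newtonian_seminorm Xe (mu \<beta>) p u"
proof -
  have p0: "p > 0" using p by simp
  obtain \<omega> where \<omega>: "wt \<beta> (z0, 0) = ennreal \<omega>" "\<omega> > 0"
    using wt_pos[of \<beta> "(z0, 0)"] wt_finite[of \<beta> "(z0, 0)"] by (cases "wt \<beta> (z0, 0)") auto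
  define c where "c = 4 powr p / \<omega>"
  have c: "c > 0" using \<omega>(2) by (simp add: c_def)
  have "e2ennreal \<bar>u root\<bar> + Lp_norm (mu \<beta>) p gu \<le> ennreal (c powr (1 / p) + 1) * newtonian_seminorm Xe (mu \<beta>) p u"
    if u: "u \<in> newtonian Xe (mu \<beta>) p" and gu: "minimal_weak_upper_gradient Xe (mu \<beta>) p u gu" for u gu
  proof -
    have g: "weak_upper_gradient Xe (mu \<beta>) p u gu" "Lp_energy (mu \<beta>) p gu < \<infinity>"
      using gu by (auto simp: minimal_weak_upper_gradient_def)
    have um: "u \<in> borel_measurable (completion (mu \<beta>))" using u by (simp add: newtonian_def)
    let ?I = "INF g \<in> {g. upper_gradient Xe u g}. Lp_energy (mu \<beta>) p g" and ?Eu = "Lp_energy (mu \<beta>) p (\<lambda>x. e2ennreal \<bar>u x\<bar>)"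
    have I: "Lp_energy (mu \<beta>) p gu \<le> ?I" by (rule Lp_energy_le_INF[OF gu p0])
    define a where "a = \<bar>real_of_ereal (u root)\<bar>"
    have ua: "e2ennreal \<bar>u root\<bar> = ennreal a"
      using root_value_le(1)[OF g p um] by (cases "u root") (auto simp: a_def e2ennreal_ereal)
    have "ennreal \<omega> * ennreal (a powr p) \<le> ennreal (4 powr p) * (?Eu + Lp_energy (mu \<beta>) p gu)"
      using root_value_le(2)[OF g p um] unfolding \<omega>(1) a_def .
    also have "\<dots> \<le> ennreal (4 powr p) * (?Eu + ?I)" by (intro mult_left_mono add_left_mono I) simp
    finally have "ennreal (1 / \<omega>) * (ennreal \<omega> * ennreal (a powr p)) \<le> ennreal (1 / \<omega>) * (ennreal (4 powr p) * (?Eu + ?I))"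
      by (rule mult_left_mono) simp
    moreover have "ennreal (1 / \<omega>) * (ennreal \<omega> * ennreal (a powr p)) = ennreal (a powr p)"
      using \<omega>(2) by (simp add: ennreal_mult[symmetric])
    moreover have "ennreal (1 / \<omega>) * (ennreal (4 powr p) * (?Eu + ?I)) = ennreal c * (?Eu + ?I)"
    proof -
      have "ennreal (1 / \<omega>) * ennreal (4 powr p) = ennreal c" using \<omega>(2) by (simp add: c_def ennreal_mult[symmetric])
      then show ?thesis by (simp only: mult.assoc[symmetric])
    qed
    ultimately have "ennreal (a powr p) \<le> ennreal c * (?Eu + ?I)" by simp
    then have "ennreal_powr (ennreal (a powr p)) (1 / p) \<le> ennreal (c powr (1 / p)) * ennreal_powr (?Eu + ?I) (1 / p)"
      using c p0 by (rule ennreal_powr_root_cmult_mono)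
    moreover have "ennreal_powr (ennreal (a powr p)) (1 / p) = e2ennreal \<bar>u root\<bar>"
      unfolding ua using p0 by (simp add: ennreal_powr_ennreal powr_powr a_def)
    ultimately have "e2ennreal \<bar>u root\<bar> \<le> ennreal (c powr (1 / p)) * newtonian_seminorm Xe (mu \<beta>) p u"
      by (simp add: newtonian_seminorm_def)
    moreover have "Lp_norm (mu \<beta>) p gu \<le> 1 * newtonian_seminorm Xe (mu \<beta>) p u"
      unfolding Lp_norm_def newtonian_seminorm_def using p0 I by (simp add: ennreal_powr_mono add_increasing)
    ultimately have "e2ennreal \<bar>u root\<bar> + Lp_norm (mu \<beta>) p gu \<le>
        ennreal (c powr (1 / p)) * newtonian_seminorm Xe (mu \<beta>) p u + 1 * newtonian_seminorm Xe (mu \<beta>) p u"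
      by (rule add_mono)
    also have "\<dots> = ennreal (c powr (1 / p) + 1) * newtonian_seminorm Xe (mu \<beta>) p u"
      by (simp add: distrib_right)
    finally show ?thesis .
  qed
  moreover have "c powr (1 / p) + 1 > 0" by (simp add: add_pos_nonneg add_nonneg_pos)
  ultimately show ?thesis by blast
qed

end

theorem theorem11p1:
  fixes \<nu> :: "'z::metric_space measure"
    and A :: "nat \<Rightarrow> 'z set" and z0 :: 'z
    and \<alpha> \<tau> \<epsilon> p \<beta> \<theta> :: real
  defines "X \<equiv> filling \<alpha> \<tau> A"
  defines "v0 \<equiv> vertex_pt (z0, 0::nat)"
  defines "X\<epsilon> \<equiv> uniformized X v0 \<epsilon>"
  defines "\<mu> \<equiv> mu_beta \<nu> \<alpha> \<tau> A \<beta>"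
  assumes "compact (UNIV :: 'z set)"
    and "0 < diameter (UNIV :: 'z set)" and "diameter (UNIV :: 'z set) < 1"
    and "doubling_measure \<nu>"
    and "\<alpha> > 1" and "\<tau> > 1" and "filling_nets \<alpha> z0 A"
    and "\<epsilon> = ln \<alpha>"
    and "p \<ge> 1" and "\<beta> > 0"
    and "0 < \<theta>" and "\<theta> \<le> 1 - \<beta> / (\<epsilon> * p)"
  shows "\<exists>C>0. \<forall>u \<in> newtonian X\<epsilon> \<mu> p. \<exists>ut \<in> besov_space \<nu> \<theta> p.
     (AE \<zeta> in \<nu>. (\<lambda>n. trace_avg \<alpha> A u n \<zeta>) \<longlonglongrightarrow> ereal (ut \<zeta>)) \<and>
     (\<forall>gu. minimal_weak_upper_gradient X\<epsilon> \<mu> p u gu \<longrightarrow>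
        besov_seminorm \<nu> \<theta> p ut \<le> ennreal C * Lp_norm \<mu> p gu \<and>
        Lp_norm \<nu> p (\<lambda>\<zeta>. ennreal \<bar>ut \<zeta>\<bar>) \<le> ennreal C * (e2ennreal \<bar>u v0\<bar> + Lp_norm \<mu> p gu) \<and>
        e2ennreal \<bar>u v0\<bar> + Lp_norm \<mu> p gu \<le> ennreal C * newtonian_seminorm X\<epsilon> \<mu> p u) \<and>
     (\<forall>f. Lipschitz_continuous_map X\<epsilon> euclidean_metric f \<and> (\<forall>x\<in>mspace X\<epsilon>. u x = ereal (f x)) \<longrightarrow>
        (\<forall>(Xbar :: 'c metric) \<iota>. is_completion X\<epsilon> Xbar \<iota> \<longrightarrow>
          (\<exists>uhat. Lipschitz_continuous_map Xbar euclidean_metric uhat \<and>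
             (\<forall>x\<in>mspace X\<epsilon>. uhat (\<iota> x) = f x) \<and>
             (\<forall>h. Lipschitz_continuous_map Xbar euclidean_metric h \<and>
                  (\<forall>x\<in>mspace X\<epsilon>. h (\<iota> x) = f x) \<longrightarrow> (\<forall>q\<in>mspace Xbar. h q = uhat q)) \<and>
             (\<forall>\<zeta>. ut \<zeta> = uhat (boundary_map \<alpha> A Xbar \<iota> \<zeta>)))))"
proof -
  interpret doubling_filling \<alpha> \<tau> A z0 \<nu>
    by unfold_locales (use assms in auto)
  have eqs: "X = filling \<alpha> \<tau> A" "v0 = vertex_pt (z0, 0)" "X\<epsilon> = Xe" "\<mu> = mu \<beta>"
    unfolding X_def v0_def X\<epsilon>_def \<mu>_def \<open>\<epsilon> = ln \<alpha>\<close> by auto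
  have p: "p \<ge> 1" and \<theta>: "0 < \<theta>" "\<theta> \<le> 1 - \<beta> / (ln \<alpha> * p)" using assms by auto
  let ?tr = "\<lambda>u :: ('z \<times> nat \<Rightarrow> real) \<Rightarrow> ereal. trace (\<lambda>v. real_of_ereal (u (vertex_pt v)))"
  obtain C1 where C1: "C1 > 0" "\<And>u g. weak_upper_gradient Xe (mu \<beta>) p u g \<Longrightarrow> Lp_energy (mu \<beta>) p g < \<infinity> \<Longrightarrow>
     ?tr u \<in> besov_space \<nu> \<theta> p \<and>
     (AE \<zeta> in \<nu>. (\<lambda>n. trace_avg \<alpha> A u n \<zeta>) \<longlonglongrightarrow> ereal (?tr u \<zeta>)) \<and>
     besov_seminorm \<nu> \<theta> p (?tr u) \<le> ennreal C1 * Lp_norm (mu \<beta>) p g \<and>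
     Lp_norm \<nu> p (\<lambda>\<zeta>. ennreal \<bar>?tr u \<zeta>\<bar>) \<le> ennreal C1 * (e2ennreal \<bar>u root\<bar> + Lp_norm (mu \<beta>) p g)"
    using trace_estimates[OF p \<theta>] by auto
  obtain C2 where C2: "C2 > 0" "\<And>u gu. u \<in> newtonian Xe (mu \<beta>) p \<Longrightarrow> minimal_weak_upper_gradient Xe (mu \<beta>) p u gu \<Longrightarrow>
     e2ennreal \<bar>u root\<bar> + Lp_norm (mu \<beta>) p gu \<le> ennreal C2 * newtonian_seminorm Xe (mu \<beta>) p u"
    using newtonian_seminorm_ge[OF p, of \<beta>] by auto
  have up: "x \<le> ennreal (C1 + C2) * y" if "x \<le> ennreal C1 * y \<or> x \<le> ennreal C2 * y" for x y
  proof -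
    have "ennreal C1 * y \<le> ennreal (C1 + C2) * y" "ennreal C2 * y \<le> ennreal (C1 + C2) * y"
      using C1(1) C2(1) by (auto intro!: mult_right_mono ennreal_leI)
    then show ?thesis using that by (auto intro: order_trans)
  qed
  show ?thesis
    unfolding eqs
  proof (intro exI[of _ "C1 + C2"] conjI ballI)
    show "C1 + C2 > 0" using C1(1) C2(1) by simp
    fix u assume u: "u \<in> newtonian Xe (mu \<beta>) p"
    then obtain g where g: "weak_upper_gradient Xe (mu \<beta>) p u g" "Lp_energy (mu \<beta>) p g < \<infinity>"
      by (auto simp: newtonian_def)
    note est = C1(2)[OF g]
    show "\<exists>ut\<in>besov_space \<nu> \<theta> p.
     (AE \<zeta> in \<nu>. (\<lambda>n. trace_avg \<alpha> A u n \<zeta>) \<longlonglongrightarrow> ereal (ut \<zeta>)) \<and>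
     (\<forall>gu. minimal_weak_upper_gradient Xe (mu \<beta>) p u gu \<longrightarrow>
        besov_seminorm \<nu> \<theta> p ut \<le> ennreal (C1 + C2) * Lp_norm (mu \<beta>) p gu \<and>
        Lp_norm \<nu> p (\<lambda>\<zeta>. ennreal \<bar>ut \<zeta>\<bar>) \<le> ennreal (C1 + C2) * (e2ennreal \<bar>u root\<bar> + Lp_norm (mu \<beta>) p gu) \<and>
        e2ennreal \<bar>u root\<bar> + Lp_norm (mu \<beta>) p gu \<le> ennreal (C1 + C2) * newtonian_seminorm Xe (mu \<beta>) p u) \<and>
     (\<forall>f. Lipschitz_continuous_map Xe euclidean_metric f \<and> (\<forall>x\<in>mspace Xe. u x = ereal (f x)) \<longrightarrow>
        (\<forall>(Xbar :: 'c metric) \<iota>. is_completion Xe Xbar \<iota> \<longrightarrow>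
          (\<exists>uhat. Lipschitz_continuous_map Xbar euclidean_metric uhat \<and>
             (\<forall>x\<in>mspace Xe. uhat (\<iota> x) = f x) \<and>
             (\<forall>h. Lipschitz_continuous_map Xbar euclidean_metric h \<and>
                  (\<forall>x\<in>mspace Xe. h (\<iota> x) = f x) \<longrightarrow> (\<forall>q\<in>mspace Xbar. h q = uhat q)) \<and>
             (\<forall>\<zeta>. ut \<zeta> = uhat (boundary_map \<alpha> A Xbar \<iota> \<zeta>)))))"
    \<comment> \<open>The witness depends on u alone, through its real values at the vertices, so
      the same trace serves every minimal weak upper gradient and every completion.\<close>
    proof (rule bexI[of _ "?tr u"], intro conjI allI impI)
      show "?tr u \<in> besov_space \<nu> \<theta> p" "AE \<zeta> in \<nu>. (\<lambda>n. trace_avg \<alpha> A u n \<zeta>) \<longlonglongrightarrow> ereal (?tr u \<zeta>)"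
        using est by auto
    next
      fix gu assume gu: "minimal_weak_upper_gradient Xe (mu \<beta>) p u gu"
      then have "weak_upper_gradient Xe (mu \<beta>) p u gu" "Lp_energy (mu \<beta>) p gu < \<infinity>"
        by (auto simp: minimal_weak_upper_gradient_def)
      note est' = C1(2)[OF this]
      show "besov_seminorm \<nu> \<theta> p (?tr u) \<le> ennreal (C1 + C2) * Lp_norm (mu \<beta>) p gu" by (rule up) (use est' in blast)
      show "Lp_norm \<nu> p (\<lambda>\<zeta>. ennreal \<bar>?tr u \<zeta>\<bar>) \<le> ennreal (C1 + C2) * (e2ennreal \<bar>u root\<bar> + Lp_norm (mu \<beta>) p gu)"
        by (rule up) (use est' in blast)
      show "e2ennreal \<bar>u root\<bar> + Lp_norm (mu \<beta>) p gu \<le> ennreal (C1 + C2) * newtonian_seminorm Xe (mu \<beta>) p u"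
        by (rule up) (use C2(2)[OF u gu] in blast)
    next
      fix f \<iota> and Xbar :: "'c metric"
      assume f: "Lipschitz_continuous_map Xe euclidean_metric f \<and> (\<forall>x\<in>mspace Xe. u x = ereal (f x))"
        and compl: "is_completion Xe Xbar \<iota>"
      have "real_of_ereal (u (vertex_pt v)) = f (vertex_pt v)" if "v \<in> fill_vertices A" for v
        using f vertex_in_pts[OF that] by simp
      from Lipschitz_trace[OF conjunct1[OF f] compl, of "\<lambda>v. real_of_ereal (u (vertex_pt v))", OF this]
      show "\<exists>uhat. Lipschitz_continuous_map Xbar euclidean_metric uhat \<and>
             (\<forall>x\<in>mspace Xe. uhat (\<iota> x) = f x) \<and>
             (\<forall>h. Lipschitz_continuous_map Xbar euclidean_metric h \<and>
                  (\<forall>x\<in>mspace Xe. h (\<iota> x) = f x) \<longrightarrow> (\<forall>q\<in>mspace Xbar. h q = uhat q)) \<and>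
             (\<forall>\<zeta>. ?tr u \<zeta> = uhat (boundary_map \<alpha> A Xbar \<iota> \<zeta>))"
        unfolding mspace_Xe .
    qed
  qed
qed

end
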